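(* Let $\mathbb{K}$ be a non-archimedean field that is complete with respect to its non-trivial valuation. Let $X$ be an infinite-dimensional Fréchet space over $\mathbb{K}$ which is not isomorphic to any of the following spaces: $c_0$, $c_0\times\mathbb{K}^{\mathbb{N}}$, $\mathbb{K}^{\mathbb{N}}$. Then $X$ contains an infinite-dimensional closed subspace without a strongly finite-dimensional Schauder decomposition.
   Context: All locally convex spaces are Hausdorff and over $\mathbb{K}$, with topology generated by non-archimedean seminorms, i.e. seminorms $p$ satisfying $p(x+y)\le\max\{p(x),p(y)\}$ and $p(ax)=|a|p(x)$. A Fréchet space is a complete metrizable locally convex space. Isomorphic means linearly homeomorphic. $c_0$ is the Banach space of all sequences in $\mathbb{K}$ converging to zero (with the sup norm), and $\mathbb{K}^{\mathbb{N}}$ is the Fréchet space of all sequences in $\mathbb{K}$ with the topology of pointwise convergence. For a locally convex space $E$, let $L(E)$ be the space of continuous linear maps from $E$ to itself. A sequence $(P_n)\subset L(E)$ is a Schauder decomposition of $E$ if $x=\sum_{n=1}^\infty P_nx$ for every $x\in E$, and $P_nP_m=\delta_{nm}P_n$ for all $n,m\in\mathbb{N}$. It is strongly finite-dimensional if $\sup_n\dim P_n(E)<\infty$. *)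

theory Defs
  imports "HOL-Analysis.Analysis" "HOL-Library.Function_Algebras"
begin

text \<open>A space is given by a scalar multiplication \<open>s\<close> on a type of vectors together with an abstract
  topology \<open>T\<close>; its underlying set is \<open>topspace T\<close>, a linear subspace of the type. A linear subspace
  \<open>D\<close> of it is then the space with topology \<open>subtopology T D\<close>.\<close>

locale nonarch_valuation =
  fixes v :: "'k::field \<Rightarrow> real"
  assumes nonneg: "0 \<le> v a"
    and eq_0_iff: "v a = 0 \<longleftrightarrow> a = 0"
    and mult: "v (a * b) = v a * v b"
    and ultrametric: "v (a + b) \<le> max (v a) (v b)"

definition val_dist :: "('k::field \<Rightarrow> real) \<Rightarrow> 'k \<Rightarrow> 'k \<Rightarrow> real" where
  "val_dist v a b = v (a - b)"

locale complete_nonarch_field = nonarch_valuation v for v :: "'k::field \<Rightarrow> real" +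
  assumes nontrivial: "\<exists>a. a \<noteq> 0 \<and> v a \<noteq> 1"
    and complete: "Metric_space.mcomplete UNIV (val_dist v)"

definition nonarch_seminorm ::
    "('k::field \<Rightarrow> real) \<Rightarrow> ('k \<Rightarrow> 'b::ab_group_add \<Rightarrow> 'b) \<Rightarrow> 'b set \<Rightarrow> ('b \<Rightarrow> real) \<Rightarrow> bool" where
  "nonarch_seminorm v s E p \<longleftrightarrow>
     (\<forall>x\<in>E. 0 \<le> p x) \<and>
     (\<forall>x\<in>E. \<forall>y\<in>E. p (x + y) \<le> max (p x) (p y)) \<and>
     (\<forall>a. \<forall>x\<in>E. p (s a x) = v a * p x)"

text \<open>The set \<open>E\<close> itself is among the generators so that \<open>E\<close> is the whole space even if \<open>Q\<close> is empty.\<close>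

definition seminorm_topology :: "'b::ab_group_add set \<Rightarrow> ('b \<Rightarrow> real) set \<Rightarrow> 'b topology" where
  "seminorm_topology E Q =
     topology_generated_by (insert E {{y\<in>E. p (y - x) < r} |p x r. p \<in> Q \<and> x \<in> E \<and> 0 < r})"

definition lcs :: "('k::field \<Rightarrow> real) \<Rightarrow> ('k \<Rightarrow> 'b::ab_group_add \<Rightarrow> 'b) \<Rightarrow> 'b topology \<Rightarrow> bool" where
  "lcs v s T \<longleftrightarrow>
     vector_space s \<and> module.subspace s (topspace T) \<and> Hausdorff_space T \<and>
     (\<exists>Q. (\<forall>p\<in>Q. nonarch_seminorm v s (topspace T) p) \<and> T = seminorm_topology (topspace T) Q)"

text \<open>Completeness for the translation-invariant uniformity: every Cauchy filter converges.\<close>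

definition cauchy_filter_in :: "'b::ab_group_add topology \<Rightarrow> 'b filter \<Rightarrow> bool" where
  "cauchy_filter_in T F \<longleftrightarrow>
     F \<noteq> bot \<and> (\<forall>\<^sub>F x in F. x \<in> topspace T) \<and>
     (\<forall>U. openin T U \<and> 0 \<in> U \<longrightarrow> (\<forall>\<^sub>F (x, y) in F \<times>\<^sub>F F. x - y \<in> U))"

definition complete_tvs :: "'b::ab_group_add topology \<Rightarrow> bool" where
  "complete_tvs T \<longleftrightarrow> (\<forall>F. cauchy_filter_in T F \<longrightarrow> (\<exists>l. limitin T (\<lambda>x. x) l F))"

definition frechet_space ::
    "('k::field \<Rightarrow> real) \<Rightarrow> ('k \<Rightarrow> 'b::ab_group_add \<Rightarrow> 'b) \<Rightarrow> 'b topology \<Rightarrow> bool" where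
  "frechet_space v s T \<longleftrightarrow> lcs v s T \<and> metrizable_space T \<and> complete_tvs T"

definition linear_map_on ::
    "('k::field \<Rightarrow> 'b::ab_group_add \<Rightarrow> 'b) \<Rightarrow> ('k \<Rightarrow> 'c::ab_group_add \<Rightarrow> 'c) \<Rightarrow> 'b set \<Rightarrow> ('b \<Rightarrow> 'c) \<Rightarrow> bool"
  where
  "linear_map_on s s' E f \<longleftrightarrow>
     (\<forall>x\<in>E. \<forall>y\<in>E. f (x + y) = f x + f y) \<and> (\<forall>a. \<forall>x\<in>E. f (s a x) = s' a (f x))"

definition lcs_isomorphic ::
    "('k::field \<Rightarrow> 'b::ab_group_add \<Rightarrow> 'b) \<Rightarrow> 'b topology \<Rightarrow>
     ('k \<Rightarrow> 'c::ab_group_add \<Rightarrow> 'c) \<Rightarrow> 'c topology \<Rightarrow> bool" where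
  "lcs_isomorphic s T s' T' \<longleftrightarrow>
     (\<exists>f. linear_map_on s s' (topspace T) f \<and> homeomorphic_map T T' f)"

definition continuous_endomorphisms ::
    "('k::field \<Rightarrow> 'b::ab_group_add \<Rightarrow> 'b) \<Rightarrow> 'b topology \<Rightarrow> ('b \<Rightarrow> 'b) set" where
  "continuous_endomorphisms s T = {A. linear_map_on s s (topspace T) A \<and> continuous_map T T A}"

text \<open>Needed because \<open>vector_space.dim\<close> is \<open>0\<close> on infinite-dimensional subspaces.\<close>

definition finite_dim :: "('k::field \<Rightarrow> 'b::ab_group_add \<Rightarrow> 'b) \<Rightarrow> 'b set \<Rightarrow> bool" where
  "finite_dim s V \<longleftrightarrow> (\<exists>B. finite B \<and> V \<subseteq> module.span s B)"

definition schauder_decomposition ::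
    "('k::field \<Rightarrow> 'b::ab_group_add \<Rightarrow> 'b) \<Rightarrow> 'b topology \<Rightarrow> (nat \<Rightarrow> 'b \<Rightarrow> 'b) \<Rightarrow> bool" where
  "schauder_decomposition s T P \<longleftrightarrow>
     (\<forall>n. P n \<in> continuous_endomorphisms s T) \<and>
     (\<forall>x\<in>topspace T. limitin T (\<lambda>N. \<Sum>n<N. P n x) x sequentially) \<and>
     (\<forall>n m. \<forall>x\<in>topspace T. P n (P m x) = (if n = m then P n x else 0))"

definition strongly_finite_dimensional ::
    "('k::field \<Rightarrow> 'b::ab_group_add \<Rightarrow> 'b) \<Rightarrow> 'b topology \<Rightarrow> (nat \<Rightarrow> 'b \<Rightarrow> 'b) \<Rightarrow> bool" where
  "strongly_finite_dimensional s T P \<longleftrightarrow>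
     (\<exists>N. \<forall>n. finite_dim s (P n ` topspace T) \<and> vector_space.dim s (P n ` topspace T) \<le> N)"

definition seq_scale :: "'k::field \<Rightarrow> (nat \<Rightarrow> 'k) \<Rightarrow> nat \<Rightarrow> 'k" where
  "seq_scale a x = (\<lambda>n. a * x n)"

definition prod_scale ::
    "('k::field \<Rightarrow> 'b \<Rightarrow> 'b) \<Rightarrow> ('k \<Rightarrow> 'c \<Rightarrow> 'c) \<Rightarrow> 'k \<Rightarrow> 'b \<times> 'c \<Rightarrow> 'b \<times> 'c" where
  "prod_scale s s' a z = (s a (fst z), s' a (snd z))"

definition c0_carrier :: "('k::field \<Rightarrow> real) \<Rightarrow> (nat \<Rightarrow> 'k) set" where
  "c0_carrier v = {x. (\<lambda>n. v (x n)) \<longlonglongrightarrow> 0}"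

definition sup_norm :: "('k::field \<Rightarrow> real) \<Rightarrow> (nat \<Rightarrow> 'k) \<Rightarrow> real" where
  "sup_norm v x = (SUP n. v (x n))"

definition c0_space :: "('k::field \<Rightarrow> real) \<Rightarrow> (nat \<Rightarrow> 'k) topology" where
  "c0_space v = seminorm_topology (c0_carrier v) {sup_norm v}"

definition seq_space :: "('k::field \<Rightarrow> real) \<Rightarrow> (nat \<Rightarrow> 'k) topology" where
  "seq_space v = product_topology (\<lambda>_. Metric_space.mtopology UNIV (val_dist v)) UNIV"

end

theory Submission
  imports Defs
begin

text \<open>
  If \<open>X\<close> itself has no strongly finite-dimensional Schauder decomposition, there is nothing to do. Let
  \<open>P\<close> be one. By the Banach--Steinhaus theorem (\<open>uniform_boundedness\<close>) the projections are
  equicontinuous, so the topology is defined by seminorms \<open>p 0 \<le> p 1 \<le> \<dots>\<close> for which \<open>p k x\<close> is the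
  supremum of \<open>p k (P n x)\<close> over \<open>n\<close> (\<open>ex_orthogonal\<close>). There are two cases.

  Suppose that for some \<open>m\<close> every \<open>p k\<close> is bounded by a multiple of \<open>p m\<close> on all but finitely many of
  the components \<open>P n X\<close>. These have bounded dimension, so they have bases that are orthogonal
  with respect to \<open>p m\<close> up to a common constant (\<open>almost_orthogonal_basis_with_kernel\<close>). The
  coordinates with respect to the basis vectors with \<open>p m b \<noteq> 0\<close> are those of a \<open>c\<^sub>0\<close> space, and the
  remaining ones are those of a power of \<open>K\<close> (\<open>ex_coordinates\<close>). Hence \<open>X\<close> is one of the three
  exceptional spaces (\<open>isomorphic_to_exceptional\<close>).

  Otherwise for every \<open>m\<close> there is a \<open>\<kappa> m\<close> such that the quotient of \<open>p (\<kappa> m)\<close> and \<open>p m\<close> takes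
  arbitrarily large values on infinitely many components. Then there are vectors \<open>y\<^sub>0, \<dots>, y\<^sub>d\<close> in
  different components which dominate each other in turns: \<open>y\<^sub>g\<close> is much larger than the
  other ones with respect to the seminorms from \<open>p (\<kappa> (l g))\<close> to \<open>p (l (g + 1))\<close> (\<open>ex_block\<close>).
  In the span \<open>F\<close> of the \<open>d\<close> vectors \<open>y\<^sub>g + y\<^sub>d\<close>, \<open>g < d\<close>, an operator that is bounded from \<open>p (l (g + 1))\<close>
  to \<open>p (\<kappa> (l g))\<close> almost preserves the hyperplane of vectors without \<open>y\<^sub>g\<close>-component. These \<open>d + 1\<close>
  hyperplanes are in general position, so an operator that is bounded at all these levels is
  almost a multiple of the identity; if its rank is less than \<open>d\<close>, the factor is small, by the
  ultrametric inequality. The subspace sought contains blocks of this kind for all \<open>d\<close>, all sequences of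
  levels and all constants (\<open>ex_blocks\<close>). In it, a strongly finite-dimensional decomposition would
  write the identity of a suitable block as a sum of operators of small rank, each of them
  almost a small multiple of the identity, which the ultrametric inequality forbids
  (\<open>no_strongly_finite_dimensional_decomposition\<close>).
\<close>

section \<open>The valuation\<close>

context nonarch_valuation
begin

lemma v_0 [simp]: "v 0 = 0"
  by (simp add: eq_0_iff)

lemma v_1 [simp]: "v 1 = 1"
proof -
  have "v 1 * v 1 = v 1" using mult[of 1 1] by simp
  moreover have "v 1 \<noteq> 0" by (simp add: eq_0_iff)
  ultimately show ?thesis by simp
qed

lemma v_pos: "a \<noteq> 0 \<Longrightarrow> 0 < v a"
  using nonneg[of a] eq_0_iff[of a] by linarith

lemma v_minus [simp]: "v (- a) = v a"
proof -
  have "v (-1) * v (-1) = 1" using mult[of "-1" "-1"] by simp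
  then have "v (-1) = 1" using nonneg[of "-1"] by (metis abs_of_nonneg abs_square_eq_1 power2_eq_square)
  then show ?thesis using mult[of "-1" a] by simp
qed

lemma v_diff: "v (a - b) \<le> max (v a) (v b)"
  using ultrametric[of a "- b"] by simp

lemma v_inverse: "v (inverse a) = inverse (v a)"
proof (cases "a = 0")
  case False
  then have "v (inverse a) * v a = 1" using mult[of "inverse a" a] by simp
  then show ?thesis using False by (metis inverse_unique mult.commute)
qed simp

lemma v_divide: "v (a / b) = v a / v b"
  by (simp add: divide_inverse mult v_inverse)

lemma v_power: "v (a ^ n) = v a ^ n"
  by (induction n) (auto simp: mult)

lemma v_sum_less: "(\<And>i. i \<in> I \<Longrightarrow> v (f i) < c) \<Longrightarrow> 0 < c \<Longrightarrow> v (sum f I) < c"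
proof (induction I rule: infinite_finite_induct)
  case (insert x F)
  then have "v (sum f F) < c" "v (f x) < c" by auto
  then show ?case using insert.hyps ultrametric[of "f x" "sum f F"] by simp
qed auto

lemma v_add_eq: "v a < v b \<Longrightarrow> v (a + b) = v b"
  using ultrametric[of a b] ultrametric[of "a + b" "- a"] by (auto simp: max_def split: if_splits)

lemma v_eq_if_close: "v (a - b) < v b \<Longrightarrow> v a = v b"
  using v_add_eq[of "a - b" b] by simp

lemma metric: "Metric_space UNIV (val_dist v)"
proof
  show "0 \<le> val_dist v x y" for x y by (simp add: val_dist_def nonneg)
  show "val_dist v x y = val_dist v y x" for x y
    unfolding val_dist_def using v_minus[of "x - y"] by simp
  show "val_dist v x y = 0 \<longleftrightarrow> x = y" for x y by (simp add: val_dist_def eq_0_iff)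
  show "val_dist v x z \<le> val_dist v x y + val_dist v y z" for x y z
    unfolding val_dist_def using ultrametric[of "x - y" "y - z"] nonneg[of "x - y"] nonneg[of "y - z"] by simp
qed

end

context complete_nonarch_field
begin

lemma ex_contracting: "\<exists>a. 0 < v a \<and> v a < 1"
proof -
  obtain a where a: "a \<noteq> 0" "v a \<noteq> 1" using nontrivial by auto
  show ?thesis
  proof (cases "v a < 1")
    case True then show ?thesis using a v_pos by blast
  next
    case False
    then have "1 < v a" using a by linarith
    then show ?thesis using a by (intro exI[of _ "inverse a"]) (simp add: v_inverse inverse_less_1_iff)
  qed
qed

definition step :: real where
  "step = v (SOME a. 0 < v a \<and> v a < 1)"

lemma step: "0 < step" "step < 1"
  using someI_ex[OF ex_contracting] by (auto simp: step_def)

text \<open>The value group is unbounded in both directions with gaps of ratio at most \<open>1 / step\<close>; hence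
  every positive number can be scaled into a prescribed interval of that ratio.\<close>

lemma ex_scaling:
  assumes c: "0 < c" and r: "0 < r"
  shows "\<exists>a. a \<noteq> 0 \<and> step * r < v a * c \<and> v a * c \<le> r"
proof -
  obtain a where a: "v a = step" unfolding step_def by auto
  have a0: "a \<noteq> 0" using a step by auto
  have "\<exists>n. step ^ n < r / c" using real_arch_pow_inv[of "r / c" step] step c r by auto
  then obtain n where n: "step ^ n < r / c" by auto
  have "\<exists>n. step ^ n < c / r" using real_arch_pow_inv[of "c / r" step] step c r by auto
  then obtain m where m: "step ^ m < c / r" by auto
  define P where "P j \<longleftrightarrow> step ^ j / step ^ m * c \<le> r" for j
  have "P (n + m)" unfolding P_def using n c step by (simp add: power_add field_simps)
  define j where "j = (LEAST j. P j)"
  have Pj: "P j" unfolding j_def using \<open>P (n + m)\<close> by (rule LeastI)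
  have "\<not> P 0" unfolding P_def using m c r step by (simp add: field_simps)
  then obtain i where i: "j = Suc i" using Pj by (cases j) auto
  have "\<not> P i" unfolding j_def using i j_def not_less_Least by (metis lessI)
  then have "step * r < step ^ j / step ^ m * c" unfolding P_def i using step by (simp add: field_simps)
  moreover have "v (a ^ j / a ^ m) = step ^ j / step ^ m" by (simp add: v_divide v_power a)
  ultimately show ?thesis using Pj a0 by (intro exI[of _ "a ^ j / a ^ m"]) (auto simp: P_def)
qed

lemma cauchy_scalars_converge:
  assumes "\<And>e. 0 < e \<Longrightarrow> \<exists>N. \<forall>m\<ge>N. \<forall>n\<ge>N. v (a m - a n) < e"
  shows "\<exists>l. (\<lambda>n. v (a n - l)) \<longlonglongrightarrow> 0"
proof -
  interpret K: Metric_space UNIV "val_dist v" by (rule metric)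
  have "K.MCauchy a" unfolding K.MCauchy_def val_dist_def using assms by simp
  then obtain l where "limitin K.mtopology a l sequentially" using complete unfolding K.mcomplete_def by blast
  then have l: "\<exists>N. \<forall>n\<ge>N. v (a n - l) < e" if "0 < e" for e
    using that unfolding K.limit_metric_sequentially val_dist_def by auto
  have "(\<lambda>n. v (a n - l)) \<longlonglongrightarrow> 0"
    unfolding LIMSEQ_iff using l nonneg by simp
  then show ?thesis ..
qed

end

section \<open>Ultrametric seminorms\<close>

locale nonarch_vector_space = complete_nonarch_field v + vector_space s
  for v :: "'k::field \<Rightarrow> real" and s :: "'k \<Rightarrow> 'b::ab_group_add \<Rightarrow> 'b" +
  fixes E :: "'b set"
  assumes subspace_E: "subspace E"
begin

abbreviation seminorm :: "('b \<Rightarrow> real) \<Rightarrow> bool" where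
  "seminorm \<equiv> nonarch_seminorm v s E"

lemmas E_0 [simp] = subspace_0[OF subspace_E]
  and E_add = subspace_add[OF subspace_E]
  and E_diff = subspace_diff[OF subspace_E]
  and E_scale = subspace_scale[OF subspace_E]
  and E_neg = subspace_neg[OF subspace_E]
  and E_sum = subspace_sum[OF subspace_E]

lemma span_in_E: "J \<subseteq> E \<Longrightarrow> span J \<subseteq> E"
  by (rule span_minimal[OF _ subspace_E])

text \<open>Homogeneity follows from one inequality, applied to a scalar and to its inverse.\<close>

lemma seminormI:
  assumes nonneg: "\<And>x. x \<in> E \<Longrightarrow> 0 \<le> h x"
    and add: "\<And>x y. x \<in> E \<Longrightarrow> y \<in> E \<Longrightarrow> h (x + y) \<le> max (h x) (h y)"
    and scale: "\<And>a x. x \<in> E \<Longrightarrow> h (s a x) \<le> v a * h x"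
  shows "seminorm h"
proof -
  have "h (s a x) = v a * h x" if x: "x \<in> E" for a x
  proof (cases "a = 0")
    case True
    then show ?thesis using scale[OF x, of 0] nonneg[OF E_0] by simp
  next
    case False
    have "v a * h x = v a * h (s (inverse a) (s a x))" using False by simp
    also have "\<dots> \<le> v a * (v (inverse a) * h (s a x))"
      using v_pos[OF False] x by (intro mult_left_mono scale E_scale) auto
    also have "\<dots> = h (s a x)" using v_pos[OF False] by (simp add: v_inverse)
    finally show ?thesis using scale[OF x, of a] by simp
  qed
  then show ?thesis unfolding nonarch_seminorm_def using nonneg add by blast
qed

context
  fixes h assumes h: "seminorm h"
begin

lemma sn_nonneg: "x \<in> E \<Longrightarrow> 0 \<le> h x"
  using h by (auto simp: nonarch_seminorm_def)

lemma sn_add: "x \<in> E \<Longrightarrow> y \<in> E \<Longrightarrow> h (x + y) \<le> max (h x) (h y)"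
  using h by (auto simp: nonarch_seminorm_def)

lemma sn_scale: "x \<in> E \<Longrightarrow> h (s a x) = v a * h x"
  using h by (auto simp: nonarch_seminorm_def)

lemma sn_0: "h 0 = 0"
  using sn_scale[of 0 0] by simp

lemma sn_minus: "x \<in> E \<Longrightarrow> h (- x) = h x"
  using sn_scale[of x "-1"] by simp

lemma sn_diff: "x \<in> E \<Longrightarrow> y \<in> E \<Longrightarrow> h (x - y) \<le> max (h x) (h y)"
  using sn_add[of x "- y"] by (simp add: sn_minus E_neg)

lemma sn_commute: "x \<in> E \<Longrightarrow> y \<in> E \<Longrightarrow> h (x - y) = h (y - x)"
  using sn_minus[of "x - y"] by (simp add: E_diff)

lemma sn_triangle: "x \<in> E \<Longrightarrow> y \<in> E \<Longrightarrow> z \<in> E \<Longrightarrow> h (x - z) \<le> max (h (x - y)) (h (y - z))"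
  using sn_add[of "x - y" "y - z"] by (simp add: E_diff)

lemma sn_sum: "(\<And>i. i \<in> I \<Longrightarrow> x i \<in> E \<and> h (x i) \<le> c) \<Longrightarrow> 0 \<le> c \<Longrightarrow> h (sum x I) \<le> c"
proof (induction I rule: infinite_finite_induct)
  case (insert a F)
  then have "h (x a + sum x F) \<le> max (h (x a)) (h (sum x F))" by (intro sn_add E_sum) auto
  also have "\<dots> \<le> c" using insert by auto
  finally show ?case using insert by simp
qed (auto simp: sn_0)

lemma sn_sum_less: "(\<And>i. i \<in> I \<Longrightarrow> x i \<in> E \<and> h (x i) < c) \<Longrightarrow> 0 < c \<Longrightarrow> h (sum x I) < c"
proof (induction I rule: infinite_finite_induct)
  case (insert a F)
  then have "h (x a + sum x F) \<le> max (h (x a)) (h (sum x F))" by (intro sn_add E_sum) auto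
  also have "\<dots> < c" using insert by auto
  finally show ?case using insert by simp
qed (auto simp: sn_0)

text \<open>The isosceles triangle principle.\<close>

lemma sn_add_eq: "x \<in> E \<Longrightarrow> y \<in> E \<Longrightarrow> h x < h y \<Longrightarrow> h (x + y) = h y"
  using sn_add[of x y] sn_diff[of "x + y" x] by (auto simp: E_add max_def split: if_splits)

lemma sn_add_kernel: "x \<in> E \<Longrightarrow> y \<in> E \<Longrightarrow> h x = 0 \<Longrightarrow> h (x + y) = h y"
  using sn_add[of x y] sn_diff[of "x + y" x] sn_nonneg[of y] sn_nonneg[of "x + y"]
  by (auto simp: E_add max_def split: if_splits)

lemma sn_kernel_subspace: "subspace V \<Longrightarrow> V \<subseteq> E \<Longrightarrow> subspace {x \<in> V. h x = 0}"
  unfolding subspace_def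
  using sn_0 sn_scale sn_add_kernel by (auto simp: subset_iff)

text \<open>Every vector with \<open>g x \<noteq> 0\<close> can be scaled into the ball, up to a bounded factor; for \<open>g x = 0\<close> all
  its multiples lie in the ball, so \<open>h x = 0\<close>.\<close>

lemma sn_dominated:
  assumes g: "seminorm g" and r: "0 < r" and ball: "\<And>x. x \<in> E \<Longrightarrow> g x < r \<Longrightarrow> h x \<le> c"
  shows "\<exists>C>0. \<forall>x\<in>E. h x \<le> C * g x"
proof -
  have g_scale: "g (s a x) = v a * g x" and g_nonneg: "0 \<le> g x" if "x \<in> E" for a x
    using g that by (auto simp: nonarch_seminorm_def)
  have c0: "0 \<le> c" using ball[of 0] sn_0 g_scale[of 0 0] r by simp
  define C where "C = (c + 1) / (step * (r / 2))"
  have C: "0 < C" unfolding C_def using c0 r step by simp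
  have "h x \<le> C * g x" if x: "x \<in> E" for x
  proof (cases "g x = 0")
    case True
    have "h x = 0"
    proof (rule ccontr)
      assume "h x \<noteq> 0"
      then have "0 < h x" using sn_nonneg[OF x] by linarith
      then obtain a where a: "step * ((c + 1) / step) < v a * h x"
        using ex_scaling[of "h x" "(c + 1) / step"] c0 step by auto
      have "h (s a x) \<le> c" using ball[of "s a x"] E_scale[OF x] g_scale[OF x] True r by simp
      then show False using a sn_scale[OF x] step by simp
    qed
    then show ?thesis using True by simp
  next
    case False
    then have "0 < g x" using g_nonneg[OF x] by linarith
    then obtain a where a: "a \<noteq> 0" "step * (r / 2) < v a * g x" "v a * g x \<le> r / 2"
      using ex_scaling[of "g x" "r / 2"] r by auto
    have "v a * h x \<le> c" using ball[of "s a x"] E_scale[OF x] g_scale[OF x] sn_scale[OF x] a r by simp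
    have "v a * h x * (step * (r / 2)) \<le> (c + 1) * (v a * g x)"
      by (rule mult_mono) (use \<open>v a * h x \<le> c\<close> a c0 r step in auto)
    then have "v a * (h x * (step * (r / 2))) \<le> v a * ((c + 1) * g x)" by (simp only: mult_ac)
    then have "h x * (step * (r / 2)) \<le> (c + 1) * g x"
      using v_pos[OF a(1)] by (simp only: mult_le_cancel_left_pos)
    then show ?thesis unfolding C_def using r step by (simp add: field_simps)
  qed
  then show ?thesis using C by blast
qed

end

end

section \<open>Finite-dimensional subspaces\<close>

context vector_space
begin

lemma dependent_family:
  assumes fin: "finite B" and sub: "\<And>i. i < d \<Longrightarrow> g i \<in> span B" and card: "card B < d"
  shows "\<exists>a. (\<exists>i<d. a i \<noteq> 0) \<and> (\<Sum>i<d. scale (a i) (g i)) = 0"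
proof (cases "inj_on g {..<d}")
  case False
  then obtain i j where ij: "i < d" "j < d" "i \<noteq> j" "g i = g j" by (auto simp: inj_on_def)
  define a where "a l = (if l = i then 1 else if l = j then - 1 else (0::'a))" for l
  have "(\<Sum>l<d. scale (a l) (g l)) = (\<Sum>l\<in>{i, j}. scale (a l) (g l))"
    by (rule sum.mono_neutral_right) (use ij in \<open>auto simp: a_def\<close>)
  also have "\<dots> = 0" using ij by (simp add: a_def)
  finally show ?thesis using ij by (intro exI[of _ a]) (auto simp: a_def)
next
  case True
  have "dependent (g ` {..<d})"
  proof (rule ccontr)
    assume "\<not> dependent (g ` {..<d})"
    then have "card (g ` {..<d}) \<le> card B"
      using independent_span_bound[OF fin, of "g ` {..<d}"] sub by auto
    then show False using card card_image[OF True] by simp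
  qed
  then obtain u w where u: "w \<in> g ` {..<d}" "u w \<noteq> 0" "(\<Sum>w\<in>g ` {..<d}. scale (u w) w) = 0"
    using dependent_finite[of "g ` {..<d}"] by auto
  then show ?thesis using sum.reindex[OF True, of "\<lambda>w. scale (u w) w"]
    by (intro exI[of _ "\<lambda>i. u (g i)"]) auto
qed

lemma finite_dimE:
  assumes "finite_dim scale V"
  obtains B where "finite B" "V \<subseteq> span B" "card B = dim V"
proof -
  obtain B0 where B0: "finite B0" "V \<subseteq> span B0" using assms unfolding finite_dim_def by blast
  obtain B where B: "B \<subseteq> V" "independent B" "V \<subseteq> span B" "card B = dim V" by (rule basis_exists)
  have "finite B" using independent_span_bound[OF B0(1) B(2)] B(1) B0(2) by auto
  then show thesis using that B by blast
qed

lemma representation_sum_basis: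
  assumes "finite J" "independent J" "b \<in> J"
  shows "representation J (\<Sum>b\<in>J. scale (f b) b) b = f b"
proof -
  have "representation J (\<Sum>b\<in>J. scale (f b) b) b = (\<Sum>b'\<in>J. f b' * representation J b' b)"
    using representation_sum[OF assms(2), of J "\<lambda>b. scale (f b) b"]
    by (simp add: representation_scale[OF assms(2)] span_base span_scale)
  also have "\<dots> = (\<Sum>b'\<in>J. if b' = b then f b' else 0)"
    by (rule sum.cong) (auto simp: representation_basis[OF assms(2)])
  finally show ?thesis using assms by (simp add: sum.delta)
qed

end

context nonarch_vector_space
begin

lemma sn_mono:
  assumes "\<And>k x. x \<in> E \<Longrightarrow> p k x \<le> p (Suc k) x" "j \<le> k" "x \<in> E"
  shows "p j x \<le> (p k x :: real)"
  using assms(2) by (induction k rule: dec_induct) (auto intro: order_trans assms(1)[OF assms(3)])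

text \<open>If the coordinates are bounded by one of the seminorms, approximations within \<open>span J\<close> are
  Cauchy in each coordinate, and completeness of the scalars provides a limit.\<close>

lemma span_closed_if_coordinates_bounded:
  assumes p: "\<And>k. seminorm (p k)" and mono: "\<And>k x. x \<in> E \<Longrightarrow> p k x \<le> p (Suc k) x"
    and J: "finite J" "J \<subseteq> E"
    and bound: "\<And>c b. b \<in> J \<Longrightarrow> v (c b) \<le> C * p k0 (\<Sum>b\<in>J. s (c b) b)" and C: "0 < C"
    and z: "z \<in> E" and near: "\<And>k e. 0 < e \<Longrightarrow> \<exists>w\<in>span J. p k (z - w) < e"
  shows "\<exists>w\<in>span J. \<forall>k. p k (z - w) = 0"
proof -
  let ?w = "\<lambda>c. \<Sum>b\<in>J. s (c b) b"
  have wE: "?w c \<in> E" for c using J by (intro E_sum E_scale) auto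
  have "\<exists>c. p i (z - ?w c) < 1 / real (Suc i)" for i
    using near[of "1 / real (Suc i)" i] span_finite[OF J(1)] by auto
  then obtain c where c: "\<And>i. p i (z - ?w (c i)) < 1 / real (Suc i)" by metis
  have close: "p k (z - ?w (c i)) < 1 / real (Suc n)" if "k \<le> n" "n \<le> i" for k i n
  proof -
    have "p k (z - ?w (c i)) \<le> p i (z - ?w (c i))"
      by (rule sn_mono[of p, OF mono]) (use that z wE E_diff in auto)
    also have "\<dots> < 1 / real (Suc i)" by (rule c)
    also have "\<dots> \<le> 1 / real (Suc n)" using that by (simp add: field_simps)
    finally show ?thesis .
  qed
  have wdiff: "?w (\<lambda>b. c1 b - c2 b) = ?w c1 - ?w c2" for c1 c2
    by (simp add: scale_left_diff_distrib sum_subtractf)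
  have cauchy: "v (c i b - c j b) < C / real (Suc n)" if b: "b \<in> J" and n: "k0 \<le> n" "n \<le> i" "n \<le> j" for i j n b
  proof -
    have "v (c i b - c j b) \<le> C * p k0 (?w (c i) - ?w (c j))"
      using bound[OF b, of "\<lambda>b. c i b - c j b"] by (simp add: wdiff)
    also have "p k0 (?w (c i) - ?w (c j)) \<le> max (p k0 (?w (c i) - z)) (p k0 (z - ?w (c j)))"
      by (rule sn_triangle[OF p]) (use wE z in auto)
    also have "p k0 (?w (c i) - z) = p k0 (z - ?w (c i))" by (rule sn_commute[OF p wE z])
    also have "max \<dots> (p k0 (z - ?w (c j))) < 1 / real (Suc n)" using close n by auto
    finally show ?thesis using C by (simp add: field_simps)
  qed
  have "\<exists>l. (\<lambda>i. v (c i b - l)) \<longlonglongrightarrow> 0" if b: "b \<in> J" for b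
  proof (rule cauchy_scalars_converge)
    fix e :: real assume e: "0 < e"
    obtain n where n: "C / e < real n" using reals_Archimedean2 by auto
    have "v (c i b - c j b) < e" if "max k0 n \<le> i" "max k0 n \<le> j" for i j
    proof -
      have "v (c i b - c j b) < C / real (Suc (max k0 n))" by (rule cauchy[OF b _ that]) auto
      also have "\<dots> \<le> e" using n e C by (simp add: field_simps) (smt (verit) mult_left_mono of_nat_mono max.cobounded2)
      finally show ?thesis .
    qed
    then show "\<exists>N. \<forall>m\<ge>N. \<forall>n\<ge>N. v (c m b - c n b) < e" by blast
  qed
  then obtain l where l: "\<And>b. b \<in> J \<Longrightarrow> (\<lambda>i. v (c i b - l b)) \<longlonglongrightarrow> 0" by metis
  have "p k (z - ?w l) = 0" for k
  proof (rule ccontr)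
    assume "p k (z - ?w l) \<noteq> 0"
    then have d: "0 < p k (z - ?w l)" (is "0 < ?d") using sn_nonneg[OF p E_diff[OF z wE]] by (metis less_eq_real_def)
    have "(\<lambda>i. v (c i b - l b) * p k b) \<longlonglongrightarrow> 0 * p k b" if "b \<in> J" for b
      by (intro tendsto_mult l that tendsto_const)
    then have "\<forall>\<^sub>F i in sequentially. v (c i b - l b) * p k b < ?d" if "b \<in> J" for b
      using that d by (intro order_tendstoD(2)) auto
    then have ev: "\<forall>\<^sub>F i in sequentially. \<forall>b\<in>J. v (c i b - l b) * p k b < ?d"
      by (intro eventually_ball_finite J) auto
    obtain n0 where n0: "1 / ?d < real n0" using reals_Archimedean2 by auto
    obtain i where i: "max k n0 \<le> i" and small: "\<And>b. b \<in> J \<Longrightarrow> v (c i b - l b) * p k b < ?d"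
      using eventually_happens'[OF sequentially_bot eventually_conj[OF eventually_ge_at_top[of "max k n0"] ev]] by blast
    have "p k (?w (c i) - ?w l) = p k (\<Sum>b\<in>J. s (c i b - l b) b)" by (simp only: wdiff[symmetric])
    also have "\<dots> < ?d" by (rule sn_sum_less[OF p _ d]) (use small J sn_scale[OF p] E_scale in auto)
    finally have "p k (?w (c i) - ?w l) < ?d" .
    moreover have "p k (z - ?w (c i)) < ?d"
    proof -
      have "p k (z - ?w (c i)) < 1 / real (Suc i)" by (rule close) (use i in auto)
      also have "\<dots> \<le> ?d"
      proof -
        have "real n0 \<le> real i" using i by simp
        then have "1 / ?d \<le> real (Suc i)" using n0 by simp
        then show ?thesis using d by (simp add: field_simps)
      qed
      finally show ?thesis .
    qed
    ultimately show False using sn_triangle[OF p z wE wE, of k l "c i"] by simp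
  qed
  moreover have "?w l \<in> span J" by (intro span_sum span_scale span_base)
  ultimately show ?thesis by blast
qed

text \<open>The coordinate functionals of a finite basis are continuous: adding a vector \<open>y\<close>, the span of
  the previous ones is closed, hence \<open>y\<close> has positive distance to it.\<close>

lemma coordinates_bounded:
  assumes p: "\<And>k. seminorm (p k)" and mono: "\<And>k x. x \<in> E \<Longrightarrow> p k x \<le> p (Suc k) x"
    and J: "finite J" "J \<subseteq> E" "independent J"
    and sep: "\<And>x. x \<in> span J \<Longrightarrow> (\<And>k. p k x = 0) \<Longrightarrow> x = 0"
  shows "\<exists>k. \<exists>C>0. \<forall>c. \<forall>b\<in>J. v (c b) \<le> C * p k (\<Sum>b\<in>J. s (c b) b)"
  using J sep
proof (induction J rule: finite_induct)
  case empty
  then show ?case by (auto intro: exI[of _ 1])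
next
  case (insert y J)
  have ind: "independent J" using insert.prems independent_mono by blast
  have sp: "span J \<subseteq> span (insert y J)" by (rule span_mono) auto
  have yE: "y \<in> E" and JE: "J \<subseteq> E" using insert.prems by auto
  have ynot: "y \<notin> span J" using insert.prems(2) insert.hyps independent_insert by metis
  have "\<exists>k. \<exists>C>0. \<forall>c. \<forall>b\<in>J. v (c b) \<le> C * p k (\<Sum>b\<in>J. s (c b) b)"
    by (rule insert.IH[OF JE ind]) (use insert.prems(3) sp in auto)
  then obtain k1 C where C: "0 < C" and bound: "\<And>c b. b \<in> J \<Longrightarrow> v (c b) \<le> C * p k1 (\<Sum>b\<in>J. s (c b) b)"
    by blast
  have "\<exists>k0. \<exists>e>0. \<forall>w\<in>span J. e \<le> p k0 (y - w)"
  proof (rule ccontr)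
    assume "\<not> ?thesis"
    then have near: "\<exists>w\<in>span J. p k (y - w) < e" if "0 < e" for k e using that by (meson not_le)
    have "\<exists>w\<in>span J. \<forall>k. p k (y - w) = 0"
      by (rule span_closed_if_coordinates_bounded[of p, OF p mono insert.hyps(1) JE bound C yE near])
    then obtain w where w: "w \<in> span J" "\<And>k. p k (y - w) = 0" by auto
    have "y - w \<in> span (insert y J)"
      using w sp span_base[of y "insert y J"] by (intro span_diff) auto
    then have "y - w = 0" using insert.prems(3) w by blast
    then show False using w ynot by simp
  qed
  then obtain k0 e where e: "0 < e" "\<And>w. w \<in> span J \<Longrightarrow> e \<le> p k0 (y - w)" by blast
  define k where "k = max k0 k1"
  define D where "D = max (1 / e) (C * max 1 (p k y / e))"
  have D: "0 < D" unfolding D_def using e by (simp add: less_max_iff_disj)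
  have "v (c b) \<le> D * p k (\<Sum>b\<in>insert y J. s (c b) b)" if b: "b \<in> insert y J" for c b
  proof -
    let ?w = "\<Sum>b\<in>J. s (c b) b" and ?x = "\<Sum>b\<in>insert y J. s (c b) b"
    have x: "?x = s (c y) y + ?w" using insert.hyps by simp
    have wJ: "?w \<in> span J" by (intro span_sum span_scale span_base)
    have wE: "?w \<in> E" using JE by (intro E_sum E_scale) auto
    have xE: "?x \<in> E" unfolding x by (intro E_add E_scale yE wE)
    have y_le: "v (c y) * e \<le> p k ?x"
    proof (cases "c y = 0")
      case False
      have "e \<le> p k0 (y - s (- inverse (c y)) ?w)" by (intro e span_scale wJ)
      then have "v (c y) * e \<le> p k0 (s (c y) (y - s (- inverse (c y)) ?w))"
        using nonneg[of "c y"] by (simp add: sn_scale[OF p] yE wE E_diff E_scale mult_left_mono del: scale_minus_left)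
      also have "s (c y) (y - s (- inverse (c y)) ?w) = ?x" unfolding x using False by (simp add: scale_right_distrib)
      also have "p k0 ?x \<le> p k ?x" by (rule sn_mono[of p, OF mono _ xE]) (auto simp: k_def)
      finally show ?thesis .
    qed (use sn_nonneg[OF p xE] in simp)
    show ?thesis
    proof (cases "b = y")
      case True
      have "v (c b) \<le> 1 / e * p k ?x" using y_le e True by (simp add: field_simps)
      also have "\<dots> \<le> D * p k ?x" by (rule mult_right_mono) (auto simp: D_def sn_nonneg[OF p xE])
      finally show ?thesis .
    next
      case False
      then have "v (c b) \<le> C * p k1 ?w" using bound that by auto
      also have "p k1 ?w \<le> p k ?w" by (rule sn_mono[of p, OF mono _ wE]) (auto simp: k_def)
      also have "?w = ?x - s (c y) y" unfolding x by simp
      also have "p k \<dots> \<le> max (p k ?x) (v (c y) * p k y)"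
        using sn_diff[OF p xE E_scale[OF yE], of k "c y"] by (simp add: sn_scale[OF p] yE)
      also have "\<dots> \<le> max 1 (p k y / e) * p k ?x"
      proof -
        have "v (c y) * p k y \<le> p k ?x / e * p k y"
          using y_le e sn_nonneg[OF p yE, of k] by (intro mult_right_mono) (auto simp: field_simps)
        moreover have "p k ?x / e * p k y \<le> max 1 (p k y / e) * p k ?x" "1 * p k ?x \<le> max 1 (p k y / e) * p k ?x"
          using mult_right_mono[of "p k y / e" "max 1 (p k y / e)" "p k ?x"] mult_right_mono[of 1 "max 1 (p k y / e)" "p k ?x"]
            sn_nonneg[OF p xE, of k]
          by (auto simp: mult.commute)
        ultimately show ?thesis by (simp only: max.bounded_iff) linarith
      qed
      finally have "v (c b) \<le> C * max 1 (p k y / e) * p k ?x" using C by (simp add: mult.assoc)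
      also have "\<dots> \<le> D * p k ?x" by (rule mult_right_mono) (auto simp: D_def sn_nonneg[OF p xE])
      finally show ?thesis .
    qed
  qed
  then show ?case using D by blast
qed

lemma finite_span_closed:
  assumes p: "\<And>k. seminorm (p k)" and mono: "\<And>k x. x \<in> E \<Longrightarrow> p k x \<le> p (Suc k) x"
    and sep: "\<And>x. x \<in> E \<Longrightarrow> (\<And>k. p k x = 0) \<Longrightarrow> x = 0"
    and B: "finite B" "B \<subseteq> E"
    and z: "z \<in> E" and near: "\<And>k e. 0 < e \<Longrightarrow> \<exists>w\<in>span B. p k (z - w) < e"
  shows "z \<in> span B"
proof -
  obtain J where J: "J \<subseteq> B" "independent J" "B \<subseteq> span J"
    using maximal_independent_subset[of B] by blast
  then have spJ: "span J = span B" using span_mono[of J B] span_minimal[of B "span J"] by auto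
  have JE: "finite J" "J \<subseteq> E" using J B finite_subset by auto
  have "\<exists>k. \<exists>C>0. \<forall>c. \<forall>b\<in>J. v (c b) \<le> C * p k (\<Sum>b\<in>J. s (c b) b)"
    by (rule coordinates_bounded[of p, OF p mono JE J(2)]) (use sep span_in_E[OF JE(2)] in auto)
  then obtain k C where C: "0 < C" "\<And>c b. b \<in> J \<Longrightarrow> v (c b) \<le> C * p k (\<Sum>b\<in>J. s (c b) b)" by blast
  have "\<exists>w\<in>span J. \<forall>k. p k (z - w) = 0"
    by (rule span_closed_if_coordinates_bounded[of p, OF p mono JE C(2) C(1) z]) (use near spJ in auto)
  then obtain w where w: "w \<in> span J" "\<And>k. p k (z - w) = 0" by auto
  have "z - w = 0" using sep w z span_in_E[OF JE(2)] E_diff by blast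
  then show ?thesis using w spJ by simp
qed

text \<open>The non-archimedean Gram--Schmidt process. Since \<open>K\<close> need not be spherically complete, distances
  to subspaces need not be attained, so orthogonality holds only up to a constant; what matters is
  that the constant depends on \<open>K\<close> and the dimension alone.\<close>

lemma almost_orthogonal_basis:
  assumes h: "seminorm h" and J: "finite J" "J \<subseteq> E" "independent J"
    and sep: "\<And>x. x \<in> span J \<Longrightarrow> h x = 0 \<Longrightarrow> x = 0"
  shows "\<exists>A. finite A \<and> independent A \<and> span A = span J \<and> (\<forall>b\<in>A. h b \<le> 1) \<and>
    (\<forall>c. \<forall>b\<in>A. v (c b) \<le> (2 / step) ^ card J * h (\<Sum>b\<in>A. s (c b) b))"
  using J sep
proof (induction J rule: finite_induct)
  case empty
  then show ?case by (intro exI[of _ "{}"]) auto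
next
  case (insert y J)
  let ?K = "2 / step :: real"
  have K: "2 \<le> ?K" using step by (simp add: field_simps)
  have ind: "independent J" using insert.prems independent_mono by blast
  have sp: "span J \<subseteq> span (insert y J)" by (rule span_mono) auto
  have yE: "y \<in> E" and JE: "J \<subseteq> E" using insert.prems by auto
  have ynot: "y \<notin> span J" using insert.prems(2) insert.hyps independent_insert by metis
  have "\<exists>A. finite A \<and> independent A \<and> span A = span J \<and> (\<forall>b\<in>A. h b \<le> 1) \<and>
    (\<forall>c. \<forall>b\<in>A. v (c b) \<le> ?K ^ card J * h (\<Sum>b\<in>A. s (c b) b))"
    by (rule insert.IH[OF JE ind]) (use insert.prems(3) sp in auto)
  then obtain A where A: "finite A" "independent A" "span A = span J" "\<And>b. b \<in> A \<Longrightarrow> h b \<le> 1"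
    and bound: "\<And>c b. b \<in> A \<Longrightarrow> v (c b) \<le> ?K ^ card J * h (\<Sum>b\<in>A. s (c b) b)"
    by blast
  have AE: "A \<subseteq> E" using A(3) span_superset[of A] span_in_E[OF JE] by auto
  have "\<exists>k::nat. \<exists>C>0. \<forall>c. \<forall>b\<in>insert y J. v (c b) \<le> C * h (\<Sum>b\<in>insert y J. s (c b) b)"
    by (rule coordinates_bounded[of "\<lambda>_. h", OF h order_refl _ insert.prems(1,2)])
      (use insert.prems(3) insert.hyps(1) in auto)
  then obtain C where C: "0 < C" "\<And>c b. b \<in> insert y J \<Longrightarrow> v (c b) \<le> C * h (\<Sum>b\<in>insert y J. s (c b) b)"
    by blast
  have dist_ge: "1 / C \<le> h (y - w)" if w: "w \<in> span J" for w
  proof -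
    obtain u where u: "w = (\<Sum>b\<in>J. s (u b) b)" using w span_finite[OF insert.hyps(1)] by auto
    define c where "c b = (if b = y then 1 else - u b)" for b
    have "(\<Sum>b\<in>J. s (c b) b) = (\<Sum>b\<in>J. - s (u b) b)"
      by (rule sum.cong) (use insert.hyps in \<open>auto simp: c_def\<close>)
    then have "(\<Sum>b\<in>insert y J. s (c b) b) = y - w"
      using insert.hyps by (simp add: u c_def[of y] sum_negf)
    then have "1 \<le> C * h (y - w)" using C(2)[of y c] by (simp add: c_def)
    then show ?thesis using C by (simp add: field_simps)
  qed
  define \<delta> where "\<delta> = (INF w\<in>span J. h (y - w))"
  have bdd: "bdd_below ((\<lambda>w. h (y - w)) ` span J)" using dist_ge by (intro bdd_belowI2)
  have ne: "span J \<noteq> {}" using span_zero by blast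
  have \<delta>_le: "\<delta> \<le> h (y - w)" if "w \<in> span J" for w unfolding \<delta>_def by (rule cINF_lower[OF bdd that])
  have "1 / C \<le> \<delta>" unfolding \<delta>_def by (rule cINF_greatest[OF ne dist_ge])
  then have \<delta>: "0 < \<delta>" using C(1) by (smt (verit) divide_pos_pos)
  obtain w0 where w0: "w0 \<in> span J" "h (y - w0) < 2 * \<delta>"
    using cINF_less_iff[OF ne bdd, of "2 * \<delta>"] \<delta> unfolding \<delta>_def[symmetric] by auto
  have w0E: "w0 \<in> E" using w0 span_in_E[OF JE] by auto
  have "0 < h (y - w0)" using \<delta>_le[OF w0(1)] \<delta> by simp
  then obtain a where a: "a \<noteq> 0" "step * 1 < v a * h (y - w0)" "v a * h (y - w0) \<le> 1"
    using ex_scaling[of "h (y - w0)" 1] by auto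
  define b0 where "b0 = s a (y - w0)"
  have b0E: "b0 \<in> E" unfolding b0_def by (intro E_scale E_diff yE w0E)
  have hb0: "step < h b0" "h b0 \<le> 1" unfolding b0_def using a sn_scale[OF h] E_diff[OF yE w0E] by auto
  have y_eq: "y = s (inverse a) b0 + w0" unfolding b0_def using a by simp
  have b0not: "b0 \<notin> span A"
  proof
    assume "b0 \<in> span A"
    then have "y \<in> span J" using w0 A(3) unfolding y_eq by (metis span_add span_scale)
    then show False using ynot by simp
  qed
  have b0A: "b0 \<notin> A" using b0not span_base by blast
  have indA: "independent (insert b0 A)" using A(2) b0not b0A independent_insert by metis
  have spA: "span (insert b0 A) = span (insert y J)"
  proof (rule span_eq[THEN iffD2], intro conjI)
    have "b0 \<in> span (insert y J)" unfolding b0_def using w0 sp span_base[of y "insert y J"] by (intro span_scale span_diff) auto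
    then show "insert b0 A \<subseteq> span (insert y J)" using A(3) sp span_superset[of A] by auto
    have "span A \<subseteq> span (insert b0 A)" by (rule span_mono) auto
    then have "y \<in> span (insert b0 A)" "J \<subseteq> span (insert b0 A)"
      using w0 A(3) span_superset[of J] span_add[OF span_scale[OF span_base[of b0 "insert b0 A"]]]
      by (auto simp: y_eq)
    then show "insert y J \<subseteq> span (insert b0 A)" by simp
  qed
  have "v (c b) \<le> ?K ^ card (insert y J) * h (\<Sum>b\<in>insert b0 A. s (c b) b)" if b: "b \<in> insert b0 A" for c b
  proof -
    let ?w = "\<Sum>b\<in>A. s (c b) b" and ?x = "\<Sum>b\<in>insert b0 A. s (c b) b"
    have x: "?x = s (c b0) b0 + ?w" using A b0A by simp
    have wJ: "?w \<in> span J" unfolding A(3)[symmetric] by (intro span_sum span_scale span_base)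
    have wE: "?w \<in> E" using AE by (intro E_sum E_scale) auto
    have xE: "?x \<in> E" unfolding x by (intro E_add E_scale b0E wE)
    have b0_le: "v (c b0) * h b0 \<le> 2 * h ?x"
    proof (cases "c b0 = 0")
      case False
      let ?u = "w0 - s (inverse (c b0 * a)) ?w"
      have uJ: "?u \<in> span J" by (intro span_diff span_scale w0 wJ)
      have "s (c b0 * a) (y - ?u) = s (c b0 * a) ((y - w0) + s (inverse (c b0 * a)) ?w)" by (simp add: algebra_simps)
      also have "\<dots> = s (c b0) b0 + ?w"
      proof -
        have "s (c b0 * a) (s (inverse (c b0 * a)) ?w) = ?w"
          using right_inverse[of "c b0 * a"] False a by (simp del: inverse_mult_distrib)
        then show ?thesis unfolding scale_right_distrib by (simp add: b0_def)
      qed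
      finally have "s (c b0 * a) (y - ?u) = ?x" unfolding x .
      then have "h ?x = v (c b0 * a) * h (y - ?u)"
        using sn_scale[OF h E_diff[OF yE], of ?u "c b0 * a"] uJ span_in_E[OF JE] by auto
      moreover have "h (y - w0) \<le> 2 * h (y - ?u)" using \<delta>_le[OF uJ] w0 by linarith
      moreover have "h b0 = v a * h (y - w0)" unfolding b0_def using sn_scale[OF h E_diff[OF yE w0E]] .
      moreover have "0 \<le> v (c b0) * v a" using nonneg by simp
      ultimately show ?thesis using mult_left_mono[of "h (y - w0)" "2 * h (y - ?u)" "v (c b0) * v a"]
        by (simp add: mult mult_ac)
    qed (use sn_nonneg[OF h xE] in simp)
    show ?thesis
    proof (cases "b = b0")
      case True
      have "v (c b0) * step \<le> v (c b0) * h b0" using hb0 nonneg by (intro mult_left_mono) auto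
      then have "v (c b0) * step \<le> 2 * h ?x" using b0_le by linarith
      then have "v (c b) \<le> ?K * h ?x" using True step by (simp add: field_simps)
      also have "\<dots> \<le> ?K ^ card (insert y J) * h ?x"
        using K insert.hyps sn_nonneg[OF h xE] by (intro mult_right_mono self_le_power) auto
      finally show ?thesis .
    next
      case False
      have "?w = ?x - s (c b0) b0" unfolding x by simp
      then have "h ?w \<le> max (h ?x) (v (c b0) * h b0)"
        using sn_diff[OF h xE E_scale[OF b0E], of "c b0"] by (simp add: sn_scale[OF h] b0E)
      then have "h ?w \<le> 2 * h ?x" using b0_le sn_nonneg[OF h xE] by (smt (verit))
      then have "h ?w \<le> ?K * h ?x" using mult_right_mono[OF K sn_nonneg[OF h xE]] by linarith
      then have "?K ^ card J * h ?w \<le> ?K ^ card J * (?K * h ?x)"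
        using step by (intro mult_left_mono) auto
      moreover have "v (c b) \<le> ?K ^ card J * h ?w" using bound False b by auto
      ultimately have "v (c b) \<le> ?K ^ card J * (?K * h ?x)" by linarith
      then show ?thesis using insert.hyps by (simp add: mult_ac)
    qed
  qed
  then have "\<forall>c. \<forall>b\<in>insert b0 A. v (c b) \<le> ?K ^ card (insert y J) * h (\<Sum>b\<in>insert b0 A. s (c b) b)" by blast
  moreover have "finite (insert b0 A)" "\<forall>b\<in>insert b0 A. h b \<le> 1" using A hb0 by auto
  ultimately show ?case using indA spA by (intro exI[of _ "insert b0 A"] conjI)
qed

text \<open>On a complement of its kernel in \<open>G\<close>, the seminorm is a norm with an almost orthogonal basis; adding
  vectors of the kernel does not change the value of \<open>h\<close>.\<close>

lemma almost_orthogonal_basis_with_kernel: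
  assumes h: "seminorm h" and G: "subspace G" "G \<subseteq> E" "finite_dim s G" "dim G \<le> N"
  shows "\<exists>A Z. finite A \<and> finite Z \<and> A \<inter> Z = {} \<and> independent (A \<union> Z) \<and> span (A \<union> Z) = G \<and>
    (\<forall>b\<in>A. h b \<le> 1) \<and> (\<forall>b\<in>Z. h b = 0) \<and>
    (\<forall>c. \<forall>b\<in>A. v (c b) \<le> (2 / step) ^ N * h (\<Sum>b\<in>A \<union> Z. s (c b) b))"
proof -
  let ?K = "2 / step :: real"
  have K: "1 \<le> ?K" using step by (simp add: field_simps)
  obtain B where B: "finite B" "G \<subseteq> span B" using G(3) by (auto simp: finite_dim_def)
  define G0 where "G0 = {x \<in> G. h x = 0}"
  have G0: "subspace G0" unfolding G0_def by (rule sn_kernel_subspace[OF h G(1,2)])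
  obtain Z where Z: "Z \<subseteq> G0" "independent Z" "G0 \<subseteq> span Z" by (rule basis_exists)
  have spZ: "span Z = G0" using Z(3) span_minimal[OF Z(1) G0] by auto
  obtain H where H: "Z \<subseteq> H" "H \<subseteq> G" "independent H" "G \<subseteq> span H"
    using maximal_independent_subset_extend[of Z G] Z by (auto simp: G0_def)
  have spH: "span H = G" using H(4) span_minimal[OF H(2) G(1)] by auto
  have finH: "finite H" using independent_span_bound[OF B(1) H(3)] H(2) B(2) by auto
  have cardH: "card H = dim G" using dim_eq_card[of H G] H spH by (simp add: span_eq_iff[THEN iffD2, OF G(1)])
  define J where "J = H - Z"
  have J: "finite J" "J \<subseteq> E" "independent J" "card J \<le> N"
    using finH H G(2) independent_mono[OF H(3)] cardH G(4) card_mono[OF finH, of J] by (auto simp: J_def)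
  have spJE: "span J \<subseteq> E" and spJG: "span J \<subseteq> G" using span_in_E[OF J(2)] spH span_mono[of J H] by (auto simp: J_def)
  have finZ: "finite Z" using finH H(1) finite_subset by blast
  have ZE: "Z \<subseteq> E" and hZ: "\<And>b. b \<in> Z \<Longrightarrow> h b = 0" using Z G(2) by (auto simp: G0_def)
  have sep: "x = 0" if "x \<in> span J" "h x = 0" for x
  proof -
    have "x \<in> span Z" using that spJG spZ by (auto simp: G0_def)
    then obtain w where w: "x = (\<Sum>b\<in>Z. s (w b) b)" using span_finite[OF finZ] by auto
    obtain u where u: "x = (\<Sum>b\<in>J. s (u b) b)" using \<open>x \<in> span J\<close> span_finite[OF J(1)] by auto
    define c where "c b = (if b \<in> J then u b else - w b)" for b
    have "(\<Sum>b\<in>J. s (c b) b) = x" unfolding u by (rule sum.cong) (auto simp: c_def)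
    moreover have "(\<Sum>b\<in>Z. s (c b) b) = (\<Sum>b\<in>Z. - s (w b) b)" by (rule sum.cong) (auto simp: c_def J_def)
    ultimately have "(\<Sum>b\<in>H. s (c b) b) = 0"
      using sum.subset_diff[OF H(1) finH, of "\<lambda>b. s (c b) b"] by (simp add: J_def w sum_negf)
    then have "\<forall>b\<in>H. c b = 0" using H(3) finH unfolding independent_explicit_finite_subsets by blast
    then have "u b = 0" if "b \<in> J" for b using that by (auto simp: J_def c_def)
    then show ?thesis unfolding u by simp
  qed
  have "\<exists>A. finite A \<and> independent A \<and> span A = span J \<and> (\<forall>b\<in>A. h b \<le> 1) \<and>
    (\<forall>c. \<forall>b\<in>A. v (c b) \<le> ?K ^ card J * h (\<Sum>b\<in>A. s (c b) b))"
    by (rule almost_orthogonal_basis[OF h J(1-3) sep])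
  then obtain A where A: "finite A" "independent A" "span A = span J" "\<And>b. b \<in> A \<Longrightarrow> h b \<le> 1"
    and bound0: "\<And>c b. b \<in> A \<Longrightarrow> v (c b) \<le> ?K ^ card J * h (\<Sum>b\<in>A. s (c b) b)"
    by blast
  have AE: "A \<subseteq> E" using A(3) span_superset[of A] spJE by auto
  have hA: "h b \<noteq> 0" if "b \<in> A" for b
  proof
    assume "h b = 0"
    moreover have "b \<in> span J" using that A(3) span_base[of b A] by simp
    ultimately have "0 \<in> A" using sep that by auto
    then show False using A(2) dependent_zero by simp
  qed
  have disj: "A \<inter> Z = {}" using hA hZ by blast
  have hsum: "h (\<Sum>b\<in>A \<union> Z. s (c b) b) = h (\<Sum>b\<in>A. s (c b) b)" for c
  proof -
    have "(\<Sum>b\<in>A \<union> Z. s (c b) b) = (\<Sum>b\<in>Z. s (c b) b) + (\<Sum>b\<in>A. s (c b) b)"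
      using sum.union_disjoint[OF A(1) finZ disj, of "\<lambda>b. s (c b) b"] by (simp add: add.commute)
    moreover have "h (\<Sum>b\<in>Z. s (c b) b) \<le> 0"
      by (rule sn_sum[OF h]) (use ZE hZ sn_scale[OF h] E_scale in auto)
    moreover have "(\<Sum>b\<in>Z. s (c b) b) \<in> E" "(\<Sum>b\<in>A. s (c b) b) \<in> E" using ZE AE by (auto intro!: E_sum E_scale)
    ultimately show ?thesis using sn_add_kernel[OF h] sn_nonneg[OF h] by (simp add: order_antisym)
  qed
  have bound: "v (c b) \<le> ?K ^ N * h (\<Sum>b\<in>A \<union> Z. s (c b) b)" if "b \<in> A" for c b
  proof -
    have "v (c b) \<le> ?K ^ card J * h (\<Sum>b\<in>A. s (c b) b)" by (rule bound0[OF that])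
    also have "\<dots> \<le> ?K ^ N * h (\<Sum>b\<in>A. s (c b) b)"
      using K J AE by (intro mult_right_mono power_increasing sn_nonneg[OF h] E_sum E_scale) auto
    finally show ?thesis by (simp add: hsum)
  qed
  have indep: "independent (A \<union> Z)"
  proof (rule independent_if_scalars_zero)
    fix c b assume sum0: "(\<Sum>b\<in>A \<union> Z. s (c b) b) = 0" and b: "b \<in> A \<union> Z"
    have cA: "c b = 0" if "b \<in> A" for b using bound[OF that, of c] sum0 sn_0[OF h] nonneg[of "c b"] eq_0_iff[of "c b"] by simp
    then have "(\<Sum>b\<in>Z. s (c b) b) = 0"
      using sum0 sum.union_disjoint[OF A(1) finZ disj, of "\<lambda>b. s (c b) b"] by simp
    then have "c b = 0" if "b \<in> Z" for b using Z(2) finZ that unfolding independent_explicit_finite_subsets by blast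
    then show "c b = 0" using cA b by auto
  qed (use A finZ in auto)
  have "span (A \<union> Z) = G"
  proof
    have "A \<union> Z \<subseteq> G" using A(3) spJG span_superset[of A] Z by (auto simp: G0_def)
    then show "span (A \<union> Z) \<subseteq> G" by (rule span_minimal[OF _ G(1)])
    have "J \<subseteq> span (A \<union> Z)" using A(3) span_superset[of J] span_mono[of A "A \<union> Z"] by auto
    moreover have "Z \<subseteq> span (A \<union> Z)" using span_superset[of "A \<union> Z"] by auto
    ultimately have "H \<subseteq> span (A \<union> Z)" by (auto simp: J_def)
    then show "G \<subseteq> span (A \<union> Z)" using spH span_minimal[of H "span (A \<union> Z)"] by auto
  qed
  then show ?thesis using A finZ disj indep bound hZ by (intro exI[of _ A] exI[of _ Z]) auto
qed

end

section \<open>Topologies defined by a sequence of seminorms\<close>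

text \<open>The functions \<open>p k\<close> need not be seminorms: in the model spaces below they are sums of
  valuations, which do not satisfy the ultrametric inequality.\<close>

definition defines_topology :: "(nat \<Rightarrow> 'b::ab_group_add \<Rightarrow> real) \<Rightarrow> 'b topology \<Rightarrow> bool" where
  "defines_topology p T \<longleftrightarrow>
     (\<forall>U. openin T U \<longleftrightarrow>
        U \<subseteq> topspace T \<and> (\<forall>x\<in>U. \<exists>k. \<exists>r>0. {y \<in> topspace T. p k (y - x) < r} \<subseteq> U))"

lemma defines_topologyD:
  assumes "defines_topology p T" "openin T U" "x \<in> U"
  obtains k r where "0 < r" "{y \<in> topspace T. p k (y - x) < r} \<subseteq> U"
  using assms unfolding defines_topology_def by blast

lemma defines_topologyI:
  assumes "defines_topology p T" "U \<subseteq> topspace T"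
    and "\<And>x. x \<in> U \<Longrightarrow> \<exists>k. \<exists>r>0. {y \<in> topspace T. p k (y - x) < r} \<subseteq> U"
  shows "openin T U"
  using assms unfolding defines_topology_def by blast

lemma homeomorphic_map_by_seminorms:
  fixes s :: "'k::field \<Rightarrow> 'b::ab_group_add \<Rightarrow> 'b" and s' :: "'k \<Rightarrow> 'c::ab_group_add \<Rightarrow> 'c"
  assumes vs: "vector_space s" and sub: "module.subspace s (topspace T)"
    and lin: "linear_map_on s s' (topspace T) f" and bij: "bij_betw f (topspace T) (topspace T')"
    and p: "defines_topology p T" and q: "defines_topology q T'"
    and cont: "\<And>k. \<exists>m. \<exists>C>0. \<forall>x\<in>topspace T. q k (f x) \<le> C * p m x"
    and inv: "\<And>k. \<exists>m. \<exists>C>0. \<forall>x\<in>topspace T. p k x \<le> C * q m (f x)"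
  shows "homeomorphic_map T T' f"
proof -
  interpret vector_space s by (rule vs)
  have f_diff: "f (y - x) = f y - f x" and diff: "y - x \<in> topspace T"
    if "x \<in> topspace T" "y \<in> topspace T" for x y
  proof -
    show d: "y - x \<in> topspace T" using that subspace_diff[OF sub] by blast
    have "f (y - x + x) = f (y - x) + f x" using lin that d unfolding linear_map_on_def by blast
    then show "f (y - x) = f y - f x" by simp
  qed
  have "openin T {x \<in> topspace T. f x \<in> U} \<longleftrightarrow> openin T' U" if U: "U \<subseteq> topspace T'" for U
  proof
    assume op: "openin T' U"
    show "openin T {x \<in> topspace T. f x \<in> U}"
    proof (rule defines_topologyI[OF p])
      fix x assume x: "x \<in> {x \<in> topspace T. f x \<in> U}"
      then obtain k r where r: "0 < r" "{y \<in> topspace T'. q k (y - f x) < r} \<subseteq> U"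
        using defines_topologyD[OF q op] by blast
      obtain m C where C: "0 < C" "\<And>z. z \<in> topspace T \<Longrightarrow> q k (f z) \<le> C * p m z" using cont by blast
      have "f y \<in> U" if y: "y \<in> topspace T" "p m (y - x) < r / C" for y
      proof -
        have "q k (f y - f x) \<le> C * p m (y - x)" using C(2)[of "y - x"] f_diff diff x y by auto
        also have "\<dots> < r" using C(1) y by (simp add: field_simps)
        finally show ?thesis using r bij y by (auto simp: bij_betw_def)
      qed
      then show "\<exists>k. \<exists>r>0. {y \<in> topspace T. p k (y - x) < r} \<subseteq> {x \<in> topspace T. f x \<in> U}"
        using r C by (intro exI[of _ m] exI[of _ "r / C"]) auto
    qed auto
  next
    assume op: "openin T {x \<in> topspace T. f x \<in> U}"
    show "openin T' U"
    proof (rule defines_topologyI[OF q U])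
      fix u assume u: "u \<in> U"
      then obtain x where x: "x \<in> topspace T" "u = f x" using U bij by (auto simp: bij_betw_def)
      then have "x \<in> {x \<in> topspace T. f x \<in> U}" using u by auto
      then obtain k r where r: "0 < r" "{y \<in> topspace T. p k (y - x) < r} \<subseteq> {x \<in> topspace T. f x \<in> U}"
        using defines_topologyD[OF p op] by blast
      obtain m C where C: "0 < C" "\<And>z. z \<in> topspace T \<Longrightarrow> p k z \<le> C * q m (f z)" using inv by blast
      have "w \<in> U" if w: "w \<in> topspace T'" "q m (w - u) < r / C" for w
      proof -
        obtain y where y: "y \<in> topspace T" "w = f y" using w bij by (auto simp: bij_betw_def)
        have "p k (y - x) \<le> C * q m (w - u)" using C(2)[of "y - x"] f_diff diff x y by auto
        also have "\<dots> < r" using C(1) w by (simp add: field_simps)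
        finally show ?thesis using r y by auto
      qed
      then show "\<exists>k. \<exists>r>0. {y \<in> topspace T'. q k (y - u) < r} \<subseteq> U"
        using r C by (intro exI[of _ m] exI[of _ "r / C"]) auto
    qed
  qed
  then show ?thesis using bij unfolding homeomorphic_map_def quotient_map_def bij_betw_def by auto
qed

lemma defines_topology_equivalent:
  assumes p: "defines_topology p T" and diff: "\<And>x y. x \<in> topspace T \<Longrightarrow> y \<in> topspace T \<Longrightarrow> y - x \<in> topspace T"
    and pq: "\<And>k. \<exists>m. \<exists>C>0. \<forall>x\<in>topspace T. q k x \<le> C * p m x"
    and qp: "\<And>k. \<exists>m. \<exists>C>0. \<forall>x\<in>topspace T. p k x \<le> C * q m x"
  shows "defines_topology q T"
proof -
  have ball: "\<exists>m. \<exists>r'>0. {y \<in> topspace T. g m (y - x) < r'} \<subseteq> {y \<in> topspace T. h k (y - x) < r}"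
    if hg: "\<exists>m. \<exists>C>0. \<forall>x\<in>topspace T. h k x \<le> C * g m x" and "0 < r" "x \<in> topspace T"
    for g h :: "nat \<Rightarrow> 'a \<Rightarrow> real" and k r x
  proof -
    obtain m C where C: "0 < C" "\<And>x. x \<in> topspace T \<Longrightarrow> h k x \<le> C * g m x" using hg by blast
    have "h k (y - x) < r" if "y \<in> topspace T" "g m (y - x) < r / C" for y
    proof -
      have "h k (y - x) \<le> C * g m (y - x)" using C(2) diff that \<open>x \<in> topspace T\<close> by blast
      also have "\<dots> < r" using C(1) that by (simp add: field_simps)
      finally show ?thesis .
    qed
    then show ?thesis using C(1) \<open>0 < r\<close> by (intro exI[of _ m] exI[of _ "r / C"]) auto
  qed
  have iff: "(\<exists>k. \<exists>r>0. {y \<in> topspace T. q k (y - x) < r} \<subseteq> U) \<longleftrightarrow>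
    (\<exists>k. \<exists>r>0. {y \<in> topspace T. p k (y - x) < r} \<subseteq> U)" if "x \<in> topspace T" for x U
    using ball[OF pq _ that] ball[OF qp _ that] by (meson order_trans)
  have "U \<subseteq> topspace T \<and> (\<forall>x\<in>U. \<exists>k. \<exists>r>0. {y \<in> topspace T. q k (y - x) < r} \<subseteq> U) \<longleftrightarrow>
    U \<subseteq> topspace T \<and> (\<forall>x\<in>U. \<exists>k. \<exists>r>0. {y \<in> topspace T. p k (y - x) < r} \<subseteq> U)" for U
    by (rule conj_cong[OF refl], rule ball_cong[OF refl], rule iff) auto
  then show ?thesis using p unfolding defines_topology_def by simp
qed

lemma (in nonarch_vector_space) openin_seminorm_topology:
  assumes Q: "\<And>q. q \<in> Q \<Longrightarrow> seminorm q"
  shows "openin (seminorm_topology E Q) U \<longleftrightarrow>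
    U \<subseteq> E \<and> (\<forall>x\<in>U. \<exists>F r. finite F \<and> F \<subseteq> Q \<and> 0 < r \<and> {y \<in> E. \<forall>q\<in>F. q (y - x) < r} \<subseteq> U)"
    (is "_ \<longleftrightarrow> ?R U")
proof
  let ?S = "insert E {{y\<in>E. p (y - x) < r} |p x r. p \<in> Q \<and> x \<in> E \<and> 0 < r}"
  define near where "near U x \<longleftrightarrow>
    (\<exists>F r. finite F \<and> F \<subseteq> Q \<and> 0 < r \<and> {y \<in> E. \<forall>q\<in>F. q (y - x) < r} \<subseteq> U)" for U x
  have near_mono: "near U x \<Longrightarrow> U \<subseteq> V \<Longrightarrow> near V x" for U V x
    unfolding near_def by (meson order_trans)
  have near_Int: "near (U \<inter> V) x" if "near U x" "near V x" for U V x
  proof -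
    obtain F r where F: "finite F" "F \<subseteq> Q" "0 < r" "{y \<in> E. \<forall>q\<in>F. q (y - x) < r} \<subseteq> U"
      using \<open>near U x\<close> unfolding near_def by auto
    obtain F' r' where F': "finite F'" "F' \<subseteq> Q" "0 < r'" "{y \<in> E. \<forall>q\<in>F'. q (y - x) < r'} \<subseteq> V"
      using \<open>near V x\<close> unfolding near_def by auto
    have "{y \<in> E. \<forall>q\<in>F \<union> F'. q (y - x) < min r r'} \<subseteq> U \<inter> V" using F(4) F'(4) by auto
    then show ?thesis unfolding near_def using F F' by (intro exI[of _ "F \<union> F'"] exI[of _ "min r r'"]) auto
  qed
  {
    assume "openin (seminorm_topology E Q) U"
    then have "generate_topology_on ?S U"
      by (simp add: seminorm_topology_def openin_topology_generated_by_iff)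
    then have "U \<subseteq> E \<and> (\<forall>x\<in>U. near U x)"
    proof induction
      case (Int a b)
      then show ?case using near_Int by auto
    next
      case (UN K)
      then show ?case using near_mono by (meson UnionE Union_upper Union_least)
    next
      case (Basis b)
      then consider "b = E" | p x0 r where "b = {y\<in>E. p (y - x0) < r}" "p \<in> Q" "x0 \<in> E" "0 < r" by blast
      then show ?case
      proof cases
        case 1
        then show ?thesis unfolding near_def by (intro conjI ballI exI[of _ "{}::('b \<Rightarrow> real) set"] exI[of _ "1::real"]) auto
      next
        case 2
        have "{y \<in> E. \<forall>q\<in>{p}. q (y - x) < r} \<subseteq> b" if "x \<in> b" for x
          using that 2 sn_triangle[OF Q[OF 2(2)], of _ x x0] by fastforce
        then show ?thesis unfolding near_def using 2 by (intro conjI ballI exI[of _ "{p}"] exI[of _ r]) auto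
      qed
    qed auto
    then show "?R U" unfolding near_def .
  }
  {
    assume R: "?R U"
    have "\<exists>V. openin (seminorm_topology E Q) V \<and> x \<in> V \<and> V \<subseteq> U" if x: "x \<in> U" for x
    proof -
      obtain F r where F: "finite F" "F \<subseteq> Q" "0 < r" "{y \<in> E. \<forall>q\<in>F. q (y - x) < r} \<subseteq> U" using R x by blast
      define V where "V = E \<inter> \<Inter> ((\<lambda>q. {y \<in> E. q (y - x) < r}) ` F)"
      have xE: "x \<in> E" using R x by auto
      have "openin (seminorm_topology E Q) V"
      proof (cases "F = {}")
        case True
        then show ?thesis unfolding V_def seminorm_topology_def by (auto intro: topology_generated_by_Basis)
      next
        case False
        have "openin (seminorm_topology E Q) {y \<in> E. q (y - x) < r}" if "q \<in> F" for q
          unfolding seminorm_topology_def using that F xE by (intro topology_generated_by_Basis) blast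
        then show ?thesis unfolding V_def
          using False F(1) topology_generated_by_Basis[of E ?S]
          by (intro openin_Int openin_Inter) (auto simp: seminorm_topology_def)
      qed
      moreover have "q (x - x) < r" if "q \<in> F" for q using sn_0[OF Q, of q] that F by auto
      then have "x \<in> V" unfolding V_def using xE by auto
      moreover have "V \<subseteq> U" using F(4) by (auto simp: V_def)
      ultimately show ?thesis by blast
    qed
    then show "openin (seminorm_topology E Q) U" using openin_subopen by metis
  }
qed

lemma (in nonarch_vector_space) ex_finite_sup_seminorm:
  assumes "finite F" "\<And>q. q \<in> F \<Longrightarrow> seminorm q"
  shows "\<exists>h. seminorm h \<and> (\<forall>x\<in>E. \<forall>c. h x \<le> c \<longleftrightarrow> 0 \<le> c \<and> (\<forall>q\<in>F. q x \<le> c))"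
  using assms
proof (induction F rule: finite_induct)
  case empty
  then show ?case by (intro exI[of _ "\<lambda>_. 0"]) (auto simp: nonarch_seminorm_def)
next
  case (insert q F)
  obtain h where h: "seminorm h" "\<And>x c. x \<in> E \<Longrightarrow> h x \<le> c \<longleftrightarrow> 0 \<le> c \<and> (\<forall>q\<in>F. q x \<le> c)"
    using insert.IH insert.prems by auto
  have q: "seminorm q" using insert.prems by auto
  have "seminorm (\<lambda>x. max (q x) (h x))"
    unfolding nonarch_seminorm_def
  proof (intro conjI ballI allI)
    fix x y assume x: "x \<in> E" and y: "y \<in> E"
    show "max (q (x + y)) (h (x + y)) \<le> max (max (q x) (h x)) (max (q y) (h y))"
      using sn_add[OF q x y] sn_add[OF h(1) x y] by linarith
  next
    fix a x assume x: "x \<in> E"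
    show "max (q (s a x)) (h (s a x)) = v a * max (q x) (h x)"
      using sn_scale[OF q x] sn_scale[OF h(1) x] nonneg[of a] by (simp add: max_mult_distrib_left)
  qed (use sn_nonneg[OF q] in \<open>auto simp: le_max_iff_disj\<close>)
  then show ?case using h(2) by (intro exI[of _ "\<lambda>x. max (q x) (h x)"]) auto
qed

text \<open>Over ultrametric seminorms, completeness amounts to the convergence of all series whose terms tend
  to zero. Stated with the topology alone, this survives a change of the seminorms.\<close>

locale frechet = nonarch_vector_space v s "topspace T"
  for v :: "'k::field \<Rightarrow> real" and s :: "'k \<Rightarrow> 'b::ab_group_add \<Rightarrow> 'b" and T :: "'b topology" +
  fixes p :: "nat \<Rightarrow> 'b \<Rightarrow> real"
  assumes p_seminorm: "seminorm (p k)"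
    and p_Suc: "x \<in> topspace T \<Longrightarrow> p k x \<le> p (Suc k) x"
    and p_separating: "x \<in> topspace T \<Longrightarrow> (\<And>k. p k x = 0) \<Longrightarrow> x = 0"
    and p_topology: "defines_topology p T"
    and series_convergent: "(\<And>n. f n \<in> topspace T) \<Longrightarrow> limitin T f 0 sequentially \<Longrightarrow>
      \<exists>l. limitin T (\<lambda>N. \<Sum>n<N. f n) l sequentially"
begin

abbreviation "E \<equiv> topspace T"

lemmas p_nonneg = sn_nonneg[OF p_seminorm]
  and p_add = sn_add[OF p_seminorm]
  and p_diff = sn_diff[OF p_seminorm]
  and p_scale = sn_scale[OF p_seminorm]
  and p_0 [simp] = sn_0[OF p_seminorm]
  and p_commute = sn_commute[OF p_seminorm]
  and p_triangle = sn_triangle[OF p_seminorm]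
  and p_sum = sn_sum[OF p_seminorm]

lemma p_mono: "j \<le> k \<Longrightarrow> x \<in> E \<Longrightarrow> p j x \<le> p k x"
  using sn_mono[of p, OF p_Suc] .

lemma openin_ball: "x \<in> E \<Longrightarrow> openin T {y \<in> E. p k (y - x) < r}"
proof (rule defines_topologyI[OF p_topology])
  fix z assume "x \<in> E" and z: "z \<in> {y \<in> E. p k (y - x) < r}"
  show "\<exists>k'. \<exists>r'>0. {y \<in> E. p k' (y - z) < r'} \<subseteq> {y \<in> E. p k (y - x) < r}"
    using z \<open>x \<in> E\<close> p_triangle[of _ z x k] p_nonneg[of "z - x" k] E_diff[of z x]
    by (intro exI[of _ k] exI[of _ r]) fastforce
qed auto

lemma limitin_iff:
  assumes x: "\<And>n. x n \<in> E"
  shows "limitin T x l sequentially \<longleftrightarrow> l \<in> E \<and> (\<forall>k. (\<lambda>n. p k (x n - l)) \<longlonglongrightarrow> 0)"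
proof
  assume lim: "limitin T x l sequentially"
  then have l: "l \<in> E" by (simp add: limitin_def)
  have "\<forall>\<^sub>F n in sequentially. norm (p k (x n - l) - 0) < r" if r: "0 < r" for k r
  proof -
    have "\<forall>\<^sub>F n in sequentially. x n \<in> {y \<in> E. p k (y - l) < r}"
      by (rule limitinD[OF lim openin_ball[OF l]]) (use l r in auto)
    then show ?thesis by (rule eventually_mono) (use p_nonneg E_diff l in auto)
  qed
  then show "l \<in> E \<and> (\<forall>k. (\<lambda>n. p k (x n - l)) \<longlonglongrightarrow> 0)" using l by (simp add: tendsto_iff dist_norm)
next
  assume R: "l \<in> E \<and> (\<forall>k. (\<lambda>n. p k (x n - l)) \<longlonglongrightarrow> 0)"
  show "limitin T x l sequentially"
    unfolding limitin_def
  proof (intro conjI allI impI)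
    fix U assume U: "openin T U \<and> l \<in> U"
    then obtain k r where r: "0 < r" "{y \<in> E. p k (y - l) < r} \<subseteq> U" using defines_topologyD[OF p_topology] by blast
    have "\<forall>\<^sub>F n in sequentially. p k (x n - l) < r" by (rule order_tendstoD(2)[of _ 0]) (use R r(1) in auto)
    then show "\<forall>\<^sub>F n in sequentially. x n \<in> U" by (rule eventually_mono) (use r x in auto)
  qed (use R in auto)
qed

lemma series:
  assumes x: "\<And>n. x n \<in> E" and lim: "\<And>k. (\<lambda>n. p k (x n)) \<longlonglongrightarrow> 0"
  shows "\<exists>l\<in>E. \<forall>k. (\<lambda>N. p k ((\<Sum>n<N. x n) - l)) \<longlonglongrightarrow> 0"
proof -
  have "limitin T x 0 sequentially" using limitin_iff[of x 0] x lim by simp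
  then obtain l where "limitin T (\<lambda>N. \<Sum>n<N. x n) l sequentially" using series_convergent x by blast
  moreover have "(\<Sum>n<N. x n) \<in> E" for N by (intro E_sum x)
  ultimately show ?thesis using limitin_iff[of "\<lambda>N. \<Sum>n<N. x n" l] by auto
qed

lemma limit_p_le:
  assumes x: "\<And>n. x n \<in> E" and l: "l \<in> E" "(\<lambda>n. p k (x n - l)) \<longlonglongrightarrow> 0"
    and le: "\<forall>\<^sub>F n in sequentially. p k (x n) \<le> c"
  shows "p k l \<le> c"
proof -
  have "\<forall>\<^sub>F n in sequentially. p k l \<le> max c (p k (x n - l))"
    using le
  proof eventually_elim
    case (elim n)
    have "p k (x n - (x n - l)) \<le> max (p k (x n)) (p k (x n - l))" by (rule p_diff) (use x l E_diff in auto)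
    then show ?case using elim by simp
  qed
  moreover have "(\<lambda>n. max c (p k (x n - l))) \<longlonglongrightarrow> max c 0" by (intro tendsto_max l tendsto_const)
  ultimately have "p k l \<le> max c 0" using tendsto_lowerbound trivial_limit_sequentially by blast
  moreover have "0 \<le> c" using eventually_happens'[OF sequentially_bot le] p_nonneg[OF x] by (meson order_trans)
  ultimately show ?thesis by simp
qed

lemma continuous_linear_bounded:
  assumes A: "A \<in> continuous_endomorphisms s T"
  shows "\<exists>m. \<exists>C>0. \<forall>x\<in>E. p k (A x) \<le> C * p m x"
proof -
  have lin: "linear_map_on s s E A" and cont: "continuous_map T T A"
    using A by (auto simp: continuous_endomorphisms_def)
  have AE: "A x \<in> E" if "x \<in> E" for x using cont that by (meson continuous_map_image_subset_topspace image_subset_iff)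
  have h: "seminorm (\<lambda>x. p k (A x))"
    unfolding nonarch_seminorm_def
    using lin p_nonneg AE p_add p_scale by (auto simp: linear_map_on_def)
  have A0: "A 0 = 0"
  proof -
    have "A (s 0 0) = s 0 (A 0)" using lin E_0 unfolding linear_map_on_def by blast
    then show ?thesis by simp
  qed
  have "openin T {x \<in> E. A x \<in> {y \<in> E. p k (y - 0) < 1}}"
    by (rule openin_continuous_map_preimage[OF cont openin_ball]) simp
  then obtain m r where r: "0 < r" "{y \<in> E. p m (y - 0) < r} \<subseteq> {x \<in> E. A x \<in> {y \<in> E. p k (y - 0) < 1}}"
    by (rule defines_topologyD[OF p_topology, of _ 0]) (use A0 in auto)
  have "\<exists>C>0. \<forall>x\<in>E. p k (A x) \<le> C * p m x"
    by (rule sn_dominated[OF h p_seminorm r(1), where c = 1]) (use r(2) in auto)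
  then show ?thesis by blast
qed

end

text \<open>A metric provides a countable base of neighbourhoods of zero, and each of them contains a ball for
  finitely many of the seminorms that generate the topology; \<open>p n\<close> is the supremum of the seminorms
  used for the first \<open>n + 1\<close> neighbourhoods.\<close>

lemma frechet_space_seminorms:
  assumes K: "complete_nonarch_field v" and X: "frechet_space v s T"
  shows "\<exists>p. frechet v s T p"
proof -
  have lcs: "lcs v s T" and met: "metrizable_space T" and comp: "complete_tvs T"
    using X by (auto simp: frechet_space_def)
  interpret complete_nonarch_field v by (rule K)
  interpret vector_space s using lcs by (simp add: lcs_def)
  interpret nonarch_vector_space v s "topspace T" by unfold_locales (use lcs in \<open>simp add: lcs_def\<close>)
  let ?E = "topspace T"
  obtain Q where Q: "\<And>q. q \<in> Q \<Longrightarrow> seminorm q" and TQ: "T = seminorm_topology ?E Q"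
    using lcs unfolding lcs_def by blast
  have op: "openin T U \<longleftrightarrow> U \<subseteq> ?E \<and> (\<forall>x\<in>U. \<exists>F r. finite F \<and> F \<subseteq> Q \<and> 0 < r \<and> {y \<in> ?E. \<forall>q\<in>F. q (y - x) < r} \<subseteq> U)" for U
    using openin_seminorm_topology[of Q U, OF Q] unfolding TQ[symmetric] .
  obtain M d where Md: "Metric_space M d" and T: "T = Metric_space.mtopology M d"
    using met by (auto simp: metrizable_space_def)
  interpret M: Metric_space M d by (rule Md)
  have EM: "?E = M" unfolding T by simp
  define good where "good n z \<longleftrightarrow> finite (fst z) \<and> fst z \<subseteq> Q \<and> 0 < snd z \<and>
    {y \<in> ?E. \<forall>q\<in>fst z. q y < snd z} \<subseteq> M.mball 0 (1 / real (Suc n))" for n z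
  have "\<forall>n. \<exists>z. good n z"
  proof
    fix n
    have "openin T (M.mball 0 (1 / real (Suc n)))" unfolding T by (rule M.openin_mball)
    moreover have "0 \<in> M.mball 0 (1 / real (Suc n))" using E_0 EM by simp
    ultimately have "\<exists>F r. finite F \<and> F \<subseteq> Q \<and> 0 < r \<and>
        {y \<in> ?E. \<forall>q\<in>F. q (y - 0) < r} \<subseteq> M.mball 0 (1 / real (Suc n))"
      unfolding op by (elim conjE) (rule bspec)
    then show "\<exists>z. good n z" unfolding good_def by simp
  qed
  then obtain z where z: "\<forall>n. good n (z n)" using choice[of good] by auto
  define F r where "F n = fst (z n)" and "r n = snd (z n)" for n
  have F: "finite (F n)" "F n \<subseteq> Q" "0 < r n"
    "{y \<in> ?E. \<forall>q\<in>F n. q y < r n} \<subseteq> M.mball 0 (1 / real (Suc n))" for n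
    using z unfolding good_def F_def r_def by auto
  have "\<exists>h. seminorm h \<and> (\<forall>x\<in>?E. \<forall>c. h x \<le> c \<longleftrightarrow> 0 \<le> c \<and> (\<forall>q\<in>(\<Union>i\<le>n. F i). q x \<le> c))" for n
    by (rule ex_finite_sup_seminorm) (use F(1,2) Q in blast)+
  then have "\<forall>n. \<exists>h. seminorm h \<and> (\<forall>x\<in>?E. \<forall>c. h x \<le> c \<longleftrightarrow> 0 \<le> c \<and> (\<forall>q\<in>(\<Union>i\<le>n. F i). q x \<le> c))" ..
  from choice[OF this] obtain p where p0: "\<forall>n. seminorm (p n) \<and>
    (\<forall>x\<in>?E. \<forall>c. p n x \<le> c \<longleftrightarrow> 0 \<le> c \<and> (\<forall>q\<in>(\<Union>i\<le>n. F i). q x \<le> c))" ..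
  have p: "seminorm (p n)"
    and p_le: "x \<in> ?E \<Longrightarrow> p n x \<le> c \<longleftrightarrow> 0 \<le> c \<and> (\<forall>q\<in>(\<Union>i\<le>n. F i). q x \<le> c)" for n x c
    using p0[rule_format, of n] by simp_all
  have top: "defines_topology p T"
    unfolding defines_topology_def
  proof (intro allI iffI conjI ballI)
    fix U assume U: "openin T U"
    then show "U \<subseteq> ?E" by (rule openin_subset)
    fix x assume x: "x \<in> U"
    then have xE: "x \<in> ?E" using \<open>U \<subseteq> ?E\<close> by auto
    obtain H e where H: "finite H" "H \<subseteq> Q" "0 < e" "{y \<in> ?E. \<forall>q\<in>H. q (y - x) < e} \<subseteq> U"
      using bspec[OF conjunct2[OF U[unfolded op]] x] by auto
    define W where "W = {y \<in> ?E. \<forall>q\<in>H. q y < e}"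
    have "openin T W"
      unfolding op
    proof (intro conjI ballI)
      fix w assume w: "w \<in> W"
      have "y \<in> W" if "y \<in> ?E" "\<forall>q\<in>H. q (y - w) < e" for y
        using that w H(2) Q sn_add[of _ "y - w" w] E_diff[of y w] unfolding W_def by fastforce
      then show "\<exists>F r. finite F \<and> F \<subseteq> Q \<and> 0 < r \<and> {y \<in> ?E. \<forall>q\<in>F. q (y - w) < r} \<subseteq> W"
        using H by (intro exI[of _ H] exI[of _ e]) auto
    qed (auto simp: W_def)
    moreover have "q 0 < e" if "q \<in> H" for q using sn_0[OF Q, of q] that H(2,3) by auto
    then have "0 \<in> W" by (auto simp: W_def)
    ultimately obtain t where t: "0 < t" "M.mball 0 t \<subseteq> W" unfolding T M.openin_mtopology by blast
    obtain n where n: "1 / real (Suc n) < t" using t(1) nat_approx_posE by blast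
    have "y \<in> U" if y: "y \<in> ?E" "p n (y - x) < r n" for y
    proof -
      have yx: "y - x \<in> ?E" using E_diff y xE by auto
      have "\<forall>q\<in>F n. q (y - x) < r n" using p_le[OF yx, of n "p n (y - x)"] y by fastforce
      then have "y - x \<in> M.mball 0 (1 / real (Suc n))" using F(4) yx by blast
      then have "y - x \<in> W" using t(2) n M.mball_subset_concentric[of "1 / real (Suc n)" t 0] by auto
      then show ?thesis using H(4) y by (auto simp: W_def)
    qed
    then show "\<exists>k. \<exists>r>0. {y \<in> ?E. p k (y - x) < r} \<subseteq> U" using F(3) by (intro exI[of _ n] exI[of _ "r n"]) auto
  next
    fix U assume R: "U \<subseteq> ?E \<and> (\<forall>x\<in>U. \<exists>k. \<exists>r>0. {y \<in> ?E. p k (y - x) < r} \<subseteq> U)"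
    show "openin T U"
      unfolding op
    proof (intro conjI ballI)
      show "U \<subseteq> ?E" using R by auto
      fix x assume x: "x \<in> U"
      then obtain k e where e: "0 < e" "{y \<in> ?E. p k (y - x) < e} \<subseteq> U" using R by blast
      have "y \<in> U" if y: "y \<in> ?E" "\<forall>q\<in>(\<Union>i\<le>k. F i). q (y - x) < e / 2" for y
      proof -
        have "p k (y - x) \<le> e / 2" using p_le[of "y - x" k "e / 2"] E_diff y x R e(1) by force
        then show ?thesis using e y by auto
      qed
      then show "\<exists>F r. finite F \<and> F \<subseteq> Q \<and> 0 < r \<and> {y \<in> ?E. \<forall>q\<in>F. q (y - x) < r} \<subseteq> U"
        using F e(1) by (intro exI[of _ "\<Union>i\<le>k. F i"] exI[of _ "e / 2"]) auto
    qed
  qed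
  have mono: "p k x \<le> p (Suc k) x" if "x \<in> ?E" for k x
    using p_le[OF that, of k "p (Suc k) x"] p_le[OF that, of "Suc k" "p (Suc k) x"] by force
  have sep: "x = 0" if x: "x \<in> ?E" "\<And>k. p k x = 0" for x
  proof (rule ccontr)
    assume "x \<noteq> 0"
    have "Hausdorff_space T" using lcs by (simp add: lcs_def)
    then obtain U where U: "openin T U" "0 \<in> U" "x \<notin> U"
      using x E_0 \<open>x \<noteq> 0\<close> unfolding Hausdorff_space_def disjnt_iff by metis
    then obtain k e where "0 < e" "{y \<in> ?E. p k (y - 0) < e} \<subseteq> U" using defines_topologyD[OF top] by blast
    then show False using x U by auto
  qed
  have ser: "\<exists>l. limitin T (\<lambda>N. \<Sum>n<N. x n) l sequentially"
    if x: "\<And>n. x n \<in> ?E" and lim: "limitin T x 0 sequentially" for x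
  proof -
    let ?S = "\<lambda>N. \<Sum>n<N. x n"
    have SE: "?S N \<in> ?E" for N by (intro E_sum x)
    have "cauchy_filter_in T (filtermap ?S sequentially)"
      unfolding cauchy_filter_in_def
    proof (intro conjI allI impI)
      show "filtermap ?S sequentially \<noteq> bot" by (simp add: filtermap_bot_iff)
      show "\<forall>\<^sub>F x in filtermap ?S sequentially. x \<in> ?E" unfolding eventually_filtermap using SE by simp
      fix U assume U: "openin T U \<and> 0 \<in> U"
      obtain k e where e: "0 < e" "{y \<in> ?E. p k (y - 0) < e} \<subseteq> U" using U defines_topologyD[OF top] by blast
      have "openin T {y \<in> ?E. p k y < e}"
      proof (rule defines_topologyI[OF top])
        fix z assume z: "z \<in> {y \<in> ?E. p k y < e}"
        have "p k y < e" if "y \<in> ?E" "p k (y - z) < e" for y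
          using sn_add[OF p, of "y - z" z k] that z E_diff[of y z] by auto
        then show "\<exists>j. \<exists>r>0. {y \<in> ?E. p j (y - z) < r} \<subseteq> {y \<in> ?E. p k y < e}"
          using e(1) by (intro exI[of _ k] exI[of _ e]) auto
      qed auto
      then have "\<forall>\<^sub>F n in sequentially. x n \<in> {y \<in> ?E. p k y < e}"
        by (rule limitinD[OF lim]) (use e(1) sn_0[OF p] in simp)
      then obtain n0 where n0: "\<And>n. n0 \<le> n \<Longrightarrow> p k (x n) < e" unfolding eventually_sequentially by blast
      have diff: "p k (?S N - ?S M) < e" if "n0 \<le> M" "M \<le> N" for M N
        using that(2)
      proof (induction N rule: dec_induct)
        case base
        then show ?case using e sn_0[OF p] by simp
      next
        case (step N)
        have "p k ((?S N - ?S M) + x N) \<le> max (p k (?S N - ?S M)) (p k (x N))"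
          by (rule sn_add[OF p]) (use SE x E_diff in auto)
        also have "\<dots> < e" using step that n0 by auto
        finally show ?case by (simp add: algebra_simps)
      qed
      have "p k (?S N - ?S M) < e" if "n0 \<le> M" "n0 \<le> N" for M N
        using diff[of M N] diff[of N M] that sn_commute[OF p SE SE, of k M N] by (cases "M \<le> N") auto
      then have "?S N - ?S M \<in> U" if "n0 \<le> M" "n0 \<le> N" for M N using that e(2) SE E_diff by auto
      then show "\<forall>\<^sub>F (x, y) in filtermap ?S sequentially \<times>\<^sub>F filtermap ?S sequentially. x - y \<in> U"
        unfolding eventually_prod_filter eventually_filtermap
        by (intro exI[of _ "\<lambda>z. \<exists>N\<ge>n0. z = ?S N"] conjI) (auto simp: eventually_sequentially)
    qed
    then obtain l where "limitin T (\<lambda>x. x) l (filtermap ?S sequentially)" using comp unfolding complete_tvs_def by blast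
    then show ?thesis unfolding limitin_def eventually_filtermap by blast
  qed
  show ?thesis
    by (rule exI[of _ p], unfold_locales) (use p mono sep top ser in auto)
qed

section \<open>Equicontinuity of Schauder decompositions\<close>

context frechet
begin

text \<open>The Banach--Steinhaus theorem for seminorms, by a gliding hump. If no common bound exists, one
  builds a convergent series such that the \<open>i\<close>-th partial sum \<open>y\<close> satisfies \<open>h n y > i\<close> for some
  \<open>n\<close>, while all later terms are so small that, by the isosceles triangle principle, they do not
  change this value.\<close>

lemma uniform_boundedness:
  assumes h: "\<And>n::nat. seminorm (h n)"
    and cont: "\<And>n. \<exists>m. \<exists>C>0. \<forall>x\<in>E. h n x \<le> C * p m x"
    and ptwise: "\<And>x. x \<in> E \<Longrightarrow> \<exists>c. \<forall>n. h n x \<le> c"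
  shows "\<exists>m. \<exists>C>0. \<forall>n. \<forall>x\<in>E. h n x \<le> C * p m x"
proof (rule ccontr)
  assume "\<not> ?thesis"
  then have unbdd: "\<exists>n. \<exists>x\<in>E. C * p m x < h n x" if "0 < C" for C m
    using that by (meson not_le)
  have large: "\<exists>n. \<exists>x\<in>E. p m x \<le> \<delta> \<and> R < h n x" if \<delta>: "0 < \<delta>" for m \<delta> R
  proof -
    define C where "C = (\<bar>R\<bar> + 1) / (step * \<delta>)"
    have C: "0 < C" unfolding C_def using step \<delta> by simp
    obtain n x where x: "x \<in> E" "C * p m x < h n x" using unbdd[OF C] by blast
    have hx: "0 < h n x" using x C p_nonneg[OF x(1), of m] by (smt (verit) mult_nonneg_nonneg)
    show ?thesis
    proof (cases "p m x = 0")
      case True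
      obtain a where a: "step * ((\<bar>R\<bar> + 1) / step) < v a * h n x"
        using ex_scaling[OF hx, of "(\<bar>R\<bar> + 1) / step"] step by auto
      then have "R < h n (s a x)" using sn_scale[OF h x(1)] step by simp
      moreover have "p m (s a x) \<le> \<delta>" using p_scale[OF x(1)] True \<delta> by simp
      ultimately show ?thesis using E_scale[OF x(1)] by blast
    next
      case False
      then have "0 < p m x" using p_nonneg[OF x(1), of m] by linarith
      then obtain a where a: "a \<noteq> 0" "step * \<delta> < v a * p m x" "v a * p m x \<le> \<delta>"
        using ex_scaling[of "p m x" \<delta>] \<delta> by auto
      have "\<bar>R\<bar> + 1 = C * (step * \<delta>)" unfolding C_def using step \<delta> by simp
      also have "\<dots> \<le> C * (v a * p m x)" using a C by (intro mult_left_mono) auto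
      also have "\<dots> = v a * (C * p m x)" by simp
      also have "\<dots> \<le> v a * h n x" using x nonneg by (intro mult_left_mono) auto
      finally have "R < h n (s a x)" using sn_scale[OF h x(1)] by simp
      moreover have "p m (s a x) \<le> \<delta>" using p_scale[OF x(1)] a by simp
      ultimately show ?thesis using E_scale[OF x(1)] by blast
    qed
  qed
  \<comment> \<open>A state \<open>(y, n, m, d)\<close> consists of the partial sum \<open>y\<close>, an index \<open>n\<close> with \<open>h n y\<close> large, and the
    requirement that all later terms \<open>z\<close> satisfy \<open>p m z \<le> d\<close>.\<close>
  define good where "good i st \<longleftrightarrow> (case st of (y, n, m, d) \<Rightarrow>
      y \<in> E \<and> real i < h n y \<and> 0 < d \<and> (\<forall>z\<in>E. p m z \<le> d \<longrightarrow> h n z \<le> real i))"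
    for i :: nat and st :: "'b \<times> nat \<times> nat \<times> real"
  define refines where "refines i st st' \<longleftrightarrow> (case st of (y, n, m, d) \<Rightarrow> case st' of (y', n', m', d') \<Rightarrow>
      p m (y' - y) \<le> d \<and> p i (y' - y) \<le> (1/2) ^ i \<and> m \<le> m' \<and> d' \<le> d)"
    for i :: nat and st st' :: "'b \<times> nat \<times> nat \<times> real"
  have step_ex: "\<exists>n' y' m' d'. good i (y', n', m', d') \<and> p m (y' - y) \<le> d \<and> p j (y' - y) \<le> (1/2) ^ j \<and>
      m \<le> m' \<and> d' \<le> d"
    if y: "y \<in> E" and d: "0 < d" and i: "0 < i" for y m d i j
  proof -
    obtain c where c: "\<And>n. h n y \<le> c" using ptwise[OF y] by blast
    obtain n x where x: "x \<in> E" "p (max m j) x \<le> min d ((1/2) ^ j)" "max (real i) c < h n x"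
      using large[of "min d ((1/2) ^ j)" "max m j" "max (real i) c"] d by auto
    have "h n (y + x) = h n x" by (rule sn_add_eq[OF h y x(1)]) (use c[of n] x(3) in simp)
    then have hy: "real i < h n (y + x)" using x by simp
    obtain m1 C where C: "0 < C" "\<And>x. x \<in> E \<Longrightarrow> h n x \<le> C * p m1 x" using cont by blast
    define m' where "m' = max m m1"
    define d' where "d' = min d (real i / C)"
    have "h n z \<le> real i" if z: "z \<in> E" "p m' z \<le> d'" for z
    proof -
      have "p m1 z \<le> real i / C" using z p_mono[of m1 m' z] unfolding m'_def d'_def by simp
      then show ?thesis using C(2)[OF z(1)] C(1) by (simp add: field_simps)
    qed
    then have "good i (y + x, n, m', d')"
      unfolding good_def using hy y x E_add d i C by (auto simp: d'_def)
    moreover have "p m (y + x - y) \<le> d" "p j (y + x - y) \<le> (1/2) ^ j"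
      using p_mono[of m "max m j" x] p_mono[of j "max m j" x] x by auto
    moreover have "m \<le> m'" "d' \<le> d" by (auto simp: m'_def d'_def)
    ultimately show ?thesis by blast
  qed
  have "\<exists>f. \<forall>i. good (Suc i) (f i) \<and> refines i (f i) (f (Suc i))"
  proof (rule dependent_nat_choice)
    show "\<exists>st. good (Suc 0) st" using step_ex[of 0 1 1 0 0] by auto
  next
    fix st i assume g: "good (Suc i) st"
    obtain y n m d where st: "st = (y, n, m, d)" by (metis surj_pair)
    have "y \<in> E" "0 < d" using g by (auto simp: good_def st)
    then show "\<exists>st'. good (Suc (Suc i)) st' \<and> refines i st st'"
      using step_ex[of y d "Suc (Suc i)" m i] unfolding refines_def st by fastforce
  qed
  then obtain f where f: "\<And>i. good (Suc i) (f i)" "\<And>i. refines i (f i) (f (Suc i))" by blast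
  define y n m d where "y i = fst (f i)" and "n i = fst (snd (f i))" and "m i = fst (snd (snd (f i)))"
    and "d i = snd (snd (snd (f i)))" for i
  have f_eq: "f i = (y i, n i, m i, d i)" for i by (simp add: y_def n_def m_def d_def)
  have yE: "y i \<in> E" and hy: "real (Suc i) < h (n i) (y i)"
    and hz: "\<And>z. z \<in> E \<Longrightarrow> p (m i) z \<le> d i \<Longrightarrow> h (n i) z \<le> real (Suc i)" for i
    using f(1)[of i] unfolding good_def f_eq by auto
  have pm: "p (m i) (y (Suc i) - y i) \<le> d i" and pi: "p i (y (Suc i) - y i) \<le> (1/2) ^ i"
    and mSuc: "m i \<le> m (Suc i)" and dSuc: "d (Suc i) \<le> d i" for i
    using f(2)[of i] unfolding refines_def f_eq by auto
  have m_mono: "m i \<le> m j" and d_mono: "d j \<le> d i" if "i \<le> j" for i j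
    using that by (induction j rule: dec_induct) (use mSuc dSuc order_trans in blast)+
  have y_diff: "p (m i) (y j - y i) \<le> d i" if "i \<le> j" for i j
    using that
  proof (induction j rule: dec_induct)
    case base
    have "0 < d i" using f(1)[of i] by (auto simp: good_def f_eq)
    then show ?case by simp
  next
    case (step j)
    have "p (m i) (y (Suc j) - y j) \<le> p (m j) (y (Suc j) - y j)"
      by (rule p_mono[OF m_mono]) (use step yE E_diff in auto)
    also have "\<dots> \<le> d i" using pm[of j] d_mono[of i j] step by simp
    finally show ?case using p_triangle[OF yE yE yE, of "m i" "Suc j" i j] step by simp
  qed
  let ?x = "\<lambda>i. y (Suc i) - y i"
  have "(\<lambda>i. p k (?x i)) \<longlonglongrightarrow> 0" for k
  proof (rule tendsto_sandwich[OF _ _ tendsto_const])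
    show "(\<lambda>i. (1/2::real) ^ i) \<longlonglongrightarrow> 0" by (rule LIMSEQ_realpow_zero) auto
    show "\<forall>\<^sub>F i in sequentially. 0 \<le> p k (?x i)" using p_nonneg E_diff yE by simp
    show "\<forall>\<^sub>F i in sequentially. p k (?x i) \<le> (1/2) ^ i"
      using eventually_ge_at_top[of k]
    proof eventually_elim
      case (elim i)
      show ?case using p_mono[OF elim, of "?x i"] pi[of i] yE E_diff by auto
    qed
  qed
  then obtain l where l: "l \<in> E" "\<And>k. (\<lambda>N. p k ((\<Sum>i<N. ?x i) - l)) \<longlonglongrightarrow> 0"
    using series[of ?x] yE E_diff by blast
  define z where "z = l + y 0"
  have zE: "z \<in> E" unfolding z_def using l yE E_add by auto
  have "(\<Sum>i<N. ?x i) - l = y N - z" for N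
    unfolding z_def sum_lessThan_telescope by (simp add: algebra_simps)
  then have lim: "(\<lambda>N. p k (y N - z)) \<longlonglongrightarrow> 0" for k using l(2)[of k] by simp
  have "real (Suc i) < h (n i) z" for i
  proof -
    have "p (m i) (z - y i) \<le> d i"
    proof (rule limit_p_le[of "\<lambda>N. y N - y i"])
      show "(\<lambda>N. p (m i) (y N - y i - (z - y i))) \<longlonglongrightarrow> 0" using lim[of "m i"] by simp
      show "\<forall>\<^sub>F N in sequentially. p (m i) (y N - y i) \<le> d i"
        using eventually_ge_at_top[of i] by (rule eventually_mono) (rule y_diff)
    qed (use yE zE E_diff in auto)
    then have "h (n i) (z - y i) \<le> real (Suc i)" using hz zE yE E_diff by blast
    then have "h (n i) (z - y i) < h (n i) (y i)" using hy[of i] by linarith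
    then have "h (n i) (z - y i + y i) = h (n i) (y i)" by (intro sn_add_eq[OF h]) (use yE zE E_diff in auto)
    then show ?thesis using hy[of i] by simp
  qed
  moreover obtain c where "\<And>n. h n z \<le> c" using ptwise[OF zE] by blast
  ultimately have "real (Suc i) < c" for i by (rule less_le_trans)
  moreover obtain i where "c < real i" using reals_Archimedean2 by blast
  moreover have "real i < real (Suc i)" by simp
  ultimately show False by (meson less_asym less_trans)
qed

end

locale schauder = frechet v s T p
  for v :: "'k::field \<Rightarrow> real" and s :: "'k \<Rightarrow> 'b::ab_group_add \<Rightarrow> 'b" and T :: "'b topology" and p +
  fixes P :: "nat \<Rightarrow> 'b \<Rightarrow> 'b"
  assumes decomposition: "schauder_decomposition s T P"
begin

lemma P_linear: "linear_map_on s s E (P n)" and P_continuous: "continuous_map T T (P n)"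
  using decomposition by (auto simp: schauder_decomposition_def continuous_endomorphisms_def)

lemma P_E: "x \<in> E \<Longrightarrow> P n x \<in> E"
  using P_continuous[of n] by (meson continuous_map_image_subset_topspace image_subset_iff)

lemma P_add: "x \<in> E \<Longrightarrow> y \<in> E \<Longrightarrow> P n (x + y) = P n x + P n y"
  and P_scale: "x \<in> E \<Longrightarrow> P n (s a x) = s a (P n x)"
  using P_linear[of n] by (auto simp: linear_map_on_def)

lemma P_0 [simp]: "P n 0 = 0"
  using P_scale[of 0 n 0] by simp

lemma P_diff: "x \<in> E \<Longrightarrow> y \<in> E \<Longrightarrow> P n (x - y) = P n x - P n y"
  using P_add[of "x - y" y n] E_diff by (simp add: eq_diff_eq)

lemma P_sum: "(\<And>i. i \<in> I \<Longrightarrow> x i \<in> E) \<Longrightarrow> P n (\<Sum>i\<in>I. x i) = (\<Sum>i\<in>I. P n (x i))"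
  by (induction I rule: infinite_finite_induct) (auto simp: P_add E_sum)

lemma P_P: "x \<in> E \<Longrightarrow> P n (P m x) = (if n = m then P n x else 0)"
  using decomposition unfolding schauder_decomposition_def by blast

lemma P_sums: "x \<in> E \<Longrightarrow> (\<lambda>N. p k ((\<Sum>n<N. P n x) - x)) \<longlonglongrightarrow> 0"
proof -
  assume x: "x \<in> E"
  then have "limitin T (\<lambda>N. \<Sum>n<N. P n x) x sequentially"
    using decomposition unfolding schauder_decomposition_def by blast
  moreover have "(\<Sum>n<N. P n x) \<in> E" for N by (intro E_sum P_E x)
  ultimately show ?thesis using limitin_iff[of "\<lambda>N. \<Sum>n<N. P n x" x] by auto
qed

lemma P_tendsto_0: "x \<in> E \<Longrightarrow> (\<lambda>n. p k (P n x)) \<longlonglongrightarrow> 0"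
proof -
  assume x: "x \<in> E"
  let ?S = "\<lambda>N. (\<Sum>n<N. P n x) - x"
  have SE: "?S N \<in> E" for N by (intro E_diff E_sum P_E x)
  have lim: "(\<lambda>N. max (p k (?S (Suc N))) (p k (?S N))) \<longlonglongrightarrow> max 0 0"
    using P_sums[OF x, of k] LIMSEQ_Suc[OF P_sums[OF x, of k]] by (intro tendsto_max)
  have "p k (P N x) \<le> max (p k (?S (Suc N))) (p k (?S N))" for N
    using p_diff[OF SE SE, of k "Suc N" N] by simp
  then show ?thesis using lim p_nonneg[OF P_E[OF x]]
    by (intro tendsto_sandwich[OF _ _ tendsto_const lim[simplified]]) auto
qed

lemma P_bounded_pointwise: "x \<in> E \<Longrightarrow> \<exists>c. \<forall>n. p k (P n x) \<le> c"
proof -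
  assume x: "x \<in> E"
  have "Bseq (\<lambda>n. p k (P n x))" using P_tendsto_0[OF x, of k] by (meson convergentI convergent_imp_Bseq)
  then obtain c where "\<And>n. \<bar>p k (P n x)\<bar> \<le> c" by (auto simp: Bseq_def)
  then show ?thesis by (meson abs_le_D1)
qed

lemma P_seminorm: "seminorm (\<lambda>x. p k (P n x))"
  unfolding nonarch_seminorm_def by (simp add: p_nonneg P_E P_add p_add P_scale p_scale)

lemma equicontinuous: "\<exists>m\<ge>k. \<exists>C>0. \<forall>n. \<forall>x\<in>E. p k (P n x) \<le> C * p m x"
proof -
  have "\<exists>m. \<exists>C>0. \<forall>n. \<forall>x\<in>E. p k (P n x) \<le> C * p m x"
  proof (rule uniform_boundedness)
    show "seminorm (\<lambda>x. p k (P n x))" for n by (rule P_seminorm)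
    have "P n \<in> continuous_endomorphisms s T" for n
      using decomposition by (simp add: schauder_decomposition_def)
    then show "\<exists>m. \<exists>C>0. \<forall>x\<in>E. p k (P n x) \<le> C * p m x" for n by (rule continuous_linear_bounded)
  qed (rule P_bounded_pointwise)
  then obtain m C where C: "0 < C" "\<And>n x. x \<in> E \<Longrightarrow> p k (P n x) \<le> C * p m x" by blast
  have "p k (P n x) \<le> C * p (max k m) x" if x: "x \<in> E" for n x
  proof -
    have "C * p m x \<le> C * p (max k m) x" using C(1) p_mono[of m "max k m" x] x by (intro mult_left_mono) auto
    then show ?thesis using C(2)[OF x, of n] by linarith
  qed
  then show ?thesis using C(1) by (intro exI[of _ "max k m"]) auto
qed

lemma p_le_sup:
  assumes x: "x \<in> E" and M: "\<And>n. p k (P n x) \<le> M"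
  shows "p k x \<le> M"
proof (rule limit_p_le)
  show "(\<lambda>N. p k ((\<Sum>n<N. P n x) - x)) \<longlonglongrightarrow> 0" by (rule P_sums[OF x])
  have "0 \<le> M" using M[of 0] p_nonneg[OF P_E[OF x], of k 0] by linarith
  then show "\<forall>\<^sub>F N in sequentially. p k (\<Sum>n<N. P n x) \<le> M"
    using M P_E x by (intro always_eventually allI p_sum) auto
qed (use x in \<open>auto intro: E_sum P_E\<close>)

end

text \<open>A Schauder decomposition is orthogonal when the projections are contractions for each of the
  chosen seminorms, so that every seminorm is the supremum of its values on the components.\<close>

locale orthogonal_schauder = schauder v s T p P
  for v :: "'k::field \<Rightarrow> real" and s :: "'k \<Rightarrow> 'b::ab_group_add \<Rightarrow> 'b" and T :: "'b topology" and p P +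
  assumes P_le: "x \<in> topspace T \<Longrightarrow> p k (P n x) \<le> p k x"

text \<open>The suprema of the seminorms over the components; equicontinuity makes them continuous.\<close>

lemma (in schauder) ex_orthogonal: "\<exists>q. orthogonal_schauder v s T q P"
proof -
  define q where "q k x = (SUP n. p k (P n x))" for k x
  have bdd: "bdd_above (range (\<lambda>n. p k (P n x)))" if "x \<in> E" for k x
    using P_bounded_pointwise[OF that, of k] by (auto simp: bdd_above_def)
  have q_ge: "p k (P n x) \<le> q k x" if "x \<in> E" for k n x
    unfolding q_def by (rule cSUP_upper[OF _ bdd[OF that]]) simp
  have q_le: "q k x \<le> M" if "\<And>n. p k (P n x) \<le> M" for k x M
    unfolding q_def using that by (intro cSUP_least) auto
  have q_nonneg: "0 \<le> q k x" if "x \<in> E" for k x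
    using q_ge[OF that, of k 0] p_nonneg[OF P_E[OF that], of k 0] by linarith
  have p_q: "p k x \<le> q k x" if "x \<in> E" for k x using p_le_sup[OF that q_ge[OF that]] .
  have q_scale_le: "q k (s a x) \<le> v a * q k x" if "x \<in> E" for k a x
    using that q_ge[OF that] nonneg by (intro q_le) (auto simp: P_scale P_E p_scale intro: mult_left_mono)
  have q_seminorm: "seminorm (q k)" for k
  proof (rule seminormI[OF q_nonneg _ q_scale_le], assumption)
    fix x y assume x: "x \<in> E" and y: "y \<in> E"
    show "q k (x + y) \<le> max (q k x) (q k y)"
    proof (rule q_le)
      fix n
      have "p k (P n (x + y)) \<le> max (p k (P n x)) (p k (P n y))" using x y by (simp add: P_add p_add P_E)
      also have "\<dots> \<le> max (q k x) (q k y)" using q_ge x y by (intro max.mono) auto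
      finally show "p k (P n (x + y)) \<le> max (q k x) (q k y)" .
    qed
  qed
  have q_Suc: "q k x \<le> q (Suc k) x" if x: "x \<in> E" for k x
    by (rule q_le) (meson P_E order_trans p_Suc q_ge x)
  have "defines_topology q T"
  proof (rule defines_topology_equivalent[OF p_topology])
    fix k
    obtain m C where C: "0 < C" "\<And>n x. x \<in> E \<Longrightarrow> p k (P n x) \<le> C * p m x" using equicontinuous[of k] by blast
    then have "\<forall>x\<in>E. q k x \<le> C * p m x" by (auto intro: q_le)
    then show "\<exists>m. \<exists>C>0. \<forall>x\<in>E. q k x \<le> C * p m x" using C(1) by blast
    show "\<exists>m. \<exists>C>0. \<forall>x\<in>E. p k x \<le> C * q m x" using p_q by (intro exI[of _ k] exI[of _ 1]) auto
  qed (rule E_diff)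
  moreover have "q k (P n x) \<le> q k x" if "x \<in> E" for k n x
    using that q_ge[OF that] q_nonneg[OF that] by (intro q_le) (auto simp: P_P)
  moreover have "x = 0" if "x \<in> E" "\<And>k. q k x = 0" for x
    using that p_q[OF that(1)] p_nonneg[OF that(1)] by (intro p_separating) (auto intro: order_antisym)
  ultimately show ?thesis
    using q_seminorm q_Suc series_convergent decomposition by (intro exI[of _ q], unfold_locales) auto
qed

section \<open>The three exceptional spaces\<close>

lemma defines_topology_prod:
  assumes p: "defines_topology p T" and q: "defines_topology q T'"
    and p_ball: "\<And>x k r. x \<in> topspace T \<Longrightarrow> openin T {y \<in> topspace T. p k (y - x) < r}"
    and q_ball: "\<And>x k r. x \<in> topspace T' \<Longrightarrow> openin T' {y \<in> topspace T'. q k (y - x) < r}"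
    and p0: "\<And>k. p k 0 = 0" and q0: "\<And>k. q k 0 = 0"
    and p_nonneg: "\<And>x y k. x \<in> topspace T \<Longrightarrow> y \<in> topspace T \<Longrightarrow> 0 \<le> p k (y - x)"
    and q_nonneg: "\<And>x y k. x \<in> topspace T' \<Longrightarrow> y \<in> topspace T' \<Longrightarrow> 0 \<le> q k (y - x)"
    and p_mono: "\<And>x y j k. j \<le> k \<Longrightarrow> x \<in> topspace T \<Longrightarrow> y \<in> topspace T \<Longrightarrow> p j (y - x) \<le> p k (y - x)"
    and q_mono: "\<And>x y j k. j \<le> k \<Longrightarrow> x \<in> topspace T' \<Longrightarrow> y \<in> topspace T' \<Longrightarrow> q j (y - x) \<le> q k (y - x)"
  shows "defines_topology (\<lambda>k z. p k (fst z) + q k (snd z)) (prod_topology T T')"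
  unfolding defines_topology_def
proof (intro allI iffI conjI ballI)
  fix S assume S: "openin (prod_topology T T') S"
  then show sub: "S \<subseteq> topspace (prod_topology T T')" by (rule openin_subset)
  fix z assume z: "z \<in> S"
  obtain x y where xy: "z = (x, y)" by (cases z)
  have xT: "x \<in> topspace T" "y \<in> topspace T'" using sub z xy by auto
  obtain U V where UV: "openin T U" "openin T' V" "x \<in> U" "y \<in> V" "U \<times> V \<subseteq> S"
    using S[unfolded openin_prod_topology_alt, rule_format, of x y] z xy by auto
  obtain k r where k: "0 < r" "{a \<in> topspace T. p k (a - x) < r} \<subseteq> U" using defines_topologyD[OF p UV(1,3)] .
  obtain l t where l: "0 < t" "{a \<in> topspace T'. q l (a - y) < t} \<subseteq> V" using defines_topologyD[OF q UV(2,4)] .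
  define m where "m = max k l"
  have "w \<in> S" if w: "w \<in> topspace (prod_topology T T')" "p m (fst (w - z)) + q m (snd (w - z)) < min r t" for w
  proof -
    obtain a b where ab: "w = (a, b)" by (cases w)
    have abT: "a \<in> topspace T" "b \<in> topspace T'" using w ab by auto
    have "p k (a - x) \<le> p m (a - x)" "q l (b - y) \<le> q m (b - y)" "0 \<le> p m (a - x)" "0 \<le> q m (b - y)"
      using p_mono[of k m x a] q_mono[of l m y b] p_nonneg[of x a m] q_nonneg[of y b m] xT abT by (auto simp: m_def)
    then have "p k (a - x) < r" "q l (b - y) < t" using w(2) by (auto simp: xy ab)
    then show ?thesis using k l UV(5) abT ab by blast
  qed
  then show "\<exists>k. \<exists>r>0. {w \<in> topspace (prod_topology T T'). p k (fst (w - z)) + q k (snd (w - z)) < r} \<subseteq> S"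
    using k(1) l(1) by (intro exI[of _ m] exI[of _ "min r t"]) auto
next
  fix S assume R: "S \<subseteq> topspace (prod_topology T T') \<and>
    (\<forall>z\<in>S. \<exists>k. \<exists>r>0. {w \<in> topspace (prod_topology T T'). p k (fst (w - z)) + q k (snd (w - z)) < r} \<subseteq> S)"
  show "openin (prod_topology T T') S"
    unfolding openin_prod_topology_alt
  proof (intro allI impI)
    fix x y assume xy: "(x, y) \<in> S"
    obtain k r where k: "0 < r"
      "{w \<in> topspace (prod_topology T T'). p k (fst (w - (x, y))) + q k (snd (w - (x, y))) < r} \<subseteq> S"
      using bspec[OF conjunct2[OF R] xy] by auto
    have xT: "x \<in> topspace T" "y \<in> topspace T'" using R xy by auto
    define e where "e = r / 2"
    have e: "0 < e" "r = e + e" using k(1) by (auto simp: e_def)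
    let ?U = "{a \<in> topspace T. p k (a - x) < e}" and ?V = "{b \<in> topspace T'. q k (b - y) < e}"
    have "?U \<times> ?V \<subseteq> S"
    proof
      fix w assume "w \<in> ?U \<times> ?V"
      then have "w \<in> {w \<in> topspace (prod_topology T T'). p k (fst (w - (x, y))) + q k (snd (w - (x, y))) < r}" using e(2) by auto
      then show "w \<in> S" using k(2) by blast
    qed
    then show "\<exists>U V. openin T U \<and> openin T' V \<and> x \<in> U \<and> y \<in> V \<and> U \<times> V \<subseteq> S"
      using p_ball[OF xT(1)] q_ball[OF xT(2)] xT e(1) p0 q0 by (intro exI[of _ ?U] exI[of _ ?V]) auto
  qed
qed

context complete_nonarch_field
begin

lemma vector_space_seq_scale: "vector_space seq_scale"
  by unfold_locales (auto simp: seq_scale_def fun_eq_iff algebra_simps)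

lemma c0_bounded: "x \<in> c0_carrier v \<Longrightarrow> bdd_above (range (\<lambda>n. v (x n)))"
proof -
  assume "x \<in> c0_carrier v"
  then have "(\<lambda>n. v (x n)) \<longlonglongrightarrow> 0" by (simp add: c0_carrier_def)
  then have "Bseq (\<lambda>n. v (x n))" by (meson convergentI convergent_imp_Bseq)
  then obtain c where "\<And>n. \<bar>v (x n)\<bar> \<le> c" by (auto simp: Bseq_def)
  then show ?thesis by (meson abs_le_D1 bdd_aboveI2)
qed

lemma sup_norm_ge: "x \<in> c0_carrier v \<Longrightarrow> v (x n) \<le> sup_norm v x"
  unfolding sup_norm_def by (rule cSUP_upper[OF _ c0_bounded]) auto

lemma sup_norm_le: "(\<And>n. v (x n) \<le> c) \<Longrightarrow> sup_norm v x \<le> c"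
  unfolding sup_norm_def by (intro cSUP_least) auto

lemma c0_carrierI:
  assumes "\<And>e. 0 < e \<Longrightarrow> finite {n. e \<le> v (x n)}"
  shows "x \<in> c0_carrier v"
proof -
  have "\<forall>\<^sub>F n in sequentially. norm (v (x n) - 0) < e" if e: "0 < e" for e
  proof -
    have "\<forall>\<^sub>F n in cofinite. \<not> e \<le> v (x n)" using assms[OF e] by (simp add: eventually_cofinite)
    then show ?thesis unfolding cofinite_eq_sequentially by (rule eventually_mono) (use nonneg in auto)
  qed
  then show ?thesis unfolding c0_carrier_def by (simp add: tendsto_iff dist_norm)
qed

lemma c0_carrierD:
  assumes "x \<in> c0_carrier v" "0 < e"
  shows "finite {n. e \<le> v (x n)}"
proof -
  have "\<forall>\<^sub>F n in sequentially. v (x n) < e"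
    using assms by (intro order_tendstoD(2)[of _ 0]) (auto simp: c0_carrier_def)
  then show ?thesis by (simp add: eventually_cofinite not_less flip: cofinite_eq_sequentially)
qed

lemma nonarch_vector_space_c0: "nonarch_vector_space v seq_scale (c0_carrier v)"
proof -
  interpret F: vector_space "seq_scale :: 'k \<Rightarrow> (nat \<Rightarrow> 'k) \<Rightarrow> _" by (rule vector_space_seq_scale)
  have "F.subspace (c0_carrier v)"
    unfolding F.subspace_def
  proof (intro conjI ballI allI)
    show "0 \<in> c0_carrier v" by (simp add: c0_carrier_def)
    show "x + y \<in> c0_carrier v" if "x \<in> c0_carrier v" "y \<in> c0_carrier v" for x y
    proof (rule c0_carrierI)
      fix e :: real assume e: "0 < e"
      have "{n. e \<le> v ((x + y) n)} \<subseteq> {n. e \<le> v (x n)} \<union> {n. e \<le> v (y n)}"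
      proof
        fix n assume "n \<in> {n. e \<le> v ((x + y) n)}"
        then have "e \<le> max (v (x n)) (v (y n))" using ultrametric[of "x n" "y n"] by simp
        then show "n \<in> {n. e \<le> v (x n)} \<union> {n. e \<le> v (y n)}" by (auto simp: le_max_iff_disj)
      qed
      then show "finite {n. e \<le> v ((x + y) n)}" using c0_carrierD that e finite_subset by blast
    qed
    show "seq_scale a x \<in> c0_carrier v" if "x \<in> c0_carrier v" for a x
      using tendsto_mult_right_zero[of "\<lambda>n. v (x n)" sequentially "v a"] that
      by (simp add: c0_carrier_def seq_scale_def mult)
  qed
  then show ?thesis
    using complete_nonarch_field_axioms vector_space_seq_scale
    by (auto simp: nonarch_vector_space_def nonarch_vector_space_axioms_def)
qed

lemma nonarch_seminorm_sup_norm: "nonarch_seminorm v seq_scale (c0_carrier v) (sup_norm v)"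
proof -
  interpret C: nonarch_vector_space v seq_scale "c0_carrier v" by (rule nonarch_vector_space_c0)
  have pos: "0 \<le> sup_norm v x" if "x \<in> c0_carrier v" for x
    using sup_norm_ge[OF that, of 0] nonneg[of "x 0"] by linarith
  have scale: "sup_norm v (seq_scale a x) \<le> v a * sup_norm v x" if "x \<in> c0_carrier v" for a x
    using sup_norm_ge[OF that] nonneg by (intro sup_norm_le) (auto simp: seq_scale_def mult intro: mult_left_mono)
  show ?thesis
  proof (rule C.seminormI[OF pos _ scale], assumption)
    fix x y assume x: "x \<in> c0_carrier v" and y: "y \<in> c0_carrier v"
    show "sup_norm v (x + y) \<le> max (sup_norm v x) (sup_norm v y)"
    proof (rule sup_norm_le)
      fix n
      have "v ((x + y) n) \<le> max (v (x n)) (v (y n))" using ultrametric by simp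
      also have "\<dots> \<le> max (sup_norm v x) (sup_norm v y)" using sup_norm_ge x y by (intro max.mono)
      finally show "v ((x + y) n) \<le> max (sup_norm v x) (sup_norm v y)" .
    qed
  qed
qed

lemma openin_c0_space:
  "openin (c0_space v) U \<longleftrightarrow> U \<subseteq> c0_carrier v \<and>
    (\<forall>x\<in>U. \<exists>r>0. {y \<in> c0_carrier v. sup_norm v (y - x) < r} \<subseteq> U)"
proof -
  interpret C: nonarch_vector_space v seq_scale "c0_carrier v" by (rule nonarch_vector_space_c0)
  have "(\<exists>F r. finite F \<and> F \<subseteq> {sup_norm v} \<and> 0 < r \<and> {y \<in> c0_carrier v. \<forall>q\<in>F. q (y - x) < r} \<subseteq> U) \<longleftrightarrow>
    (\<exists>r>0. {y \<in> c0_carrier v. sup_norm v (y - x) < r} \<subseteq> U)" for x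
  proof
    assume "\<exists>F r. finite F \<and> F \<subseteq> {sup_norm v} \<and> 0 < r \<and> {y \<in> c0_carrier v. \<forall>q\<in>F. q (y - x) < r} \<subseteq> U"
    then obtain F r where "F \<subseteq> {sup_norm v}" "0 < r" "{y \<in> c0_carrier v. \<forall>q\<in>F. q (y - x) < r} \<subseteq> U" by blast
    then show "\<exists>r>0. {y \<in> c0_carrier v. sup_norm v (y - x) < r} \<subseteq> U" by (intro exI[of _ r]) auto
  next
    assume "\<exists>r>0. {y \<in> c0_carrier v. sup_norm v (y - x) < r} \<subseteq> U"
    then obtain r where "0 < r" "{y \<in> c0_carrier v. sup_norm v (y - x) < r} \<subseteq> U" by blast
    then show "\<exists>F r. finite F \<and> F \<subseteq> {sup_norm v} \<and> 0 < r \<and> {y \<in> c0_carrier v. \<forall>q\<in>F. q (y - x) < r} \<subseteq> U"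
      by (intro exI[of _ "{sup_norm v}"] exI[of _ r]) auto
  qed
  then show ?thesis
    using C.openin_seminorm_topology[of "{sup_norm v}" U] nonarch_seminorm_sup_norm by (simp add: c0_space_def)
qed

lemma topspace_c0_space [simp]: "topspace (c0_space v) = c0_carrier v"
proof
  show "topspace (c0_space v) \<subseteq> c0_carrier v" using openin_c0_space openin_topspace by blast
  have "openin (c0_space v) (c0_carrier v)" unfolding openin_c0_space by (auto intro: exI[of _ 1])
  then show "c0_carrier v \<subseteq> topspace (c0_space v)" by (rule openin_subset)
qed

lemma defines_topology_c0: "defines_topology (\<lambda>k. sup_norm v) (c0_space v)"
  unfolding defines_topology_def topspace_c0_space openin_c0_space by simp

lemma topspace_seq_space [simp]: "topspace (seq_space v) = UNIV"
proof -
  interpret M: Metric_space UNIV "val_dist v" by (rule metric)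
  show ?thesis by (simp add: seq_space_def)
qed

lemma defines_topology_seq: "defines_topology (\<lambda>k y. \<Sum>i<k. v (y i)) (seq_space v)"
proof -
  interpret M: Metric_space UNIV "val_dist v" by (rule metric)
  have mball: "y \<in> M.mball x r \<longleftrightarrow> v (y - x) < r" for x y r
    using v_minus[of "x - y"] by (simp add: val_dist_def)
  have op: "openin (seq_space v) U \<longleftrightarrow> (\<forall>x\<in>U. \<exists>V. finite {i. V i \<noteq> UNIV} \<and> (\<forall>i. openin M.mtopology (V i)) \<and>
      (\<forall>i. x i \<in> V i) \<and> {y. \<forall>i. y i \<in> V i} \<subseteq> U)" for U
    unfolding seq_space_def openin_product_topology_alt by (simp add: PiE_UNIV_domain Pi_def)
  show ?thesis
    unfolding defines_topology_def topspace_seq_space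
  proof (intro allI iffI conjI ballI)
    fix U :: "(nat \<Rightarrow> 'k) set" and x assume U: "openin (seq_space v) U" and x: "x \<in> U"
    obtain V where V: "finite {i. V i \<noteq> UNIV}" "\<And>i. openin M.mtopology (V i)" "\<And>i. x i \<in> V i" "{y. \<forall>i. y i \<in> V i} \<subseteq> U"
      using U x unfolding op by blast
    define I where "I = {i. V i \<noteq> UNIV}"
    have "\<exists>r>0. M.mball (x i) r \<subseteq> V i" for i using V(2,3) unfolding M.openin_mtopology by blast
    then obtain r where r: "\<And>i. 0 < r i" "\<And>i. M.mball (x i) (r i) \<subseteq> V i" by metis
    define t where "t = Min (insert 1 (r ` I))"
    have t: "0 < t" "\<And>i. i \<in> I \<Longrightarrow> t \<le> r i" unfolding t_def using V(1) r(1) by (auto simp: I_def)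
    define k where "k = Suc (Max (insert 0 I))"
    have k: "i < k" if "i \<in> I" for i unfolding k_def using V(1) that by (auto simp: I_def less_Suc_eq_le)
    have "y \<in> U" if y: "(\<Sum>i<k. v ((y - x) i)) < t" for y
    proof -
      have "y i \<in> V i" for i
      proof (cases "i \<in> I")
        case True
        have "v ((y - x) i) \<le> (\<Sum>i<k. v ((y - x) i))"
          using k[OF True] nonneg by (intro member_le_sum) auto
        then have "v (y i - x i) < r i" using y t(2)[OF True] by simp
        then show ?thesis using r(2) mball by blast
      qed (auto simp: I_def)
      then show ?thesis using V(4) by blast
    qed
    then show "\<exists>k. \<exists>r>0. {y \<in> UNIV. (\<Sum>i<k. v ((y - x) i)) < r} \<subseteq> U" using t(1) by (intro exI[of _ k] exI[of _ t]) auto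
  next
    fix U :: "(nat \<Rightarrow> 'k) set"
    assume R: "U \<subseteq> UNIV \<and> (\<forall>x\<in>U. \<exists>k. \<exists>r>0. {y \<in> UNIV. (\<Sum>i<k. v ((y - x) i)) < r} \<subseteq> U)"
    show "openin (seq_space v) U"
      unfolding op
    proof
      fix x assume "x \<in> U"
      then obtain k r where k: "0 < r" "\<And>y. (\<Sum>i<k. v ((y - x) i)) < r \<Longrightarrow> y \<in> U" using R by blast
      define V where "V i = (if i < k then M.mball (x i) (r / (real k + 1)) else UNIV)" for i
      have "y \<in> U" if y: "\<forall>i. y i \<in> V i" for y
      proof (rule k(2))
        have "v ((y - x) i) \<le> r / (real k + 1)" if "i < k" for i
          using y[rule_format, of i] that mball[of "y i" "x i" "r / (real k + 1)"] by (simp add: V_def)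
        then have "(\<Sum>i<k. v ((y - x) i)) \<le> (\<Sum>i<k. r / (real k + 1))" by (intro sum_mono) auto
        also have "\<dots> < r" using k(1) by (simp add: field_simps)
        finally show "(\<Sum>i<k. v ((y - x) i)) < r" .
      qed
      moreover have "finite {i. V i \<noteq> UNIV}" by (rule finite_subset[of _ "{..<k}"]) (auto simp: V_def)
      moreover have "x i \<in> V i" for i using k(1) mball[of "x i" "x i" "r / (real k + 1)"] by (simp add: V_def)
      moreover have "openin M.mtopology (V i)" for i using openin_topspace[of M.mtopology] by (auto simp: V_def)
      ultimately show "\<exists>V. finite {i. V i \<noteq> UNIV} \<and> (\<forall>i. openin M.mtopology (V i)) \<and>
          (\<forall>i. x i \<in> V i) \<and> {y. \<forall>i. y i \<in> V i} \<subseteq> U" by (intro exI[of _ V]) blast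
    qed
  qed auto
qed

lemma defines_topology_c0_seq:
  "defines_topology (\<lambda>k z. sup_norm v (fst z) + (\<Sum>i<k. v (snd z i))) (prod_topology (c0_space v) (seq_space v))"
proof -
  interpret C: nonarch_vector_space v seq_scale "c0_carrier v" by (rule nonarch_vector_space_c0)
  note sn = nonarch_seminorm_sup_norm
  show ?thesis
  proof (rule defines_topology_prod[OF defines_topology_c0 defines_topology_seq])
    fix x r assume x: "x \<in> topspace (c0_space v)"
    show "openin (c0_space v) {y \<in> topspace (c0_space v). sup_norm v (y - x) < r}"
    proof (rule defines_topologyI[OF defines_topology_c0])
      fix z assume z: "z \<in> {y \<in> topspace (c0_space v). sup_norm v (y - x) < r}"
      have "sup_norm v (y - x) < r" if "y \<in> c0_carrier v" "sup_norm v (y - z) < r" for y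
        using C.sn_triangle[OF sn that(1), of z x] z x that by (auto simp: max_def split: if_splits)
      then show "\<exists>k::nat. \<exists>r'>0. {y \<in> topspace (c0_space v). sup_norm v (y - z) < r'} \<subseteq>
          {y \<in> topspace (c0_space v). sup_norm v (y - x) < r}"
        using z C.sn_nonneg[OF sn C.E_diff, of z x] x by (intro exI[of _ 0] exI[of _ r]) auto
    qed auto
  next
    fix x :: "nat \<Rightarrow> 'k" and k r
    show "openin (seq_space v) {y \<in> topspace (seq_space v). (\<Sum>i<k. v ((y - x) i)) < r}"
    proof (rule defines_topologyI[OF defines_topology_seq])
      fix z assume z: "z \<in> {y \<in> topspace (seq_space v). (\<Sum>i<k. v ((y - x) i)) < r}"
      have "(\<Sum>i<k. v ((y - x) i)) < r" if y: "(\<Sum>i<k. v ((y - z) i)) < r - (\<Sum>i<k. v ((z - x) i))" for y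
      proof -
        have "v ((y - x) i) \<le> v ((y - z) i) + v ((z - x) i)" for i
          using ultrametric[of "y i - z i" "z i - x i"] nonneg[of "y i - z i"] nonneg[of "z i - x i"] by simp
        then have "(\<Sum>i<k. v ((y - x) i)) \<le> (\<Sum>i<k. v ((y - z) i) + v ((z - x) i))" by (intro sum_mono)
        then show ?thesis using y by (simp add: sum.distrib)
      qed
      then show "\<exists>k'. \<exists>r'>0. {y \<in> topspace (seq_space v). (\<Sum>i<k'. v ((y - z) i)) < r'} \<subseteq>
          {y \<in> topspace (seq_space v). (\<Sum>i<k. v ((y - x) i)) < r}"
        using z by (intro exI[of _ k] exI[of _ "r - (\<Sum>i<k. v ((z - x) i))"]) auto
    qed auto
  next
    fix x y :: "nat \<Rightarrow> 'k" and j k :: nat assume "j \<le> k"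
    then show "(\<Sum>i<j. v ((y - x) i)) \<le> (\<Sum>i<k. v ((y - x) i))" using nonneg by (intro sum_mono2) auto
  qed (use C.sn_0[OF sn] C.sn_nonneg[OF sn C.E_diff] nonneg in \<open>auto intro: sum_nonneg\<close>)
qed

end

section \<open>Coordinate systems\<close>

text \<open>Coordinates identifying the space with \<open>c\<^sub>0(A) \<times> K\<^bsup>B\<^esup>\<close>, the index sets being countable but possibly
  finite.\<close>

locale coordinates = frechet v s T p
  for v :: "'k::field \<Rightarrow> real" and s :: "'k \<Rightarrow> 'b::ab_group_add \<Rightarrow> 'b" and T :: "'b topology" and p +
  fixes A B :: "'i set" and c :: "'b \<Rightarrow> 'i \<Rightarrow> 'k"
  assumes disjoint: "A \<inter> B = {}" and countable_A: "countable A" and countable_B: "countable B"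
    and c_add: "x \<in> topspace T \<Longrightarrow> y \<in> topspace T \<Longrightarrow> i \<in> A \<union> B \<Longrightarrow> c (x + y) i = c x i + c y i"
    and c_scale: "x \<in> topspace T \<Longrightarrow> i \<in> A \<union> B \<Longrightarrow> c (s a x) i = a * c x i"
    and c_bound_A: "\<exists>k. \<exists>C>0. \<forall>x\<in>topspace T. \<forall>i\<in>A. v (c x i) \<le> C * p k x"
    and c_vanishing: "x \<in> topspace T \<Longrightarrow> 0 < e \<Longrightarrow> finite {i \<in> A. e \<le> v (c x i)}"
    and c_bound_B: "i \<in> B \<Longrightarrow> \<exists>k. \<exists>C>0. \<forall>x\<in>topspace T. v (c x i) \<le> C * p k x"
    and p_bound: "\<exists>F R. finite F \<and> F \<subseteq> B \<and> 0 < R \<and>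
      (\<forall>x\<in>topspace T. \<forall>M\<ge>0. (\<forall>i\<in>A \<union> F. v (c x i) \<le> M) \<longrightarrow> p k x \<le> R * M)"
    and c_surj: "(\<And>e. 0 < e \<Longrightarrow> finite {i \<in> A. e \<le> v (\<gamma> i)}) \<Longrightarrow> \<exists>x\<in>topspace T. \<forall>i\<in>A \<union> B. c x i = \<gamma> i"
begin

lemma c_inj:
  assumes x: "x \<in> E" and y: "y \<in> E" and eq: "\<And>i. i \<in> A \<union> B \<Longrightarrow> c x i = c y i"
  shows "x = y"
proof -
  have "p k (x - y) = 0" for k
  proof -
    obtain F R where F: "F \<subseteq> B" "0 < R"
      "\<And>z M. z \<in> E \<Longrightarrow> 0 \<le> M \<Longrightarrow> (\<forall>i\<in>A \<union> F. v (c z i) \<le> M) \<Longrightarrow> p k z \<le> R * M" using p_bound[of k] by blast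
    have "c (x - y) i = 0" if i: "i \<in> A \<union> B" for i
    proof -
      have "c (x - y) i + c y i = c (x - y + y) i" by (rule c_add[symmetric]) (use x y i E_diff in auto)
      then show ?thesis using eq[OF i] by simp
    qed
    then have "p k (x - y) \<le> R * 0" using F(1) by (intro F(3)) (use x y E_diff in auto)
    then show ?thesis using p_nonneg[of "x - y" k] x y E_diff by simp
  qed
  then show ?thesis using p_separating[of "x - y"] x y E_diff by simp
qed

text \<open>On finitely many coordinates, uniform and pointwise convergence agree. So a finite part may be
  moved to the other one, which leaves the cases where each part is empty or infinite.\<close>

lemma move_to_A:
  assumes fin: "finite B"
  shows "coordinates v s T p (A \<union> B) {} c"
proof unfold_locales
  have "\<exists>k. \<exists>C>0. \<forall>x\<in>E. \<forall>i\<in>A \<union> F. v (c x i) \<le> C * p k x" if "finite F" "F \<subseteq> B" for F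
    using that
  proof (induction F rule: finite_induct)
    case empty
    then show ?case using c_bound_A by simp
  next
    case (insert j F)
    obtain k1 C1 where 1: "0 < C1" "\<And>x i. x \<in> E \<Longrightarrow> i \<in> A \<union> F \<Longrightarrow> v (c x i) \<le> C1 * p k1 x"
      using insert.IH insert.prems by (metis (no_types, lifting) insert_subset)
    obtain k2 C2 where 2: "0 < C2" "\<And>x. x \<in> E \<Longrightarrow> v (c x j) \<le> C2 * p k2 x"
      using c_bound_B[of j] insert.prems by auto
    have "v (c x i) \<le> max C1 C2 * p (max k1 k2) x" if x: "x \<in> E" and i: "i \<in> A \<union> insert j F" for x i
    proof -
      have "C1 * p k1 x \<le> max C1 C2 * p (max k1 k2) x" "C2 * p k2 x \<le> max C1 C2 * p (max k1 k2) x"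
        using 1(1) 2(1) p_mono[OF _ x] p_nonneg[OF x] by (auto intro!: mult_mono)
      then show ?thesis using 1(2)[OF x, of i] 2(2)[OF x] i by (cases "i = j") auto
    qed
    then show ?case using 1(1) by (intro exI[of _ "max k1 k2"] exI[of _ "max C1 C2"]) auto
  qed
  then show "\<exists>k. \<exists>C>0. \<forall>x\<in>E. \<forall>i\<in>A \<union> B. v (c x i) \<le> C * p k x" using fin by simp
next
  fix x e assume x: "x \<in> E" and e: "(0::real) < e"
  have "{i \<in> A \<union> B. e \<le> v (c x i)} \<subseteq> {i \<in> A. e \<le> v (c x i)} \<union> B" by auto
  then show "finite {i \<in> A \<union> B. e \<le> v (c x i)}" using c_vanishing[OF x e] fin finite_subset by blast
next
  fix k
  obtain F R where FR: "F \<subseteq> B" "0 < R" "\<forall>x\<in>E. \<forall>M\<ge>0. (\<forall>i\<in>A \<union> F. v (c x i) \<le> M) \<longrightarrow> p k x \<le> R * M"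
    using p_bound[of k] by auto
  have "p k x \<le> R * M" if "x \<in> E" "0 \<le> M" "\<forall>i\<in>A \<union> B. v (c x i) \<le> M" for x M
    using FR(3)[rule_format, OF that(1,2)] that(3) FR(1) by blast
  then show "\<exists>F R. finite F \<and> F \<subseteq> {} \<and> 0 < R \<and>
      (\<forall>x\<in>E. \<forall>M\<ge>0. (\<forall>i\<in>A \<union> B \<union> F. v (c x i) \<le> M) \<longrightarrow> p k x \<le> R * M)"
    using FR(2) by (intro exI[of _ "{}"] exI[of _ R]) auto
next
  fix \<gamma> assume \<gamma>: "\<And>e. 0 < e \<Longrightarrow> finite {i \<in> A \<union> B. e \<le> v (\<gamma> i)}"
  have "finite {i \<in> A. e \<le> v (\<gamma> i)}" if "0 < e" for e by (rule finite_subset[OF _ \<gamma>[OF that]]) auto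
  then show "\<exists>x\<in>E. \<forall>i\<in>A \<union> B \<union> {}. c x i = \<gamma> i" using c_surj[of \<gamma>] by simp
qed (use countable_A countable_B c_add c_scale in auto)

lemma move_to_B:
  assumes fin: "finite A"
  shows "coordinates v s T p {} (A \<union> B) c"
proof unfold_locales
  fix i assume "i \<in> A \<union> B"
  then show "\<exists>k. \<exists>C>0. \<forall>x\<in>E. v (c x i) \<le> C * p k x" using c_bound_A c_bound_B[of i] by blast
next
  fix k
  obtain F R where "finite F" "F \<subseteq> B" "0 < R" "\<forall>x\<in>E. \<forall>M\<ge>0. (\<forall>i\<in>A \<union> F. v (c x i) \<le> M) \<longrightarrow> p k x \<le> R * M"
    using p_bound[of k] by auto
  then show "\<exists>F R. finite F \<and> F \<subseteq> A \<union> B \<and> 0 < R \<and>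
      (\<forall>x\<in>E. \<forall>M\<ge>0. (\<forall>i\<in>{} \<union> F. v (c x i) \<le> M) \<longrightarrow> p k x \<le> R * M)"
    using fin by (intro exI[of _ "A \<union> F"] exI[of _ R]) auto
next
  fix \<gamma> :: "'i \<Rightarrow> 'k"
  have "finite {i \<in> A. e \<le> v (\<gamma> i)}" for e using fin by simp
  then show "\<exists>x\<in>E. \<forall>i\<in>{} \<union> (A \<union> B). c x i = \<gamma> i" using c_surj[of \<gamma>] by simp
qed (use countable_A countable_B c_add c_scale in \<open>auto intro: exI[of _ 1]\<close>)

lemma finite_dim_if_finite:
  assumes fin: "finite A" "finite B"
  shows "finite_dim s E"
proof -
  have "\<exists>x\<in>E. \<forall>i\<in>A \<union> B. c x i = (if i = j then 1 else 0)" for j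
    by (rule c_surj) (use fin in simp)
  then obtain e where e: "\<And>j. e j \<in> E" "\<And>i j. i \<in> A \<union> B \<Longrightarrow> c (e j) i = (if i = j then 1 else 0)" by metis
  have "x \<in> span (e ` (A \<union> B))" if x: "x \<in> E" for x
  proof -
    let ?y = "\<Sum>j\<in>A \<union> B. s (c x j) (e j)"
    have c_sum: "c (\<Sum>j\<in>F. s (a j) (e j)) i = (\<Sum>j\<in>F. a j * c (e j) i)" if "finite F" "i \<in> A \<union> B" for F a i
      using that
    proof (induction F rule: finite_induct)
      case empty
      have "c (s 0 0) i = 0 * c 0 i" by (rule c_scale) (use empty in auto)
      then show ?case by simp
    next
      case (insert j F)
      then have "c (s (a j) (e j) + (\<Sum>j\<in>F. s (a j) (e j))) i = c (s (a j) (e j)) i + c (\<Sum>j\<in>F. s (a j) (e j)) i"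
        by (intro c_add E_sum E_scale e) auto
      then show ?case using insert c_scale[OF e(1)] by simp
    qed
    have "x = ?y"
    proof (rule c_inj[OF x])
      show "?y \<in> E" by (intro E_sum E_scale e)
      fix i assume i: "i \<in> A \<union> B"
      have "c ?y i = (\<Sum>j\<in>A \<union> B. c x j * c (e j) i)" by (rule c_sum) (use fin i in auto)
      also have "\<dots> = (\<Sum>j\<in>A \<union> B. if i = j then c x j else 0)" by (rule sum.cong) (use e(2)[OF i] in auto)
      finally show "c x i = c ?y i" using fin i by (simp add: sum.delta)
    qed
    also have "?y \<in> span (e ` (A \<union> B))" by (intro span_sum span_scale span_base) auto
    finally show ?thesis .
  qed
  then show ?thesis unfolding finite_dim_def using fin by (intro exI[of _ "e ` (A \<union> B)"]) auto
qed

lemma partial_sums_bounded: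
  fixes \<beta> :: "nat \<Rightarrow> 'i"
  assumes "\<And>n. \<beta> n \<in> B"
  shows "\<exists>m. \<exists>C>0. \<forall>x\<in>E. (\<Sum>i<k. v (c x (\<beta> i))) \<le> C * p m x"
proof (induction k)
  case 0
  then show ?case using p_nonneg by (intro exI[of _ 0] exI[of _ 1]) auto
next
  case (Suc k)
  obtain k1 C1 where 1: "0 < C1" "\<And>x. x \<in> E \<Longrightarrow> (\<Sum>i<k. v (c x (\<beta> i))) \<le> C1 * p k1 x" using Suc by auto
  obtain k2 C2 where 2: "0 < C2" "\<And>x. x \<in> E \<Longrightarrow> v (c x (\<beta> k)) \<le> C2 * p k2 x" using c_bound_B[OF assms] by blast
  have "(\<Sum>i<Suc k. v (c x (\<beta> i))) \<le> (C1 + C2) * p (max k1 k2) x" if x: "x \<in> E" for x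
  proof -
    have "C1 * p k1 x \<le> C1 * p (max k1 k2) x" "C2 * p k2 x \<le> C2 * p (max k1 k2) x"
      using 1(1) 2(1) p_mono[OF _ x] by (auto intro!: mult_left_mono)
    then show ?thesis using 1(2)[OF x] 2(2)[OF x] by (simp add: algebra_simps)
  qed
  then show ?case using 1(1) 2(1) by (intro exI[of _ "max k1 k2"] exI[of _ "C1 + C2"]) auto
qed

lemma p_le_partial_sums:
  fixes \<beta> :: "nat \<Rightarrow> 'i"
  assumes "B \<subseteq> range \<beta>"
  shows "\<exists>N. \<exists>R>0. \<forall>x\<in>E. \<forall>M\<ge>0. (\<forall>i\<in>A. v (c x i) \<le> M) \<longrightarrow> p k x \<le> R * (M + (\<Sum>i<N. v (c x (\<beta> i))))"
proof -
  obtain F R where F: "finite F" "F \<subseteq> B" "0 < R"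
    "\<And>x M. x \<in> E \<Longrightarrow> 0 \<le> M \<Longrightarrow> (\<forall>i\<in>A \<union> F. v (c x i) \<le> M) \<Longrightarrow> p k x \<le> R * M" using p_bound[of k] by blast
  have "F \<subseteq> \<beta> ` UNIV" using F(2) assms by auto
  then obtain I where I: "finite I" "F = \<beta> ` I" using finite_subset_image[OF F(1)] by metis
  obtain N where N: "I \<subseteq> {..<N}" using finite_nat_iff_bounded[of I] I(1) by auto
  have "p k x \<le> R * (M + (\<Sum>i<N. v (c x (\<beta> i))))" if x: "x \<in> E" "0 \<le> M" "\<forall>i\<in>A. v (c x i) \<le> M" for x M
  proof (rule F(4)[OF x(1)])
    have S: "0 \<le> (\<Sum>i<N. v (c x (\<beta> i)))" using nonneg by (intro sum_nonneg) auto
    then show "0 \<le> M + (\<Sum>i<N. v (c x (\<beta> i)))" using x by simp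
    have "v (c x (\<beta> i)) \<le> (\<Sum>i<N. v (c x (\<beta> i)))" if "i \<in> I" for i
      using that N nonneg by (intro member_le_sum) auto
    then show "\<forall>i\<in>A \<union> F. v (c x i) \<le> M + (\<Sum>i<N. v (c x (\<beta> i)))" using S x I(2) by fastforce
  qed
  then show ?thesis using F(3) by blast
qed

lemma ex_enumeration: "countable I \<Longrightarrow> infinite I \<Longrightarrow> \<exists>f. bij_betw f (UNIV :: nat set) I"
  using countableE_infinite bij_betw_inv_into by (metis bij_betw_inv)

lemma c_enum_c0:
  assumes x: "x \<in> E" and \<alpha>: "bij_betw \<alpha> (UNIV :: nat set) A"
  shows "(\<lambda>n. c x (\<alpha> n)) \<in> c0_carrier v"
proof (rule c0_carrierI)
  fix e :: real assume "0 < e"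
  have "inj_on \<alpha> {n. e \<le> v (c x (\<alpha> n))}" using \<alpha> inj_on_subset by (auto simp: bij_betw_def)
  moreover have "\<alpha> ` {n. e \<le> v (c x (\<alpha> n))} \<subseteq> {i \<in> A. e \<le> v (c x i)}" using \<alpha> by (auto simp: bij_betw_def)
  ultimately show "finite {n. e \<le> v (c x (\<alpha> n))}"
    using c_vanishing[OF x \<open>0 < e\<close>] finite_subset finite_imageD by blast
qed

lemma c_enum_surj:
  assumes \<alpha>: "bij_betw \<alpha> (UNIV :: nat set) A" and y: "y \<in> c0_carrier v" and e: "0 < e"
  shows "finite {i \<in> A. e \<le> v (y (inv_into UNIV \<alpha> i))}"
proof -
  have "{i \<in> A. e \<le> v (y (inv_into UNIV \<alpha> i))} \<subseteq> \<alpha> ` {n. e \<le> v (y n)}"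
    using \<alpha> by (auto simp: bij_betw_def f_inv_into_f intro!: image_eqI[where x = "inv_into UNIV \<alpha> _"])
  then show ?thesis using c0_carrierD[OF y e] finite_surj by blast
qed

lemma isomorphic_seq_space:
  assumes A: "A = {}" and B: "infinite B"
  shows "lcs_isomorphic s T seq_scale (seq_space v)"
proof -
  obtain \<beta> where \<beta>: "bij_betw \<beta> (UNIV :: nat set) B" using ex_enumeration[OF countable_B B] by auto
  have \<beta>B: "\<beta> n \<in> B" for n using \<beta> by (auto simp: bij_betw_def)
  define f where "f x = (\<lambda>n. c x (\<beta> n))" for x
  have lin: "linear_map_on s seq_scale E f"
    using \<beta>B c_add c_scale by (auto simp: linear_map_on_def f_def seq_scale_def fun_eq_iff)
  have bij: "bij_betw f E (topspace (seq_space v))"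
    unfolding bij_betw_def
  proof (intro conjI inj_onI)
    fix x y assume xy: "x \<in> E" "y \<in> E" "f x = f y"
    have "c x i = c y i" if i: "i \<in> A \<union> B" for i
    proof -
      obtain n where "i = \<beta> n" using i A \<beta> by (auto simp: bij_betw_def)
      then show ?thesis using fun_cong[OF xy(3), of n] by (simp add: f_def)
    qed
    then show "x = y" using c_inj xy by blast
  next
    have "y \<in> f ` E" for y
    proof -
      obtain x where x: "x \<in> E" "\<And>i. i \<in> A \<union> B \<Longrightarrow> c x i = y (inv_into UNIV \<beta> i)"
        using c_surj[of "\<lambda>i. y (inv_into UNIV \<beta> i)"] A by auto
      have "f x = y" using x(2) \<beta> \<beta>B by (auto simp: f_def bij_betw_def fun_eq_iff)
      then show ?thesis using x(1) by blast
    qed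
    then show "f ` E = topspace (seq_space v)" by auto
  qed
  have "homeomorphic_map T (seq_space v) f"
  proof (rule homeomorphic_map_by_seminorms[OF vector_space_axioms subspace_E lin bij p_topology defines_topology_seq])
    fix k
    show "\<exists>m. \<exists>C>0. \<forall>x\<in>E. (\<Sum>i<k. v (f x i)) \<le> C * p m x" unfolding f_def by (rule partial_sums_bounded[OF \<beta>B])
    have "B \<subseteq> range \<beta>" using \<beta> by (auto simp: bij_betw_def)
    then obtain N R where "0 < R" "\<And>x M. x \<in> E \<Longrightarrow> 0 \<le> M \<Longrightarrow> (\<forall>i\<in>A. v (c x i) \<le> M) \<Longrightarrow> p k x \<le> R * (M + (\<Sum>i<N. v (c x (\<beta> i))))"
      using p_le_partial_sums[of \<beta> k] by blast
    from this(1) this(2)[of _ 0] show "\<exists>m. \<exists>C>0. \<forall>x\<in>E. p k x \<le> C * (\<Sum>i<m. v (f x i))"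
      using A by (intro exI[of _ N] exI[of _ R]) (auto simp: f_def)
  qed
  then show ?thesis unfolding lcs_isomorphic_def using lin by blast
qed

lemma isomorphic_c0:
  assumes A: "infinite A" and B: "B = {}"
  shows "lcs_isomorphic s T seq_scale (c0_space v)"
proof -
  obtain \<alpha> where \<alpha>: "bij_betw \<alpha> (UNIV :: nat set) A" using ex_enumeration[OF countable_A A] by auto
  have \<alpha>A: "\<alpha> n \<in> A" for n using \<alpha> by (auto simp: bij_betw_def)
  define f where "f x = (\<lambda>n. c x (\<alpha> n))" for x
  have fc0: "f x \<in> c0_carrier v" if "x \<in> E" for x unfolding f_def by (rule c_enum_c0[OF that \<alpha>])
  have lin: "linear_map_on s seq_scale E f"
    using \<alpha>A c_add c_scale by (auto simp: linear_map_on_def f_def seq_scale_def fun_eq_iff)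
  have bij: "bij_betw f E (topspace (c0_space v))"
    unfolding bij_betw_def topspace_c0_space
  proof (intro conjI inj_onI equalityI subsetI)
    fix x y assume xy: "x \<in> E" "y \<in> E" "f x = f y"
    have "c x i = c y i" if i: "i \<in> A \<union> B" for i
    proof -
      obtain n where "i = \<alpha> n" using i B \<alpha> by (auto simp: bij_betw_def)
      then show ?thesis using fun_cong[OF xy(3), of n] by (simp add: f_def)
    qed
    then show "x = y" using c_inj xy by blast
  next
    fix y assume y: "y \<in> c0_carrier v"
    obtain x where x: "x \<in> E" "\<And>i. i \<in> A \<union> B \<Longrightarrow> c x i = y (inv_into UNIV \<alpha> i)"
      using c_surj[of "\<lambda>i. y (inv_into UNIV \<alpha> i)"] c_enum_surj[OF \<alpha> y] by auto
    have "f x = y" using x(2) \<alpha> \<alpha>A by (auto simp: f_def bij_betw_def fun_eq_iff)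
    then show "y \<in> f ` E" using x(1) by blast
  qed (use fc0 in auto)
  have "homeomorphic_map T (c0_space v) f"
  proof (rule homeomorphic_map_by_seminorms[OF vector_space_axioms subspace_E lin bij p_topology defines_topology_c0])
    fix k
    obtain m C where "0 < C" "\<And>x i. x \<in> E \<Longrightarrow> i \<in> A \<Longrightarrow> v (c x i) \<le> C * p m x" using c_bound_A by blast
    then show "\<exists>m. \<exists>C>0. \<forall>x\<in>E. sup_norm v (f x) \<le> C * p m x"
      using \<alpha>A by (intro exI[of _ m] exI[of _ C]) (auto simp: f_def intro!: sup_norm_le)
    obtain F R where R: "F \<subseteq> B" "0 < R"
      "\<And>x M. x \<in> E \<Longrightarrow> 0 \<le> M \<Longrightarrow> (\<forall>i\<in>A \<union> F. v (c x i) \<le> M) \<Longrightarrow> p k x \<le> R * M" using p_bound[of k] by blast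
    have "p k x \<le> R * sup_norm v (f x)" if x: "x \<in> E" for x
    proof (rule R(3)[OF x])
      have le: "v (c x (\<alpha> n)) \<le> sup_norm v (f x)" for n using sup_norm_ge[OF fc0[OF x], of n] by (simp add: f_def)
      then show "0 \<le> sup_norm v (f x)" using nonneg order_trans by blast
      show "\<forall>i\<in>A \<union> F. v (c x i) \<le> sup_norm v (f x)" using le R(1) B \<alpha> by (auto simp: bij_betw_def)
    qed
    then show "\<exists>m::nat. \<exists>C>0. \<forall>x\<in>E. p k x \<le> C * sup_norm v (f x)" using R(2) by blast
  qed
  then show ?thesis unfolding lcs_isomorphic_def using lin by blast
qed

lemma isomorphic_c0_seq:
  assumes A: "infinite A" and B: "infinite B"
  shows "lcs_isomorphic s T (prod_scale seq_scale seq_scale) (prod_topology (c0_space v) (seq_space v))"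
proof -
  obtain \<alpha> where \<alpha>: "bij_betw \<alpha> (UNIV :: nat set) A" using ex_enumeration[OF countable_A A] by auto
  have \<alpha>A: "\<alpha> n \<in> A" for n using \<alpha> by (auto simp: bij_betw_def)
  obtain \<beta> where \<beta>: "bij_betw \<beta> (UNIV :: nat set) B" using ex_enumeration[OF countable_B B] by auto
  have \<beta>B: "\<beta> n \<in> B" for n using \<beta> by (auto simp: bij_betw_def)
  define f where "f x = ((\<lambda>n. c x (\<alpha> n)), (\<lambda>n. c x (\<beta> n)))" for x
  have fc0: "fst (f x) \<in> c0_carrier v" if "x \<in> E" for x unfolding f_def fst_conv by (rule c_enum_c0[OF that \<alpha>])
  have lin: "linear_map_on s (prod_scale seq_scale seq_scale) E f"
    using \<alpha>A \<beta>B c_add c_scale by (auto simp: linear_map_on_def f_def seq_scale_def prod_scale_def fun_eq_iff)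
  have bij: "bij_betw f E (topspace (prod_topology (c0_space v) (seq_space v)))"
    unfolding bij_betw_def topspace_prod_topology topspace_c0_space topspace_seq_space
  proof (intro conjI inj_onI equalityI subsetI)
    fix x y assume xy: "x \<in> E" "y \<in> E" "f x = f y"
    have "c x i = c y i" if i: "i \<in> A \<union> B" for i
    proof -
      consider n where "i = \<alpha> n" | n where "i = \<beta> n" using i \<alpha> \<beta> by (auto simp: bij_betw_def)
      then show ?thesis
      proof cases
        case 1
        then show ?thesis using fun_cong[OF arg_cong[OF xy(3), of fst], of n] by (simp add: f_def)
      next
        case 2
        then show ?thesis using fun_cong[OF arg_cong[OF xy(3), of snd], of n] by (simp add: f_def)
      qed
    qed
    then show "x = y" using c_inj xy by blast
  next
    fix w :: "(nat \<Rightarrow> 'k) \<times> (nat \<Rightarrow> 'k)" assume w: "w \<in> c0_carrier v \<times> UNIV"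
    obtain y z where yz: "w = (y, z)" "y \<in> c0_carrier v" using w by auto
    define \<gamma> where "\<gamma> i = (if i \<in> A then y (inv_into UNIV \<alpha> i) else z (inv_into UNIV \<beta> i))" for i
    have "finite {i \<in> A. e \<le> v (\<gamma> i)}" if "0 < e" for e
      using c_enum_surj[OF \<alpha> yz(2) that] by (rule finite_subset[rotated]) (auto simp: \<gamma>_def)
    then obtain x where x: "x \<in> E" "\<And>i. i \<in> A \<union> B \<Longrightarrow> c x i = \<gamma> i" using c_surj[of \<gamma>] by auto
    have "\<beta> n \<notin> A" for n using \<beta>B disjoint by blast
    then have "f x = w" using x(2) \<alpha> \<alpha>A \<beta> \<beta>B unfolding yz(1) by (auto simp: f_def \<gamma>_def bij_betw_def fun_eq_iff)
    then show "w \<in> f ` E" using x(1) by blast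
  qed (use fc0 in \<open>auto simp: mem_Times_iff\<close>)
  have "homeomorphic_map T (prod_topology (c0_space v) (seq_space v)) f"
  proof (rule homeomorphic_map_by_seminorms[OF vector_space_axioms subspace_E lin bij p_topology defines_topology_c0_seq])
    fix k
    obtain m C where 1: "0 < C" "\<And>x i. x \<in> E \<Longrightarrow> i \<in> A \<Longrightarrow> v (c x i) \<le> C * p m x" using c_bound_A by blast
    obtain m' C' where 2: "0 < C'" "\<And>x. x \<in> E \<Longrightarrow> (\<Sum>i<k. v (c x (\<beta> i))) \<le> C' * p m' x"
      using partial_sums_bounded[of \<beta> k, OF \<beta>B] by blast
    have "sup_norm v (fst (f x)) + (\<Sum>i<k. v (snd (f x) i)) \<le> (C + C') * p (max m m') x" if x: "x \<in> E" for x
    proof -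
      have "sup_norm v (fst (f x)) \<le> C * p m x" using 1(2)[OF x \<alpha>A] by (intro sup_norm_le) (simp add: f_def)
      moreover have "(\<Sum>i<k. v (snd (f x) i)) \<le> C' * p m' x" using 2(2)[OF x] by (simp add: f_def)
      moreover have "C * p m x \<le> C * p (max m m') x" "C' * p m' x \<le> C' * p (max m m') x"
        using 1(1) 2(1) p_mono[OF _ x] by (auto intro!: mult_left_mono)
      ultimately show ?thesis by (simp add: algebra_simps)
    qed
    then show "\<exists>m. \<exists>C>0. \<forall>x\<in>E. sup_norm v (fst (f x)) + (\<Sum>i<k. v (snd (f x) i)) \<le> C * p m x"
      using 1(1) 2(1) by (intro exI[of _ "max m m'"] exI[of _ "C + C'"]) auto
    have "B \<subseteq> range \<beta>" using \<beta> by (auto simp: bij_betw_def)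
    then obtain N R where R: "0 < R" "\<And>x M. x \<in> E \<Longrightarrow> 0 \<le> M \<Longrightarrow> (\<forall>i\<in>A. v (c x i) \<le> M) \<Longrightarrow> p k x \<le> R * (M + (\<Sum>i<N. v (c x (\<beta> i))))"
      using p_le_partial_sums[of \<beta> k] by blast
    have "p k x \<le> R * (sup_norm v (fst (f x)) + (\<Sum>i<N. v (snd (f x) i)))" if x: "x \<in> E" for x
    proof -
      have le: "v (c x (\<alpha> n)) \<le> sup_norm v (fst (f x))" for n using sup_norm_ge[OF fc0[OF x], of n] by (simp add: f_def)
      then have "0 \<le> sup_norm v (fst (f x))" using nonneg order_trans by blast
      moreover have "\<forall>i\<in>A. v (c x i) \<le> sup_norm v (fst (f x))" using le \<alpha> by (auto simp: bij_betw_def)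
      ultimately show ?thesis using R(2)[OF x] by (simp add: f_def)
    qed
    then show "\<exists>m. \<exists>C>0. \<forall>x\<in>E. p k x \<le> C * (sup_norm v (fst (f x)) + (\<Sum>i<m. v (snd (f x) i)))" using R(1) by blast
  qed
  then show ?thesis unfolding lcs_isomorphic_def using lin by blast
qed

lemma isomorphic_to_exceptional:
  assumes "\<not> finite_dim s E"
  shows "lcs_isomorphic s T seq_scale (c0_space v) \<or>
    lcs_isomorphic s T (prod_scale seq_scale seq_scale) (prod_topology (c0_space v) (seq_space v)) \<or>
    lcs_isomorphic s T seq_scale (seq_space v)"
proof -
  consider "infinite A" "infinite B" | "finite A" "infinite B" | "infinite A" "finite B"
    using finite_dim_if_finite assms by blast
  then show ?thesis
  proof cases
    case 1
    then show ?thesis using isomorphic_c0_seq by simp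
  next
    case 2
    interpret B: coordinates v s T p "{}" "A \<union> B" c by (rule move_to_B[OF 2(1)])
    show ?thesis using B.isomorphic_seq_space 2 by simp
  next
    case 3
    interpret A: coordinates v s T p "A \<union> B" "{}" c by (rule move_to_A[OF 3(2)])
    show ?thesis using A.isomorphic_c0 3 by simp
  qed
qed

end

section \<open>Decompositions with eventually equivalent seminorms\<close>

lemma (in schauder) component_subspace: "subspace (P n ` E)"
  unfolding subspace_def
proof (intro conjI ballI allI)
  show "0 \<in> P n ` E" using P_0[of n] E_0 by (metis image_eqI)
  show "x + y \<in> P n ` E" if "x \<in> P n ` E" "y \<in> P n ` E" for x y
    using that by (auto simp: P_add[symmetric] intro!: imageI E_add)
  show "s a x \<in> P n ` E" if "x \<in> P n ` E" for a x
    using that by (auto simp: P_scale[symmetric] intro!: imageI E_scale)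
qed

lemma (in schauder) component_E: "x \<in> P n ` E \<Longrightarrow> x \<in> E"
  using P_E by auto

lemma (in schauder) P_component: "x \<in> P n ` E \<Longrightarrow> P j x = (if j = n then x else 0)"
  by (auto simp: P_P)

text \<open>Almost orthogonal bases of the components with respect to \<open>p m\<close> combine to a
  coordinate system: the kernels of \<open>p m\<close> make up the part \<open>K\<^bsup>B\<^esup>\<close>, the rest is the part \<open>c\<^sub>0(A)\<close>.
  The bound \<open>N\<close> on the dimensions makes the constants of almost orthogonality uniform.\<close>

lemma (in orthogonal_schauder) ex_coordinates:
  assumes fd: "\<And>n. finite_dim s (P n ` E)" "\<And>n. dim (P n ` E) \<le> N"
    and dom: "\<And>k. \<exists>R>0. \<exists>S. finite S \<and> (\<forall>n. n \<notin> S \<longrightarrow> (\<forall>x\<in>P n ` E. p k x \<le> R * p m x))"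
  shows "\<exists>A B (c :: 'b \<Rightarrow> nat \<times> 'b \<Rightarrow> 'k). coordinates v s T p A B c"
proof -
  define K where "K = (2 / step) ^ N"
  have K: "0 < K" unfolding K_def using step by simp
  define basis where "basis n Q \<longleftrightarrow> (case Q of (A, Z) \<Rightarrow> finite A \<and> finite Z \<and> A \<inter> Z = {} \<and> independent (A \<union> Z) \<and>
      span (A \<union> Z) = P n ` E \<and> (\<forall>b\<in>A. p m b \<le> 1) \<and> (\<forall>b\<in>Z. p m b = 0) \<and>
      (\<forall>c. \<forall>b\<in>A. v (c b) \<le> K * p m (\<Sum>b\<in>A \<union> Z. s (c b) b)))" for n Q
  have "\<exists>Q. basis n Q" for n
  proof -
    have "P n ` E \<subseteq> E" using P_E by auto
    from almost_orthogonal_basis_with_kernel[OF p_seminorm[of m] component_subspace this fd]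
    show ?thesis unfolding basis_def K_def by simp
  qed
  then have "\<forall>n. \<exists>Q. basis n Q" by simp
  from choice[OF this] obtain Q where Q: "\<forall>n. basis n (Q n)" ..
  define A0 Z0 J where "A0 n = fst (Q n)" and "Z0 n = snd (Q n)" and "J n = fst (Q n) \<union> snd (Q n)" for n
  have J_def': "J n = A0 n \<union> Z0 n" for n by (simp add: J_def A0_def Z0_def)
  have fin: "finite (A0 n)" "finite (Z0 n)" "finite (J n)" and disj: "A0 n \<inter> Z0 n = {}"
    and ind: "independent (J n)" and spJ: "span (J n) = P n ` E"
    and A_le: "\<And>b. b \<in> A0 n \<Longrightarrow> p m b \<le> 1" and Z_0: "\<And>b. b \<in> Z0 n \<Longrightarrow> p m b = 0"
    and orth: "\<And>c b. b \<in> A0 n \<Longrightarrow> v (c b) \<le> K * p m (\<Sum>b\<in>J n. s (c b) b)" for n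
    using Q[rule_format, of n] by (auto simp: basis_def A0_def Z0_def J_def split: prod.splits)
  have JE: "J n \<subseteq> E" for n using spJ[of n] span_superset[of "J n"] component_E by blast
  define A B where "A = (SIGMA n:UNIV. A0 n)" and "B = (SIGMA n:UNIV. Z0 n)"
  have AB: "(n, b) \<in> A \<union> B \<longleftrightarrow> b \<in> J n" for n b by (auto simp: A_def B_def J_def')
  define c where "c x i = representation (J (fst i)) (P (fst i) x) (snd i)" for x and i :: "nat \<times> 'b"
  have P_span: "P n x \<in> span (J n)" if "x \<in> E" for n x using spJ that by auto
  have P_eq: "P n x = (\<Sum>b\<in>J n. s (c x (n, b)) b)" if x: "x \<in> E" for n x
    using sum_representation_eq[OF ind P_span[OF x] fin(3), of n n] by (simp add: c_def)
  have sum_E: "(\<Sum>b\<in>J n. s (f b) b) \<in> E" for f n using JE by (intro E_sum E_scale) auto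
  have sum_comp: "(\<Sum>b\<in>J n. s (f b) b) \<in> P n ` E" for f n
    unfolding spJ[symmetric] by (intro span_sum span_scale span_base)
  have pm_sum: "p m (\<Sum>b\<in>J n. s (f b) b) \<le> M" if "0 \<le> M" "\<And>b. b \<in> A0 n \<Longrightarrow> v (f b) \<le> M" for n f M
  proof (rule p_sum)
    fix b assume b: "b \<in> J n"
    then have bE: "b \<in> E" using JE by auto
    have "v (f b) * p m b \<le> M * 1" if "b \<in> A0 n"
      using that \<open>b \<in> A0 n \<Longrightarrow> v (f b) \<le> M\<close> A_le[OF that] p_nonneg[OF bE] \<open>0 \<le> M\<close> by (intro mult_mono) auto
    then have "v (f b) * p m b \<le> M" using b Z_0[of b n] \<open>0 \<le> M\<close> unfolding J_def' by auto
    then show "s (f b) b \<in> E \<and> p m (s (f b) b) \<le> M" using bE by (simp add: E_scale p_scale)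
  qed fact
  have c_A: "v (c x (n, b)) \<le> K * p m (P n x)" if "x \<in> E" "b \<in> A0 n" for x n b
    using orth[OF that(2), of "\<lambda>b. c x (n, b)"] P_eq[OF that(1), of n] by simp
  have "coordinates v s T p A B c"
  proof unfold_locales
    show "A \<inter> B = {}" using disj by (auto simp: A_def B_def)
    show "countable A" "countable B" unfolding A_def B_def using fin by (intro countable_SIGMA countableI_type countable_finite; simp)+
    fix x y a i assume x: "x \<in> E" and y: "y \<in> E" and i: "i \<in> A \<union> B"
    show "c (x + y) i = c x i + c y i"
      using representation_add[OF ind P_span[OF y] P_span[OF x], of "fst i"] by (simp add: c_def P_add x y)
  next
    fix x a i assume x: "x \<in> E"
    show "c (s a x) i = a * c x i"
      using representation_scale[OF ind P_span[OF x]] by (simp add: c_def P_scale x)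
  next
    have "v (c x i) \<le> K * p m x" if x: "x \<in> E" and i: "i \<in> A" for x i
    proof -
      obtain n b where nb: "i = (n, b)" "b \<in> A0 n" using i by (auto simp: A_def)
      have "K * p m (P n x) \<le> K * p m x" using K P_le[OF x, of m n] by simp
      then show ?thesis using c_A[OF x nb(2)] nb(1) by simp
    qed
    then show "\<exists>k. \<exists>C>0. \<forall>x\<in>E. \<forall>i\<in>A. v (c x i) \<le> C * p k x" using K by blast
  next
    fix x and e :: real assume x: "x \<in> E" and e: "0 < e"
    have "\<forall>\<^sub>F n in sequentially. p m (P n x) < e / K"
      using P_tendsto_0[OF x, of m] e K by (intro order_tendstoD(2)[of _ 0]) auto
    then obtain n0 where n0: "\<And>n. n0 \<le> n \<Longrightarrow> p m (P n x) < e / K" unfolding eventually_sequentially by blast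
    have "{i \<in> A. e \<le> v (c x i)} \<subseteq> (SIGMA n:{..<n0}. A0 n)"
    proof
      fix i assume i: "i \<in> {i \<in> A. e \<le> v (c x i)}"
      obtain n b where nb: "i = (n, b)" "b \<in> A0 n" using i by (auto simp: A_def)
      have "e \<le> K * p m (P n x)" using i c_A[OF x nb(2)] nb(1) by simp
      then have "\<not> n0 \<le> n" using n0[of n] K by (auto simp: field_simps)
      then show "i \<in> (SIGMA n:{..<n0}. A0 n)" using nb by auto
    qed
    then show "finite {i \<in> A. e \<le> v (c x i)}" by (rule finite_subset) (use fin in auto)
  next
    fix i assume "i \<in> B"
    then obtain n b where nb: "i = (n, b)" "b \<in> J n" by (auto simp: B_def J_def')
    have "\<exists>k. \<exists>C>0. \<forall>c. \<forall>b\<in>J n. v (c b) \<le> C * p k (\<Sum>b\<in>J n. s (c b) b)"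
      by (rule coordinates_bounded[of p, OF p_seminorm p_Suc fin(3) JE ind])
        (use p_separating span_in_E[OF JE] in auto)
    then obtain k C where C: "0 < C" "\<And>c b. b \<in> J n \<Longrightarrow> v (c b) \<le> C * p k (\<Sum>b\<in>J n. s (c b) b)" by blast
    have "v (c x i) \<le> C * p k x" if x: "x \<in> E" for x
    proof -
      have "v (c x (n, b)) \<le> C * p k (P n x)" using C(2)[OF nb(2), of "\<lambda>b. c x (n, b)"] P_eq[OF x, of n] by simp
      also have "\<dots> \<le> C * p k x" using C(1) P_le[OF x, of k n] by simp
      finally show ?thesis using nb by simp
    qed
    then show "\<exists>k. \<exists>C>0. \<forall>x\<in>E. v (c x i) \<le> C * p k x" using C(1) by blast
  next
    fix k
    obtain R S where R: "0 < R" "finite S" "\<And>n x. n \<notin> S \<Longrightarrow> x \<in> P n ` E \<Longrightarrow> p k x \<le> R * p m x" using dom[of k] by blast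
    define R' where "R' = R + (\<Sum>n\<in>S. \<Sum>b\<in>J n. p k b)"
    have pos: "0 \<le> p k b" if "b \<in> J n" for n b using that JE p_nonneg by blast
    then have pos': "0 \<le> (\<Sum>b\<in>J n. p k b)" for n by (intro sum_nonneg)
    then have "R \<le> R'" unfolding R'_def by (simp add: sum_nonneg)
    have R'_ge: "p k b \<le> R'" if "n \<in> S" "b \<in> J n" for n b
    proof -
      have "p k b \<le> (\<Sum>b\<in>J n. p k b)" using fin pos that by (intro member_le_sum) auto
      also have "\<dots> \<le> (\<Sum>n\<in>S. \<Sum>b\<in>J n. p k b)" using that R(2) pos' by (intro member_le_sum) auto
      finally show ?thesis using R(1) by (simp add: R'_def)
    qed
    define F where "F = (SIGMA n:S. Z0 n)"
    have "p k x \<le> R' * M" if x: "x \<in> E" and M: "0 \<le> M" "\<forall>i\<in>A \<union> F. v (c x i) \<le> M" for x M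
    proof (rule p_le_sup[OF x])
      fix n
      show "p k (P n x) \<le> R' * M"
      proof (cases "n \<in> S")
        case True
        have "p k (\<Sum>b\<in>J n. s (c x (n, b)) b) \<le> R' * M"
        proof (rule p_sum)
          fix b assume b: "b \<in> J n"
          then have "(n, b) \<in> A \<union> F" using True by (auto simp: A_def F_def J_def')
          then have "v (c x (n, b)) * p k b \<le> M * R'"
            using M R'_ge[OF True b] pos[OF b] by (intro mult_mono) auto
          then show "s (c x (n, b)) b \<in> E \<and> p k (s (c x (n, b)) b) \<le> R' * M"
            using subsetD[OF JE b] by (simp add: E_scale p_scale mult.commute)
        qed (use M \<open>R \<le> R'\<close> R(1) in auto)
        then show ?thesis using P_eq[OF x, of n] by simp
      next
        case False
        have "p m (P n x) \<le> M"
          unfolding P_eq[OF x, of n] by (rule pm_sum[OF M(1)]) (use M(2) in \<open>auto simp: A_def\<close>)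
        then have "R * p m (P n x) \<le> R' * M" using R(1) \<open>R \<le> R'\<close> p_nonneg[OF P_E[OF x]] by (intro mult_mono) auto
        then show ?thesis using R(3)[OF False, of "P n x"] x by force
      qed
    qed
    then show "\<exists>F R. finite F \<and> F \<subseteq> B \<and> 0 < R \<and>
        (\<forall>x\<in>E. \<forall>M\<ge>0. (\<forall>i\<in>A \<union> F. v (c x i) \<le> M) \<longrightarrow> p k x \<le> R * M)"
      using R(1,2) \<open>R \<le> R'\<close> fin by (intro exI[of _ F] exI[of _ R']) (auto simp: F_def B_def)
  next
    fix \<gamma> :: "nat \<times> 'b \<Rightarrow> 'k" assume \<gamma>: "\<And>e. 0 < e \<Longrightarrow> finite {i \<in> A. e \<le> v (\<gamma> i)}"
    define z where "z n = (\<Sum>b\<in>J n. s (\<gamma> (n, b)) b)" for n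
    have zE: "z n \<in> E" and zP: "z n \<in> P n ` E" for n unfolding z_def by (rule sum_E, rule sum_comp)
    have "(\<lambda>n. p k (z n)) \<longlonglongrightarrow> 0" for k
    proof -
      obtain R S where R: "0 < R" "finite S" "\<And>n x. n \<notin> S \<Longrightarrow> x \<in> P n ` E \<Longrightarrow> p k x \<le> R * p m x" using dom[of k] by blast
      have "\<forall>\<^sub>F n in sequentially. norm (p k (z n) - 0) < e" if e: "0 < e" for e
      proof -
        define e' where "e' = e / (2 * R)"
        have e': "0 < e'" using e R(1) by (simp add: e'_def)
        have "finite (S \<union> fst ` {i \<in> A. e' \<le> v (\<gamma> i)})" using R(2) \<gamma>[OF e'] by simp
        then have "\<forall>\<^sub>F n in sequentially. n \<notin> S \<union> fst ` {i \<in> A. e' \<le> v (\<gamma> i)}"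
          unfolding cofinite_eq_sequentially[symmetric] eventually_cofinite by simp
        then show ?thesis
        proof eventually_elim
          case (elim n)
          have "v (\<gamma> (n, b)) \<le> e'" if "b \<in> A0 n" for b
          proof (rule ccontr)
            assume "\<not> v (\<gamma> (n, b)) \<le> e'"
            then have "(n, b) \<in> {i \<in> A. e' \<le> v (\<gamma> i)}" using that by (auto simp: A_def)
            then show False using elim by force
          qed
          then have "p m (z n) \<le> e'" unfolding z_def using e' by (intro pm_sum) auto
          then have "R * p m (z n) \<le> R * e'" using R(1) by simp
          also have "\<dots> < e" using R(1) e by (simp add: e'_def)
          finally have "p k (z n) < e" using R(3)[of n "z n"] zP elim by force
          then show ?case using p_nonneg[OF zE] by simp
        qed
      qed
      then show ?thesis by (simp add: tendsto_iff dist_norm)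
    qed
    then obtain l where l: "l \<in> E" "\<And>k. (\<lambda>N. p k ((\<Sum>n<N. z n) - l)) \<longlonglongrightarrow> 0" using series[of z] zE by blast
    have "P n l = z n" for n
    proof -
      have "p k (z n - P n l) = 0" for k
      proof -
        have SE: "(\<Sum>n<N. z n) \<in> E" for N by (intro E_sum zE)
        have "\<forall>\<^sub>F N in sequentially. p k (z n - P n l) \<le> p k ((\<Sum>n<N. z n) - l)"
          using eventually_gt_at_top[of n]
        proof eventually_elim
          case (elim N)
          have "P n (\<Sum>j<N. z j) = (\<Sum>j<N. if n = j then z j else 0)"
            using P_component[OF zP] by (simp add: P_sum zE)
          also have "\<dots> = z n" using elim by (simp add: sum.delta)
          finally have "z n - P n l = P n ((\<Sum>n<N. z n) - l)" using P_diff[OF SE l(1)] by simp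
          then show ?case using P_le[OF E_diff[OF SE l(1)]] by simp
        qed
        then have "p k (z n - P n l) \<le> 0" using l(2)[of k] by (intro tendsto_lowerbound[OF l(2)]) auto
        moreover have "0 \<le> p k (z n - P n l)" by (intro p_nonneg E_diff zE P_E l(1))
        ultimately show ?thesis by linarith
      qed
      then show ?thesis using p_separating[of "z n - P n l"] zE l(1) P_E E_diff by simp
    qed
    then have c_l: "c l (n, b) = \<gamma> (n, b)" if "b \<in> J n" for n b
      using representation_sum_basis[OF fin(3) ind that, of "\<lambda>b. \<gamma> (n, b)"] by (simp add: c_def z_def)
    have "c l i = \<gamma> i" if "i \<in> A \<union> B" for i
      using c_l[of "snd i" "fst i"] AB[of "fst i" "snd i"] that by simp
    then show "\<exists>x\<in>E. \<forall>i\<in>A \<union> B. c x i = \<gamma> i" using l(1) by blast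
  qed
  then show ?thesis by (intro exI[of _ A] exI[of _ B] exI[of _ c])
qed

section \<open>Closed subspaces\<close>

lemma (in frechet) frechet_subspace:
  assumes D: "subspace D" "closedin T D"
  shows "frechet v s (subtopology T D) p"
proof -
  have DE: "D \<subseteq> E" using D(2) by (rule closedin_subset)
  then have top: "topspace (subtopology T D) = D" by auto
  have "defines_topology p (subtopology T D)"
    unfolding defines_topology_def top
  proof (intro allI iffI conjI ballI)
    fix U assume U: "openin (subtopology T D) U"
    then obtain V where V: "openin T V" "U = V \<inter> D" by (auto simp: openin_subtopology)
    show "U \<subseteq> D" using V by auto
    fix x assume x: "x \<in> U"
    have "x \<in> V" using x V(2) by auto
    then obtain k r where "0 < r" "{y \<in> E. p k (y - x) < r} \<subseteq> V" by (rule defines_topologyD[OF p_topology V(1)])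
    then show "\<exists>k. \<exists>r>0. {y \<in> D. p k (y - x) < r} \<subseteq> U" using V DE by (intro exI[of _ k] exI[of _ r]) auto
  next
    fix U assume R: "U \<subseteq> D \<and> (\<forall>x\<in>U. \<exists>k. \<exists>r>0. {y \<in> D. p k (y - x) < r} \<subseteq> U)"
    have "\<exists>W. openin (subtopology T D) W \<and> x \<in> W \<and> W \<subseteq> U" if x: "x \<in> U" for x
    proof -
      obtain k r where kr: "0 < r" "{y \<in> D. p k (y - x) < r} \<subseteq> U" using R x by blast
      have xE: "x \<in> E" using R x DE by auto
      have "openin (subtopology T D) ({y \<in> E. p k (y - x) < r} \<inter> D)"
        using openin_ball[OF xE] by (auto simp: openin_subtopology)
      moreover have "x \<in> {y \<in> E. p k (y - x) < r} \<inter> D" using kr(1) xE R x by auto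
      ultimately show ?thesis using kr(2) by (intro exI[of _ "{y \<in> E. p k (y - x) < r} \<inter> D"]) auto
    qed
    then show "openin (subtopology T D) U" by (subst openin_subopen) blast
  qed
  moreover have "\<exists>l. limitin (subtopology T D) (\<lambda>N. \<Sum>n<N. f n) l sequentially"
    if f: "\<And>n. f n \<in> D" "limitin (subtopology T D) f 0 sequentially" for f
  proof -
    have SD: "(\<Sum>n<N. f n) \<in> D" for N using f D(1) by (intro subspace_sum) auto
    have "limitin T f 0 sequentially" using f by (simp add: limitin_subtopology)
    then obtain l where l: "limitin T (\<lambda>N. \<Sum>n<N. f n) l sequentially" using series_convergent[of f] f(1) DE by blast
    have "l \<in> D" by (rule limitin_closedin[OF l D(2)]) (use SD in auto)
    then show ?thesis using l SD by (intro exI[of _ l]) (simp add: limitin_subtopology)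
  qed
  moreover have "nonarch_seminorm v s D (p k)" for k
    using p_seminorm[of k] DE by (auto simp: nonarch_seminorm_def subset_iff)
  ultimately show ?thesis
    using D(1) p_Suc p_separating DE by unfold_locales (auto simp: Int_absorb1)
qed

section \<open>Blocks of vectors whose order of magnitude changes along the seminorms\<close>

context orthogonal_schauder
begin

text \<open>The negation of the domination hypothesis of \<open>ex_coordinates\<close>, in a scaled form.\<close>

definition rich :: "(nat \<Rightarrow> nat) \<Rightarrow> bool" where
  "rich \<kappa> \<longleftrightarrow> (\<forall>m. m \<le> \<kappa> m) \<and>
     (\<forall>m \<Lambda> \<eta> S. 0 < \<Lambda> \<longrightarrow> 0 < \<eta> \<longrightarrow> finite S \<longrightarrow>
        (\<exists>n. n \<notin> S \<and> (\<exists>y\<in>P n ` E. \<Lambda> \<le> p (\<kappa> m) y \<and> p m y \<le> \<eta>)))"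

lemma ex_rich:
  assumes no_dom: "\<And>m. \<exists>k. \<forall>R>0. \<forall>S. finite S \<longrightarrow> (\<exists>n. n \<notin> S \<and> (\<exists>x\<in>P n ` E. R * p m x < p k x))"
  shows "\<exists>\<kappa>. rich \<kappa>"
proof -
  obtain \<kappa> where \<kappa>: "\<And>m R S. 0 < R \<Longrightarrow> finite S \<Longrightarrow> \<exists>n. n \<notin> S \<and> (\<exists>x\<in>P n ` E. R * p m x < p (\<kappa> m) x)"
    using no_dom by metis
  have "m \<le> \<kappa> m" for m
  proof (rule ccontr)
    assume "\<not> m \<le> \<kappa> m"
    moreover obtain n x where "x \<in> P n ` E" "1 * p m x < p (\<kappa> m) x" using \<kappa>[of 1 "{}" m] by auto
    ultimately show False using p_mono[of "\<kappa> m" m x] component_E[of x n] by simp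
  qed
  moreover have "\<exists>n. n \<notin> S \<and> (\<exists>y\<in>P n ` E. \<Lambda> \<le> p (\<kappa> m) y \<and> p m y \<le> \<eta>)"
    if pos: "0 < \<Lambda>" "0 < \<eta>" and S: "finite S" for m \<Lambda> \<eta> S
  proof -
    define R where "R = \<Lambda> / (step * \<eta>)"
    have R: "0 < R" unfolding R_def using pos step by simp
    obtain n x where n: "n \<notin> S" "x \<in> P n ` E" "R * p m x < p (\<kappa> m) x" using \<kappa>[OF R S] by blast
    have xE: "x \<in> E" using n component_E by blast
    have "0 \<le> R * p m x" using R p_nonneg[OF xE] by simp
    then have "0 < p (\<kappa> m) x" using n(3) by linarith
    then obtain a where a: "a \<noteq> 0" "step * (\<Lambda> / step) < v a * p (\<kappa> m) x" "v a * p (\<kappa> m) x \<le> \<Lambda> / step"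
      using ex_scaling[of "p (\<kappa> m) x" "\<Lambda> / step"] pos step by auto
    have "v a * (R * p m x) \<le> v a * p (\<kappa> m) x" using n(3) nonneg by (intro mult_left_mono) auto
    also have "\<dots> \<le> \<Lambda> / step" by (rule a)
    finally have "R * (v a * p m x) \<le> R * \<eta>" using pos step by (simp add: R_def mult_ac)
    then have "p m (s a x) \<le> \<eta>" using R xE by (simp add: p_scale)
    moreover have "\<Lambda> \<le> p (\<kappa> m) (s a x)" using a step xE by (simp add: p_scale)
    moreover have "s a x \<in> P n ` E" by (rule subspace_scale[OF component_subspace n(2)])
    ultimately show ?thesis using n(1) by blast
  qed
  ultimately show ?thesis unfolding rich_def by blast
qed

text \<open>The vector \<open>y g\<close> is chosen tiny up to level \<open>l g\<close>, so that it does not disturb the dominations of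
  its predecessors, and huge from level \<open>\<kappa> (l g)\<close> on, so that it dominates them up to level
  \<open>l (g + 1)\<close>. The condition \<open>rich \<kappa>\<close> makes this possible in a component not used before.\<close>

lemma ex_block:
  assumes rich: "rich \<kappa>" and lev: "\<And>g. g < L \<Longrightarrow> \<kappa> (l g) \<le> l (Suc g)" and C: "0 < C" and S: "finite S"
  shows "\<exists>\<nu> y. inj_on \<nu> {..<L} \<and> (\<forall>g<L. \<nu> g \<notin> S \<and> y g \<in> P (\<nu> g) ` E \<and> 0 < p (\<kappa> (l g)) (y g)) \<and>
    (\<forall>g<L. \<forall>h<L. g \<noteq> h \<longrightarrow> C * p (l (Suc g)) (y h) < p (\<kappa> (l g)) (y g))"
  using lev
proof (induction L)
  case 0
  then show ?case by simp
next
  case (Suc L)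
  obtain \<nu> y where inj: "inj_on \<nu> {..<L}"
    and y_all: "\<forall>g<L. \<nu> g \<notin> S \<and> y g \<in> P (\<nu> g) ` E \<and> 0 < p (\<kappa> (l g)) (y g)"
    and dom: "\<forall>g<L. \<forall>h<L. g \<noteq> h \<longrightarrow> C * p (l (Suc g)) (y h) < p (\<kappa> (l g)) (y g)"
    using Suc.IH Suc.prems by (auto simp: less_Suc_eq)
  have y: "g < L \<Longrightarrow> \<nu> g \<notin> S" "g < L \<Longrightarrow> y g \<in> P (\<nu> g) ` E" "g < L \<Longrightarrow> 0 < p (\<kappa> (l g)) (y g)" for g
    using y_all by auto
  have yE: "y g \<in> E" if "g < L" for g using y(2)[OF that] component_E by blast
  define \<Lambda> where "\<Lambda> = 1 + (\<Sum>h<L. C * p (l (Suc L)) (y h))"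
  have nonneg_terms: "0 \<le> C * p (l (Suc L)) (y h)" if "h < L" for h using C p_nonneg[OF yE[OF that]] by simp
  then have \<Lambda>: "0 < \<Lambda>" unfolding \<Lambda>_def by (intro add_pos_nonneg sum_nonneg) auto
  have \<Lambda>_gt: "C * p (l (Suc L)) (y h) < \<Lambda>" if "h < L" for h
  proof -
    have "C * p (l (Suc L)) (y h) \<le> (\<Sum>h<L. C * p (l (Suc L)) (y h))"
      using that nonneg_terms by (intro member_le_sum) auto
    then show ?thesis by (simp add: \<Lambda>_def)
  qed
  define \<mu> where "\<mu> = Min (insert 1 ((\<lambda>h. p (\<kappa> (l h)) (y h)) ` {..<L}))"
  have \<mu>: "0 < \<mu>" "\<And>h. h < L \<Longrightarrow> \<mu> \<le> p (\<kappa> (l h)) (y h)" unfolding \<mu>_def using y(3) by auto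
  have \<eta>: "0 < \<mu> / (2 * C)" using \<mu>(1) C by simp
  have "finite (S \<union> \<nu> ` {..<L})" using S by simp
  then obtain n z where z: "n \<notin> S \<union> \<nu> ` {..<L}" "z \<in> P n ` E" "\<Lambda> \<le> p (\<kappa> (l L)) z" "p (l L) z \<le> \<mu> / (2 * C)"
    using rich \<Lambda> \<eta> unfolding rich_def by meson
  have zE: "z \<in> E" using z(2) component_E by blast
  have l_mono: "l (Suc g) \<le> l L" if "g < L" for g
  proof -
    have "Suc g \<le> L" using that by simp
    then show ?thesis
    proof (induction L rule: dec_induct)
      case (step h)
      have "l h \<le> \<kappa> (l h)" using rich by (simp add: rich_def)
      then show ?case using step Suc.prems[of h] \<open>g < L\<close> by (meson Suc_leD le_trans less_Suc_eq lessI order_less_trans)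
    qed simp
  qed
  let ?\<nu> = "\<nu>(L := n)" and ?y = "y(L := z)"
  have "inj_on ?\<nu> {..<Suc L}"
    using inj z(1) by (auto simp: inj_on_def less_Suc_eq)
  moreover have "?\<nu> g \<notin> S \<and> ?y g \<in> P (?\<nu> g) ` E \<and> 0 < p (\<kappa> (l g)) (?y g)" if "g < Suc L" for g
    using that y z \<Lambda> by (auto simp: less_Suc_eq)
  moreover have "C * p (l (Suc g)) (?y h) < p (\<kappa> (l g)) (?y g)" if gh: "g < Suc L" "h < Suc L" "g \<noteq> h" for g h
  proof -
    consider "g < L" "h < L" | "g = L" "h < L" | "g < L" "h = L" using gh by linarith
    then show ?thesis
    proof cases
      case 1
      then show ?thesis using dom gh(3) by simp
    next
      case 2
      then show ?thesis using \<Lambda>_gt z(3) by fastforce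
    next
      case 3
      have "C * p (l (Suc g)) z \<le> C * p (l L) z" using C p_mono[OF l_mono[OF 3(1)] zE] by simp
      also have "\<dots> \<le> C * (\<mu> / (2 * C))" using C z(4) by (intro mult_left_mono) auto
      also have "\<dots> < \<mu>" using C \<mu>(1) by simp
      also have "\<dots> \<le> p (\<kappa> (l g)) (y g)" by (rule \<mu>(2)[OF 3(1)])
      finally show ?thesis using 3 by simp
    qed
  qed
  ultimately show ?case by (intro exI[of _ ?\<nu>] exI[of _ ?y]) blast
qed

end

text \<open>The levels that matter depend on an unknown decomposition, so blocks are provided for all of them.
  Only the levels \<open>l 0, \<dots>, l (n + 1)\<close> enter, so countably many blocks suffice, and they can have
  disjoint supports.\<close>

locale blocks = orthogonal_schauder v s T p P
  for v :: "'k::field \<Rightarrow> real" and s :: "'k \<Rightarrow> 'b::ab_group_add \<Rightarrow> 'b" and T :: "'b topology" and p P +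
  fixes \<kappa> :: "nat \<Rightarrow> nat" and d :: "nat \<Rightarrow> nat" and \<nu> :: "nat \<Rightarrow> nat \<Rightarrow> nat" and y :: "nat \<Rightarrow> nat \<Rightarrow> 'b"
  assumes y_component: "g \<le> d \<tau> \<Longrightarrow> y \<tau> g \<in> P (\<nu> \<tau> g) ` topspace T"
    and y_nonzero: "g \<le> d \<tau> \<Longrightarrow> y \<tau> g \<noteq> 0"
    and \<nu>_inj: "g \<le> d \<tau> \<Longrightarrow> g' \<le> d \<tau>' \<Longrightarrow> \<nu> \<tau> g = \<nu> \<tau>' g' \<Longrightarrow> \<tau> = \<tau>' \<and> g = g'"
    and ex_dominating: "0 < C \<Longrightarrow> (\<And>g. g \<le> n \<Longrightarrow> \<kappa> (l g) \<le> l (Suc g)) \<Longrightarrow>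
      \<exists>\<tau>. d \<tau> = n \<and> (\<forall>g\<le>n. \<forall>h\<le>n. g \<noteq> h \<longrightarrow> C * p (l (Suc g)) (y \<tau> h) < p (\<kappa> (l g)) (y \<tau> g))"

text \<open>The blocks are chosen one after the other, each avoiding the components used before.\<close>

lemma (in orthogonal_schauder) ex_blocks:
  assumes rich: "rich \<kappa>"
  shows "\<exists>d \<nu> y. blocks v s T p P \<kappa> d \<nu> y"
proof -
  \<comment> \<open>A block is specified by a list of levels and a natural number bounding the constant.\<close>
  define \<A> where "\<A> = {(ls, M :: nat). 2 \<le> length ls \<and> (\<forall>g. Suc g < length ls \<longrightarrow> \<kappa> (ls ! g) \<le> ls ! Suc g)}"
  have \<A>: "countable \<A>" "\<A> \<noteq> {}"
  proof -
    have "([0, \<kappa> 0], 0) \<in> \<A>" by (auto simp: \<A>_def less_Suc_eq)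
    then show "\<A> \<noteq> {}" by blast
  qed auto
  define pr where "pr \<tau> = from_nat_into \<A> \<tau>" for \<tau>
  have pr: "pr \<tau> \<in> \<A>" for \<tau> unfolding pr_def by (rule from_nat_into[OF \<A>(2)])
  define d where "d \<tau> = length (fst (pr \<tau>)) - 2" for \<tau>
  define l where "l \<tau> g = fst (pr \<tau>) ! g" for \<tau> g
  define C where "C \<tau> = 1 + real (snd (pr \<tau>))" for \<tau>
  have len: "length (fst (pr \<tau>)) = Suc (Suc (d \<tau>))" and lev: "\<And>g. g < Suc (d \<tau>) \<Longrightarrow> \<kappa> (l \<tau> g) \<le> l \<tau> (Suc g)" for \<tau>
    using pr[of \<tau>] by (auto simp: \<A>_def d_def l_def split: prod.splits)
  have C: "0 < C \<tau>" for \<tau> by (simp add: C_def)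
  define good where "good \<tau> st \<longleftrightarrow> (case st of (\<nu>, y, S) \<Rightarrow> finite S \<and> \<nu> ` {..<Suc (d \<tau>)} \<subseteq> S \<and>
      inj_on \<nu> {..<Suc (d \<tau>)} \<and> (\<forall>g<Suc (d \<tau>). y g \<in> P (\<nu> g) ` E \<and> 0 < p (\<kappa> (l \<tau> g)) (y g)) \<and>
      (\<forall>g<Suc (d \<tau>). \<forall>h<Suc (d \<tau>). g \<noteq> h \<longrightarrow> C \<tau> * p (l \<tau> (Suc g)) (y h) < p (\<kappa> (l \<tau> g)) (y g)))"
    for \<tau> and st :: "(nat \<Rightarrow> nat) \<times> (nat \<Rightarrow> 'b) \<times> nat set"
  define fresh where "fresh \<tau> st st' \<longleftrightarrow> (case st of (\<nu>, y, S) \<Rightarrow> case st' of (\<nu>', y', S') \<Rightarrow>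
      S \<subseteq> S' \<and> \<nu>' ` {..<Suc (d (Suc \<tau>))} \<inter> S = {})"
    for \<tau> and st st' :: "(nat \<Rightarrow> nat) \<times> (nat \<Rightarrow> 'b) \<times> nat set"
  have step_ex: "\<exists>\<nu> y S'. good \<tau> (\<nu>, y, S') \<and> S \<subseteq> S' \<and> \<nu> ` {..<Suc (d \<tau>)} \<inter> S = {}" if S: "finite S" for \<tau> S
  proof -
    obtain \<nu> y where *: "inj_on \<nu> {..<Suc (d \<tau>)}"
      "\<forall>g<Suc (d \<tau>). \<nu> g \<notin> S \<and> y g \<in> P (\<nu> g) ` E \<and> 0 < p (\<kappa> (l \<tau> g)) (y g)"
      "\<forall>g<Suc (d \<tau>). \<forall>h<Suc (d \<tau>). g \<noteq> h \<longrightarrow> C \<tau> * p (l \<tau> (Suc g)) (y h) < p (\<kappa> (l \<tau> g)) (y g)"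
      using ex_block[where L = "Suc (d \<tau>)" and l = "l \<tau>" and C = "C \<tau>", OF rich lev C S] by blast
    then have "good \<tau> (\<nu>, y, S \<union> \<nu> ` {..<Suc (d \<tau>)})" using S by (simp add: good_def)
    moreover have "\<nu> ` {..<Suc (d \<tau>)} \<inter> S = {}" using *(2) by auto
    ultimately show ?thesis by blast
  qed
  have "\<exists>f. \<forall>\<tau>. good \<tau> (f \<tau>) \<and> fresh \<tau> (f \<tau>) (f (Suc \<tau>))"
  proof (rule dependent_nat_choice)
    show "\<exists>st. good 0 st" using step_ex[of "{}" 0] by blast
  next
    fix st \<tau> assume g: "good \<tau> st"
    obtain \<nu> y S where st: "st = (\<nu>, y, S)" by (metis surj_pair)
    have "finite S" using g by (simp add: good_def st)
    then show "\<exists>st'. good (Suc \<tau>) st' \<and> fresh \<tau> st st'"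
      using step_ex[of S "Suc \<tau>"] unfolding fresh_def st by auto
  qed
  then obtain f where f: "\<And>\<tau>. good \<tau> (f \<tau>)" "\<And>\<tau>. fresh \<tau> (f \<tau>) (f (Suc \<tau>))" by blast
  define \<nu> y S where "\<nu> \<tau> = fst (f \<tau>)" and "y \<tau> = fst (snd (f \<tau>))" and "S \<tau> = snd (snd (f \<tau>))" for \<tau>
  have f_eq: "f \<tau> = (\<nu> \<tau>, y \<tau>, S \<tau>)" for \<tau> by (simp add: \<nu>_def y_def S_def)
  have \<nu>S: "\<nu> \<tau> g \<in> S \<tau>" and y: "y \<tau> g \<in> P (\<nu> \<tau> g) ` E" "0 < p (\<kappa> (l \<tau> g)) (y \<tau> g)" if "g \<le> d \<tau>" for \<tau> g
    using f(1)[of \<tau>] that by (auto simp: good_def f_eq)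
  have inj: "inj_on (\<nu> \<tau>) {..<Suc (d \<tau>)}" for \<tau> using f(1)[of \<tau>] by (simp add: good_def f_eq)
  have dom: "C \<tau> * p (l \<tau> (Suc g)) (y \<tau> h) < p (\<kappa> (l \<tau> g)) (y \<tau> g)" if "g \<le> d \<tau>" "h \<le> d \<tau>" "g \<noteq> h" for \<tau> g h
    using f(1)[of \<tau>] that by (auto simp: good_def f_eq)
  have S_mono: "S \<tau> \<subseteq> S \<tau>'" if "\<tau> \<le> \<tau>'" for \<tau> \<tau>'
    by (rule lift_Suc_mono_le[OF _ that]) (use f(2) in \<open>auto simp: fresh_def f_eq\<close>)
  have fresh: "\<nu> \<tau>' g \<notin> S \<tau>" if less: "\<tau> < \<tau>'" and g: "g \<le> d \<tau>'" for \<tau> \<tau>' g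
  proof -
    obtain \<sigma> where \<sigma>: "\<tau>' = Suc \<sigma>" "\<tau> \<le> \<sigma>" using less by (cases \<tau>') auto
    have "\<nu> \<tau>' ` {..<Suc (d \<tau>')} \<inter> S \<sigma> = {}" using f(2)[of \<sigma>] by (simp add: fresh_def f_eq \<sigma>(1))
    moreover have "\<nu> \<tau>' g \<in> \<nu> \<tau>' ` {..<Suc (d \<tau>')}" using g by simp
    ultimately show ?thesis using S_mono[OF \<sigma>(2)] by blast
  qed
  have "blocks v s T p P \<kappa> d \<nu> y"
  proof unfold_locales
    fix g \<tau> assume g: "g \<le> d \<tau>"
    show "y \<tau> g \<in> P (\<nu> \<tau> g) ` E" by (rule y(1)[OF g])
    show "y \<tau> g \<noteq> 0" using y(2)[OF g] by auto
  next
    fix g \<tau> g' \<tau>' assume g: "g \<le> d \<tau>" "g' \<le> d \<tau>'" "\<nu> \<tau> g = \<nu> \<tau>' g'"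
    have "\<tau> = \<tau>'"
      using fresh[of \<tau> \<tau>' g'] fresh[of \<tau>' \<tau> g] \<nu>S[OF g(1)] \<nu>S[OF g(2)] g by (cases \<tau> \<tau>' rule: linorder_cases) auto
    then show "\<tau> = \<tau>' \<and> g = g'" using inj_onD[OF inj[of \<tau>] g(3)[folded \<open>\<tau> = \<tau>'\<close>]] g by auto
  next
    fix C' :: real and n l' assume C': "0 < C'" and l': "\<And>g. g \<le> n \<Longrightarrow> \<kappa> (l' g) \<le> l' (Suc g)"
    obtain M :: nat where M: "C' < real M" using reals_Archimedean2 by blast
    define ls where "ls = map l' [0..<Suc (Suc n)]"
    have nth: "ls ! g = l' g" if "g \<le> Suc n" for g unfolding ls_def using that by (subst nth_map) (auto simp del: upt_Suc)
    have ls: "length ls = Suc (Suc n)" by (simp add: ls_def)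
    have "(ls, M) \<in> \<A>" unfolding \<A>_def using l' nth ls by auto
    then obtain \<tau> where \<tau>: "pr \<tau> = (ls, M)" unfolding pr_def using from_nat_into_surj[OF \<A>(1)] by blast
    have d: "d \<tau> = n" by (simp add: d_def \<tau> ls)
    have l_eq: "l \<tau> g = l' g" if "g \<le> Suc n" for g using nth[OF that] by (simp add: l_def \<tau>)
    have "C' * p (l' (Suc g)) (y \<tau> h) < p (\<kappa> (l' g)) (y \<tau> g)" if gh: "g \<le> n" "h \<le> n" "g \<noteq> h" for g h
    proof -
      have "y \<tau> h \<in> E" using y(1)[of h \<tau>] component_E gh d by blast
      then have "C' * p (l' (Suc g)) (y \<tau> h) \<le> C \<tau> * p (l' (Suc g)) (y \<tau> h)"
        using M by (intro mult_right_mono p_nonneg) (auto simp: C_def \<tau>)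
      then show ?thesis using dom[of g \<tau> h] gh d l_eq by simp
    qed
    then show "\<exists>\<tau>. d \<tau> = n \<and> (\<forall>g\<le>n. \<forall>h\<le>n. g \<noteq> h \<longrightarrow> C' * p (l' (Suc g)) (y \<tau> h) < p (\<kappa> (l' g)) (y \<tau> g))"
      using d by blast
  qed
  then show ?thesis by blast
qed

section \<open>The subspace without a strongly finite-dimensional decomposition\<close>

context blocks
begin

definition block_vec :: "nat \<Rightarrow> nat \<Rightarrow> 'b" where
  "block_vec \<tau> g = y \<tau> g + y \<tau> (d \<tau>)"

text \<open>Each condition concerns finitely many components and a finite-dimensional space, which is closed.\<close>

definition block_subspace :: "'b set" where
  "block_subspace = {x \<in> E. \<forall>\<tau>. (\<Sum>g\<le>d \<tau>. P (\<nu> \<tau> g) x) \<in> span (block_vec \<tau> ` {..<d \<tau>})}"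

lemma y_E: "g \<le> d \<tau> \<Longrightarrow> y \<tau> g \<in> E"
  using y_component component_E by blast

lemma block_vec_E: "g < d \<tau> \<Longrightarrow> block_vec \<tau> g \<in> E"
  unfolding block_vec_def by (intro E_add y_E) auto

lemma P_y: "g \<le> d \<tau> \<Longrightarrow> h \<le> d \<sigma> \<Longrightarrow> P (\<nu> \<tau> g) (y \<sigma> h) = (if \<tau> = \<sigma> \<and> g = h then y \<sigma> h else 0)"
  using P_component[OF y_component, of h \<sigma> "\<nu> \<tau> g"] \<nu>_inj[of g \<tau> h \<sigma>] by auto

lemma P_block_vec:
  assumes g: "g \<le> d \<tau>" and h: "h < d \<tau>"
  shows "P (\<nu> \<tau> g) (block_vec \<tau> h) = (if g = h \<or> g = d \<tau> then y \<tau> g else 0)"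
  unfolding block_vec_def using assms by (auto simp: P_add y_E P_y)

lemma scale_sum_delta:
  assumes "finite I" "g \<in> I"
  shows "(\<Sum>h\<in>I. s (a h) (if g = h then x else 0)) = s (a g) x"
proof -
  have "(\<Sum>h\<in>I. s (a h) (if g = h then x else 0)) = (\<Sum>h\<in>I. if h = g then s (a h) x else 0)"
    by (rule sum.cong) auto
  then show ?thesis using assms by (simp add: sum.delta)
qed

lemma subspace_block_subspace: "subspace block_subspace"
  unfolding subspace_def
proof (intro conjI ballI allI)
  show "0 \<in> block_subspace" unfolding block_subspace_def using E_0 by (auto simp: span_zero)
  show "x + z \<in> block_subspace" if "x \<in> block_subspace" "z \<in> block_subspace" for x z
    using that unfolding block_subspace_def by (auto simp: E_add P_add sum.distrib intro!: span_add)
  show "s a x \<in> block_subspace" if "x \<in> block_subspace" for a x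
    using that unfolding block_subspace_def by (auto simp: E_scale P_scale scale_sum_right[symmetric] intro!: span_scale)
qed

lemma closedin_block_subspace: "closedin T block_subspace"
  unfolding closedin_def
proof
  show "block_subspace \<subseteq> E" by (auto simp: block_subspace_def)
  show "openin T (E - block_subspace)"
  proof (rule defines_topologyI[OF p_topology])
    fix x assume x: "x \<in> E - block_subspace"
    then obtain \<tau> where \<tau>: "(\<Sum>g\<le>d \<tau>. P (\<nu> \<tau> g) x) \<notin> span (block_vec \<tau> ` {..<d \<tau>})" (is "?Q x \<notin> ?F") by (auto simp: block_subspace_def)
    have FE: "block_vec \<tau> ` {..<d \<tau>} \<subseteq> E" using block_vec_E by auto
    have QE: "?Q z \<in> E" if "z \<in> E" for z using that by (intro E_sum P_E)
    have xE: "x \<in> E" using x by simp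
    have "\<not> (\<forall>k e. 0 < e \<longrightarrow> (\<exists>w\<in>?F. p k (?Q x - w) < e))"
    proof
      assume near: "\<forall>k e. 0 < e \<longrightarrow> (\<exists>w\<in>?F. p k (?Q x - w) < e)"
      have "?Q x \<in> ?F"
        by (rule finite_span_closed[of p, OF p_seminorm p_Suc p_separating _ FE QE[OF xE]]) (use near in auto)
      then show False using \<tau> by simp
    qed
    then obtain k e where e: "0 < e" "\<And>w. w \<in> ?F \<Longrightarrow> e \<le> p k (?Q x - w)" by (meson not_le)
    have "z \<notin> block_subspace" if z: "z \<in> E" "p k (z - x) < e" for z
    proof
      assume "z \<in> block_subspace"
      then have "e \<le> p k (?Q x - ?Q z)" by (intro e) (auto simp: block_subspace_def)
      also have "\<dots> = p k (?Q z - ?Q x)" by (rule p_commute[OF QE[OF xE] QE[OF z(1)]])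
      also have "?Q z - ?Q x = ?Q (z - x)" using z xE by (simp add: P_diff sum_subtractf)
      also have "p k \<dots> \<le> p k (z - x)"
        using z xE E_diff by (intro p_sum) (auto simp: P_E P_le p_nonneg)
      finally show False using z by simp
    qed
    then show "\<exists>k. \<exists>r>0. {z \<in> E. p k (z - x) < r} \<subseteq> E - block_subspace" using e(1) by (intro exI[of _ k] exI[of _ e]) auto
  qed auto
qed

lemma block_vec_in:
  assumes g: "g < d \<tau>"
  shows "block_vec \<tau> g \<in> block_subspace"
proof -
  have "(\<Sum>h\<le>d \<sigma>. P (\<nu> \<sigma> h) (block_vec \<tau> g)) \<in> span (block_vec \<sigma> ` {..<d \<sigma>})" for \<sigma>
  proof (cases "\<sigma> = \<tau>")
    case False
    then have "P (\<nu> \<sigma> h) (block_vec \<tau> g) = 0" if "h \<le> d \<sigma>" for h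
      unfolding block_vec_def using that g by (simp add: P_add y_E P_y)
    then show ?thesis by (simp add: span_zero)
  next
    case True
    have "(\<Sum>h\<le>d \<tau>. P (\<nu> \<tau> h) (block_vec \<tau> g)) = (\<Sum>h\<le>d \<tau>. if h = g \<or> h = d \<tau> then y \<tau> h else 0)"
      by (rule sum.cong) (use P_block_vec g in auto)
    also have "\<dots> = (\<Sum>h\<in>{g, d \<tau>}. y \<tau> h)"
      using g by (intro sum.mono_neutral_cong_right) auto
    also have "\<dots> = block_vec \<tau> g" using g by (simp add: block_vec_def)
    finally show ?thesis using True g by (simp add: span_base)
  qed
  then show ?thesis using block_vec_E[OF g] by (simp add: block_subspace_def)
qed

lemma ex_coefficients:
  assumes "w \<in> span (block_vec \<tau> ` {..<n})"
  shows "\<exists>a. w = (\<Sum>g<n. s (a g) (block_vec \<tau> g))"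
proof -
  let ?V = "range (\<lambda>a. \<Sum>g<n. s (a g) (block_vec \<tau> g))"
  have "subspace ?V"
    unfolding subspace_def
  proof (intro conjI ballI allI)
    show "0 \<in> ?V" by (rule range_eqI[of _ _ "\<lambda>_. 0"]) simp
    show "x + z \<in> ?V" if xz: "x \<in> ?V" "z \<in> ?V" for x z
    proof -
      obtain a b where "x = (\<Sum>g<n. s (a g) (block_vec \<tau> g))" "z = (\<Sum>g<n. s (b g) (block_vec \<tau> g))" using xz by blast
      then have "x + z = (\<Sum>g<n. s (a g + b g) (block_vec \<tau> g))" by (simp add: scale_left_distrib sum.distrib)
      then show ?thesis by (rule range_eqI[of _ _ "\<lambda>g. a g + b g"])
    qed
    show "s b x \<in> ?V" if x: "x \<in> ?V" for b x
    proof -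
      obtain a where "x = (\<Sum>g<n. s (a g) (block_vec \<tau> g))" using x by blast
      then have "s b x = (\<Sum>g<n. s (b * a g) (block_vec \<tau> g))" by (simp add: scale_sum_right)
      then show ?thesis by (rule range_eqI[of _ _ "\<lambda>g. b * a g"])
    qed
  qed
  moreover have "block_vec \<tau> ` {..<n} \<subseteq> ?V"
  proof (intro image_subsetI)
    fix h assume "h \<in> {..<n}"
    then have "block_vec \<tau> h = (\<Sum>g<n. s (if g = h then 1 else 0) (block_vec \<tau> g))" by (simp add: if_distrib[of "\<lambda>a. s a _"] sum.delta cong: if_cong)
    then show "block_vec \<tau> h \<in> ?V" by (rule range_eqI[of _ _ "\<lambda>g. if g = h then 1 else 0"])
  qed
  ultimately show ?thesis using span_minimal assms by blast
qed

lemma block_coordinates: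
  assumes x: "x \<in> block_subspace"
  shows "\<exists>a. (\<forall>g<d \<tau>. P (\<nu> \<tau> g) x = s (a g) (y \<tau> g)) \<and> P (\<nu> \<tau> (d \<tau>)) x = s (\<Sum>g<d \<tau>. a g) (y \<tau> (d \<tau>))"
proof -
  have xE: "x \<in> E" using x by (simp add: block_subspace_def)
  have "(\<Sum>g\<le>d \<tau>. P (\<nu> \<tau> g) x) \<in> span (block_vec \<tau> ` {..<d \<tau>})" using x by (simp add: block_subspace_def)
  then obtain a where a: "(\<Sum>g\<le>d \<tau>. P (\<nu> \<tau> g) x) = (\<Sum>g<d \<tau>. s (a g) (block_vec \<tau> g))" using ex_coefficients by blast
  have P_x: "P (\<nu> \<tau> g) x = (\<Sum>h<d \<tau>. s (a h) (P (\<nu> \<tau> g) (block_vec \<tau> h)))" if g: "g \<le> d \<tau>" for g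
  proof -
    have "P (\<nu> \<tau> g) (P (\<nu> \<tau> h) x) = (if h = g then P (\<nu> \<tau> g) x else 0)" if "h \<le> d \<tau>" for h
      using P_P[OF xE] \<nu>_inj[OF g that] by auto
    then have "P (\<nu> \<tau> g) (\<Sum>h\<le>d \<tau>. P (\<nu> \<tau> h) x) = (\<Sum>h\<le>d \<tau>. if h = g then P (\<nu> \<tau> g) x else 0)"
      using P_E[OF xE] by (subst P_sum) auto
    then have "P (\<nu> \<tau> g) x = P (\<nu> \<tau> g) (\<Sum>h\<le>d \<tau>. P (\<nu> \<tau> h) x)" using g by (simp add: sum.delta)
    also have "\<dots> = (\<Sum>h<d \<tau>. s (a h) (P (\<nu> \<tau> g) (block_vec \<tau> h)))"
      unfolding a by (subst P_sum) (auto simp: P_scale block_vec_E E_scale)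
    finally show ?thesis .
  qed
  have "P (\<nu> \<tau> g) x = s (a g) (y \<tau> g)" if g: "g < d \<tau>" for g
  proof -
    have "P (\<nu> \<tau> g) x = (\<Sum>h<d \<tau>. s (a h) (if g = h then y \<tau> g else 0))"
      using g P_block_vec[of g \<tau>] by (subst P_x) auto
    then show ?thesis using g by (simp add: scale_sum_delta)
  qed
  moreover have "P (\<nu> \<tau> (d \<tau>)) x = s (\<Sum>g<d \<tau>. a g) (y \<tau> (d \<tau>))"
    using P_block_vec[of "d \<tau>" \<tau>] by (subst P_x) (auto simp: scale_sum_left intro!: sum.cong)
  ultimately show ?thesis by blast
qed

lemma block_subspace_infinite_dim:
  assumes \<kappa>: "\<And>m. m \<le> \<kappa> m"
  shows "\<not> finite_dim s block_subspace"
proof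
  assume "finite_dim s block_subspace"
  then obtain B where B: "finite B" "block_subspace \<subseteq> span B" unfolding finite_dim_def by blast
  define l where "l = rec_nat 0 (\<lambda>_. \<kappa>)"
  obtain \<tau> where \<tau>: "d \<tau> = Suc (card B)" using ex_dominating[of 1 "Suc (card B)" l] by (auto simp: l_def)
  have "block_vec \<tau> g \<in> span B" if "g < d \<tau>" for g using block_vec_in[OF that] B(2) by blast
  moreover have "card B < d \<tau>" by (simp add: \<tau>)
  ultimately obtain a where a: "\<exists>g<d \<tau>. a g \<noteq> 0" "(\<Sum>g<d \<tau>. s (a g) (block_vec \<tau> g)) = 0"
    using dependent_family[OF B(1), of "d \<tau>" "block_vec \<tau>"] by blast
  have "a g = 0" if g: "g < d \<tau>" for g
  proof -
    have "0 = P (\<nu> \<tau> g) (\<Sum>h<d \<tau>. s (a h) (block_vec \<tau> h))" using a(2) by simp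
    also have "\<dots> = (\<Sum>h<d \<tau>. s (a h) (if g = h then y \<tau> g else 0))"
      using g P_block_vec[of g \<tau>] by (subst P_sum) (auto simp: P_scale block_vec_E E_scale simp del: if_split_asm)
    also have "\<dots> = s (a g) (y \<tau> g)" using g by (simp add: scale_sum_delta)
    finally show ?thesis using y_nonzero[of g \<tau>] g by simp
  qed
  then show False using a(1) by blast
qed

text \<open>Let \<open>R\<close> be a decomposition of \<open>block_subspace\<close> with components of dimension at most \<open>N\<close>, and choose a block
  with \<open>d = N + 1\<close> whose levels are adapted to the equicontinuity estimates of \<open>R\<close>. In the basis
  \<open>block_vec 0, \<dots>, block_vec (d - 1)\<close> of the block, each \<open>R j\<close>, compressed to the
  block, is given by a \<open>d \<times> d\<close> matrix. The domination of \<open>y g\<close>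
  says that the \<open>g\<close>-th coordinate form is almost an eigenvector of the transposed matrix, for \<open>g < d\<close>,
  and that of \<open>y d\<close> says the same for the sum of all coordinates. So the matrix is a scalar one up to
  entries of absolute value less than \<open>1\<close>. If the scalar were of absolute value at least \<open>1\<close>, the
  matrix would be invertible, since in every column the diagonal entry would dominate; but its rank
  is at most \<open>N < d\<close>. So the upper left entries of all these matrices have absolute value less than
  \<open>1\<close>, and by the ultrametric inequality they cannot sum up to \<open>1\<close>.\<close>

lemma no_strongly_finite_dimensional_decomposition:
  assumes R: "schauder_decomposition s (subtopology T block_subspace) R"
    and strong: "strongly_finite_dimensional s (subtopology T block_subspace) R"
  shows False
proof -
  have top_sub: "topspace (subtopology T block_subspace) = block_subspace" using closedin_block_subspace closedin_subset by fastforce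
  have sub_E: "x \<in> E" if "x \<in> block_subspace" for x using that by (simp add: block_subspace_def)
  interpret R: schauder v s "subtopology T block_subspace" p R
    using frechet_subspace[OF subspace_block_subspace closedin_block_subspace] R by (simp add: schauder_def schauder_axioms_def)
  note R_in = R.P_E[unfolded top_sub]
  obtain N where N: "\<And>n. finite_dim s (R n ` block_subspace)" "\<And>n. dim (R n ` block_subspace) \<le> N"
    using strong unfolding strongly_finite_dimensional_def top_sub by blast
  have "\<forall>k. \<exists>mC. k \<le> fst mC \<and> 0 < snd mC \<and> (\<forall>n. \<forall>x\<in>block_subspace. p k (R n x) \<le> snd mC * p (fst mC) x)"
    using R.equicontinuous unfolding top_sub by fastforce
  from choice[OF this] obtain mC where mC: "\<And>k. k \<le> fst (mC k)" "\<And>k. 0 < snd (mC k)"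
    "\<And>k n x. x \<in> block_subspace \<Longrightarrow> p k (R n x) \<le> snd (mC k) * p (fst (mC k)) x" by blast
  define l where "l = rec_nat 0 (\<lambda>_ m. fst (mC (\<kappa> m)))"
  have l_Suc: "l (Suc g) = fst (mC (\<kappa> (l g)))" for g by (simp add: l_def)
  define C where "C = (\<Sum>g\<le>Suc N. snd (mC (\<kappa> (l g))))"
  have C_ge: "snd (mC (\<kappa> (l g))) \<le> C" if "g \<le> Suc N" for g
    unfolding C_def using that mC(2) by (intro member_le_sum) (auto intro: less_imp_le)
  then have "0 < C" using mC(2) by (meson le0 less_le_trans)
  then obtain \<tau> where \<tau>: "d \<tau> = Suc N"
    and dom: "\<And>g h. g \<le> Suc N \<Longrightarrow> h \<le> Suc N \<Longrightarrow> g \<noteq> h \<Longrightarrow> C * p (l (Suc g)) (y \<tau> h) < p (\<kappa> (l g)) (y \<tau> g)"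
    using ex_dominating[of C "Suc N" l] mC(1) l_Suc by auto
  \<comment> \<open>A vector of the block without \<open>y g\<close>-component has an image whose coordinate there is small.\<close>
  have small: "v a < 1"
    if x: "x \<in> block_subspace" and g: "g \<le> Suc N" "h \<le> Suc N" "h' \<le> Suc N" "g \<noteq> h" "g \<noteq> h'"
      and p_x: "\<And>k. p k x \<le> max (p k (y \<tau> h)) (p k (y \<tau> h'))"
      and a: "P (\<nu> \<tau> g) (R j x) = s a (y \<tau> g)" for x g h h' j a
  proof -
    let ?k = "\<kappa> (l g)"
    have yE: "y \<tau> g \<in> E" "y \<tau> h \<in> E" using y_E g \<tau> by auto
    have "v a * p ?k (y \<tau> g) = p ?k (P (\<nu> \<tau> g) (R j x))" using a yE by (simp add: p_scale)
    also have "\<dots> \<le> p ?k (R j x)" by (rule P_le) (use R_in[OF x] sub_E in blast)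
    also have "\<dots> \<le> snd (mC ?k) * p (l (Suc g)) x" unfolding l_Suc by (rule mC(3)[OF x])
    also have "\<dots> \<le> C * p (l (Suc g)) x" using C_ge[OF g(1)] p_nonneg[OF sub_E[OF x]] by (intro mult_right_mono)
    also have "\<dots> \<le> C * max (p (l (Suc g)) (y \<tau> h)) (p (l (Suc g)) (y \<tau> h'))"
      using \<open>0 < C\<close> p_x by (intro mult_left_mono) auto
    also have "\<dots> < p ?k (y \<tau> g)" using dom[of g h] dom[of g h'] g \<open>0 < C\<close> by (simp add: max_mult_distrib_left)
    finally have "v a * p ?k (y \<tau> g) < 1 * p ?k (y \<tau> g)" by simp
    then show ?thesis by (rule mult_right_less_imp_less[OF _ p_nonneg[OF yE(1)]])
  qed
  have f_in: "block_vec \<tau> i \<in> block_subspace" if "i < Suc N" for i using block_vec_in \<tau> that by simp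
  define row where "row j i a \<longleftrightarrow> i < Suc N \<longrightarrow> (\<forall>g<Suc N. P (\<nu> \<tau> g) (R j (block_vec \<tau> i)) = s (a g) (y \<tau> g)) \<and>
      P (\<nu> \<tau> (Suc N)) (R j (block_vec \<tau> i)) = s (\<Sum>g<Suc N. a g) (y \<tau> (Suc N))" for j i a
  have "\<exists>a. row j i a" for i j
    using block_coordinates[OF R_in[OF f_in], of i \<tau> j] \<tau> unfolding row_def by (cases "i < Suc N") auto
  then obtain a where "\<And>j i. row j i (a j i)" by metis
  then have a: "i < Suc N \<Longrightarrow> g < Suc N \<Longrightarrow> P (\<nu> \<tau> g) (R j (block_vec \<tau> i)) = s (a j i g) (y \<tau> g)"
    and a_sum: "i < Suc N \<Longrightarrow> P (\<nu> \<tau> (Suc N)) (R j (block_vec \<tau> i)) = s (\<Sum>g<Suc N. a j i g) (y \<tau> (Suc N))" for j i g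
    unfolding row_def by blast+
  have off_diagonal: "v (a j i g) < 1" if "i < Suc N" "g < Suc N" "i \<noteq> g" for i g j
  proof (rule small[OF f_in[OF that(1)]])
    show "p k (block_vec \<tau> i) \<le> max (p k (y \<tau> i)) (p k (y \<tau> (Suc N)))" for k
      unfolding block_vec_def \<tau> by (rule p_add) (use y_E \<tau> that in auto)
    show "P (\<nu> \<tau> g) (R j (block_vec \<tau> i)) = s (a j i g) (y \<tau> g)" by (rule a) (use that in auto)
  qed (use that in auto)
  have diagonal: "v (a j i i - a j 0 0) < 1" if i: "i < Suc N" for i j
  proof (cases "i = 0")
    case False
    have sums: "v ((\<Sum>g<Suc N. a j i g) - (\<Sum>g<Suc N. a j 0 g)) < 1"
    proof (rule small[of "block_vec \<tau> i - block_vec \<tau> 0" "Suc N" i 0])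
      show "block_vec \<tau> i - block_vec \<tau> 0 \<in> block_subspace" using f_in i by (intro subspace_diff[OF subspace_block_subspace]) auto
      show "p k (block_vec \<tau> i - block_vec \<tau> 0) \<le> max (p k (y \<tau> i)) (p k (y \<tau> 0))" for k
        using p_diff[of "y \<tau> i" "y \<tau> 0" k] y_E[of _ \<tau>] \<tau> i by (simp add: block_vec_def)
      have "R j (block_vec \<tau> i - block_vec \<tau> 0) = R j (block_vec \<tau> i) - R j (block_vec \<tau> 0)"
        using R.P_diff[of "block_vec \<tau> i" "block_vec \<tau> 0" j] f_in i unfolding top_sub by simp
      then show "P (\<nu> \<tau> (Suc N)) (R j (block_vec \<tau> i - block_vec \<tau> 0)) =
          s ((\<Sum>g<Suc N. a j i g) - (\<Sum>g<Suc N. a j 0 g)) (y \<tau> (Suc N))"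
        using a_sum[OF i, of j] a_sum[of 0 j] P_diff[OF sub_E[OF R_in[OF f_in[OF i]]] sub_E[OF R_in[OF f_in[of 0]]]]
        by (simp add: scale_left_diff_distrib)
    qed (use i False in auto)
    have rest: "v (\<Sum>g\<in>{..<Suc N} - {i}. a j i g) < 1" if "i < Suc N" for i
      using off_diagonal that by (intro v_sum_less) auto
    have split: "(\<Sum>g<Suc N. a j i g) = a j i i + (\<Sum>g\<in>{..<Suc N} - {i}. a j i g)" if "i < Suc N" for i
      using that by (intro sum.remove) auto
    let ?r = "\<lambda>i. \<Sum>g\<in>{..<Suc N} - {i}. a j i g"
    have "a j i i - a j 0 0 = ((\<Sum>g<Suc N. a j i g) - (\<Sum>g<Suc N. a j 0 g)) - (?r i - ?r 0)"
      unfolding split[OF i] split[OF zero_less_Suc] by (simp add: algebra_simps)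
    then have "v (a j i i - a j 0 0) = v (((\<Sum>g<Suc N. a j i g) - (\<Sum>g<Suc N. a j 0 g)) - (?r i - ?r 0))"
      by (rule arg_cong)
    also have "\<dots> \<le> max (v ((\<Sum>g<Suc N. a j i g) - (\<Sum>g<Suc N. a j 0 g))) (max (v (?r i)) (v (?r 0)))"
      by (rule order_trans[OF v_diff max.mono[OF order_refl v_diff]])
    also have "\<dots> < 1" using sums rest[OF i] rest[OF zero_less_Suc] by simp
    finally show ?thesis .
  qed simp
  have corner: "v (a j 0 0) < 1" for j
  proof (rule ccontr)
    assume "\<not> v (a j 0 0) < 1"
    then have big: "1 \<le> v (a j 0 0)" by simp
    have diag_eq: "v (a j i i) = v (a j 0 0)" if "i < Suc N" for i
      by (rule v_eq_if_close) (use diagonal[OF that, of j] big in linarith)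
    obtain B where B: "finite B" "R j ` block_subspace \<subseteq> span B" "card B = dim (R j ` block_subspace)" by (rule finite_dimE[OF N(1)])
    have "card B < Suc N" using B(3) N(2)[of j] by simp
    moreover have "R j (block_vec \<tau> i) \<in> span B" if "i < Suc N" for i using B(2) f_in[OF that] by blast
    ultimately obtain b where b: "\<exists>i<Suc N. b i \<noteq> 0" "(\<Sum>i<Suc N. s (b i) (R j (block_vec \<tau> i))) = 0"
      using dependent_family[OF B(1), of "Suc N" "\<lambda>i. R j (block_vec \<tau> i)"] by blast
    have rows: "(\<Sum>i<Suc N. b i * a j i g) = 0" if g: "g < Suc N" for g
    proof -
      have RE: "R j (block_vec \<tau> i) \<in> E" if "i < Suc N" for i using sub_E[OF R_in[OF f_in[OF that]]] .
      have "0 = P (\<nu> \<tau> g) (\<Sum>i<Suc N. s (b i) (R j (block_vec \<tau> i)))" unfolding b(2) by simp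
      also have "\<dots> = (\<Sum>i<Suc N. P (\<nu> \<tau> g) (s (b i) (R j (block_vec \<tau> i))))" by (rule P_sum) (use RE E_scale in auto)
      also have "\<dots> = (\<Sum>i<Suc N. s (b i * a j i g) (y \<tau> g))"
        by (rule sum.cong) (use RE a g in \<open>auto simp: P_scale\<close>)
      also have "\<dots> = s (\<Sum>i<Suc N. b i * a j i g) (y \<tau> g)" by (simp only: scale_sum_left)
      finally show ?thesis using y_nonzero[of g \<tau>] g \<tau> by simp
    qed
    define m where "m = Max (v ` b ` {..<Suc N})"
    have m_ge: "v (b i) \<le> m" if "i < Suc N" for i unfolding m_def using that by (intro Max_ge) auto
    have "m \<in> v ` b ` {..<Suc N}" unfolding m_def by (intro Max_in) auto
    then obtain i where i: "i < Suc N" "m = v (b i)" by auto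
    have "0 < m" using b(1) m_ge v_pos by (meson less_le_trans)
    have "v (\<Sum>i'\<in>{..<Suc N} - {i}. b i' * a j i' i) < m"
    proof (rule v_sum_less[OF _ \<open>0 < m\<close>])
      fix i' assume i': "i' \<in> {..<Suc N} - {i}"
      have "v (b i') * v (a j i' i) \<le> m * v (a j i' i)" using m_ge i' nonneg by (intro mult_right_mono) auto
      also have "\<dots> < m * 1" using off_diagonal[of i' i j] i' i(1) \<open>0 < m\<close> by (intro mult_strict_left_mono) auto
      finally show "v (b i' * a j i' i) < m" by (simp add: mult)
    qed
    moreover have "b i * a j i i = - (\<Sum>i'\<in>{..<Suc N} - {i}. b i' * a j i' i)"
      using rows[OF i(1)] sum.remove[of "{..<Suc N}" i "\<lambda>i'. b i' * a j i' i"] i(1) by (simp add: eq_neg_iff_add_eq_0)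
    ultimately have "v (b i * a j i i) < m" by simp
    then have "m * v (a j 0 0) < m * 1" using i diag_eq[OF i(1)] by (simp add: mult)
    then show False using big \<open>0 < m\<close> by simp
  qed
  have f0: "block_vec \<tau> 0 \<in> block_subspace" "block_vec \<tau> 0 \<in> E" using f_in[of 0] sub_E by auto
  let ?S = "\<lambda>J. \<Sum>j<J. R j (block_vec \<tau> 0)"
  have coord: "P (\<nu> \<tau> 0) (?S J - block_vec \<tau> 0) = s ((\<Sum>j<J. a j 0 0) - 1) (y \<tau> 0)" for J
  proof -
    have RE: "R j (block_vec \<tau> 0) \<in> E" for j using sub_E[OF R_in[OF f0(1)]] .
    have "P (\<nu> \<tau> 0) (?S J) = s (\<Sum>j<J. a j 0 0) (y \<tau> 0)"
      using P_sum[of "{..<J}" "\<lambda>j. R j (block_vec \<tau> 0)" "\<nu> \<tau> 0"] RE a[of 0 0] by (simp add: scale_sum_left)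
    moreover have "P (\<nu> \<tau> 0) (block_vec \<tau> 0) = y \<tau> 0" using P_block_vec[of 0 \<tau> 0] \<tau> by simp
    ultimately show ?thesis using P_diff[of "?S J" "block_vec \<tau> 0"] E_sum[of "{..<J}" "\<lambda>j. R j (block_vec \<tau> 0)"] RE f0
      by (simp add: scale_left_diff_distrib)
  qed
  have y0: "y \<tau> 0 \<in> E" "y \<tau> 0 \<noteq> 0" using y_E[of 0 \<tau>] y_nonzero[of 0 \<tau>] by auto
  then obtain k where "p k (y \<tau> 0) \<noteq> 0" using p_separating by blast
  then have k: "0 < p k (y \<tau> 0)" using p_nonneg[OF y0(1), of k] by simp
  have "\<forall>\<^sub>F J in sequentially. p k (?S J - block_vec \<tau> 0) < p k (y \<tau> 0)"
    using R.P_sums[of "block_vec \<tau> 0" k] f0 k unfolding top_sub by (intro order_tendstoD(2)[of _ 0]) auto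
  then obtain J where J: "p k (?S J - block_vec \<tau> 0) < p k (y \<tau> 0)" using eventually_happens'[OF sequentially_bot] by blast
  have SE: "?S J - block_vec \<tau> 0 \<in> E" using sub_E[OF R_in[OF f0(1)]] f0 by (intro E_diff E_sum) auto
  have "v ((\<Sum>j<J. a j 0 0) - 1) * p k (y \<tau> 0) \<le> p k (?S J - block_vec \<tau> 0)"
    using P_le[OF SE, of k "\<nu> \<tau> 0"] coord[of J] y0 by (simp add: p_scale)
  then have "v ((\<Sum>j<J. a j 0 0) - 1) * p k (y \<tau> 0) < 1 * p k (y \<tau> 0)" using J by simp
  then have "v ((\<Sum>j<J. a j 0 0) - 1) < 1" using k by simp
  moreover have "v (\<Sum>j<J. a j 0 0) < 1" using corner by (intro v_sum_less) auto
  ultimately show False using v_diff[of "\<Sum>j<J. a j 0 0" "(\<Sum>j<J. a j 0 0) - 1"] by simp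
qed

end

section \<open>The theorem\<close>

theorem theorem3p0p3:
  fixes v :: "'k::field \<Rightarrow> real"
    and s :: "'k \<Rightarrow> 'b::ab_group_add \<Rightarrow> 'b"
    and X :: "'b topology"
  assumes "complete_nonarch_field v"
    and "frechet_space v s X"
    and "\<not> finite_dim s (topspace X)"
    and "\<not> lcs_isomorphic s X seq_scale (c0_space v)"
    and "\<not> lcs_isomorphic s X (prod_scale seq_scale seq_scale) (prod_topology (c0_space v) (seq_space v))"
    and "\<not> lcs_isomorphic s X seq_scale (seq_space v)"
  shows "\<exists>D. module.subspace s D \<and> D \<subseteq> topspace X \<and> closedin X D \<and> \<not> finite_dim s D \<and>
    \<not> (\<exists>P. schauder_decomposition s (subtopology X D) P \<and>
           strongly_finite_dimensional s (subtopology X D) P)"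
proof (cases "\<exists>P. schauder_decomposition s X P \<and> strongly_finite_dimensional s X P")
  case False
  have "module.subspace s (topspace X)" using assms(2) by (simp add: frechet_space_def lcs_def)
  then show ?thesis using False assms(3) by (intro exI[of _ "topspace X"]) auto
next
  case True
  then obtain P where P: "schauder_decomposition s X P" "strongly_finite_dimensional s X P" by blast
  obtain p0 where "frechet v s X p0" using frechet_space_seminorms[OF assms(1,2)] by blast
  then interpret X0: schauder v s X p0 P using P(1) by (simp add: schauder_def schauder_axioms_def)
  obtain p where p: "orthogonal_schauder v s X p P" using X0.ex_orthogonal by blast
  interpret X: orthogonal_schauder v s X p P by (rule p)
  obtain N where N: "\<And>n. finite_dim s (P n ` topspace X)" "\<And>n. vector_space.dim s (P n ` topspace X) \<le> N"
    using P(2) unfolding strongly_finite_dimensional_def by blast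
  show ?thesis
  proof (cases "\<exists>m. \<forall>k. \<exists>R>0. \<exists>S. finite S \<and> (\<forall>n. n \<notin> S \<longrightarrow> (\<forall>x\<in>P n ` topspace X. p k x \<le> R * p m x))")
    case True
    then obtain m where "\<And>k. \<exists>R>0. \<exists>S. finite S \<and> (\<forall>n. n \<notin> S \<longrightarrow> (\<forall>x\<in>P n ` topspace X. p k x \<le> R * p m x))" by blast
    from X.ex_coordinates[OF N this] obtain A B and c :: "'b \<Rightarrow> nat \<times> 'b \<Rightarrow> 'k" where "coordinates v s X p A B c" by blast
    then show ?thesis using coordinates.isomorphic_to_exceptional assms(3-6) by blast
  next
    case False
    have "\<exists>k. \<forall>R>0. \<forall>S. finite S \<longrightarrow> (\<exists>n. n \<notin> S \<and> (\<exists>x\<in>P n ` topspace X. R * p m x < p k x))" for m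
    proof -
      have "\<not> (\<forall>k. \<exists>R>0. \<exists>S. finite S \<and> (\<forall>n. n \<notin> S \<longrightarrow> (\<forall>x\<in>P n ` topspace X. p k x \<le> R * p m x)))" using False by blast
      then show ?thesis by (simp add: not_le)
    qed
    then obtain \<kappa> where \<kappa>: "X.rich \<kappa>" using X.ex_rich by blast
    obtain d \<nu> y where "blocks v s X p P \<kappa> d \<nu> y" using X.ex_blocks[OF \<kappa>] by blast
    then interpret blocks v s X p P \<kappa> d \<nu> y .
    have "\<not> finite_dim s block_subspace" using block_subspace_infinite_dim \<kappa> by (simp add: X.rich_def)
    then show ?thesis
      using subspace_block_subspace closedin_block_subspace closedin_subset[OF closedin_block_subspace] no_strongly_finite_dimensional_decomposition
      by (intro exI[of _ block_subspace]) blast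
  qed
qed

end
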